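(* Let $(M,H)$ be an $n$-dimensional Carnot manifold, $a\in M$, $(X_1,\ldots,X_n)$ an $H$-frame near $a$, and let local coordinates $(x_1,\ldots,x_n)$ near $a$ be given. Then the change of coordinates $x\mapsto\varepsilon_a(x)$, where $\varepsilon_a$ is the $\varepsilon$-Carnot coordinate map at $a$ associated with these local coordinates and the $H$-frame, provides Carnot coordinates at $a$ adapted to the $H$-frame $(X_1,\ldots,X_n)$.
   Context: A Carnot manifold of step $r$ is a smooth manifold $M$ ($\dim M=n$) with a filtration by subbundles $H_1\subset\cdots\subset H_r=TM$ such that the Lie bracket of local sections of $H_w$ and $H_{w'}$ is a section of $H_{w+w'}$ whenever $w+w'\le r$. Its weights are $w_j=\min\{w:\ j\le \mathrm{rk}\,H_w\}$, $1\le j\le n$. An $H$-frame near $a$ is a tangent frame $(X_1,\ldots,X_n)$ near $a$ with each $X_j$ a section of $H_{w_j}$; then $[X_i,X_j]=\sum_{w_k\le w_i+w_j}L_{ij}^k X_k$ with smooth functions $L_{ij}^k$ near $a$. For $\alpha\in\mathbb{N}_0^n$: $|\alpha|=\sum\alpha_j$, $\langle\alpha\rangle=\sum w_j\alpha_j$. Dilations on $\mathbb{R}^n$: $\delta_t(x)=t\cdot x=(t^{w_1}x_1,\ldots,t^{w_n}x_n)$. For a vector field $X=\sum a_j(x)\partial_j$, $\delta_t^*X=\sum_j t^{-w_j}a_j(t\cdot x)\partial_j$. Order and privileged coordinates: for $I=(i_1,\ldots,i_k)$, $k\ge 0$, put $X_I=X_{i_1}\cdots X_{i_k}$, $\langle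 I\rangle=w_{i_1}+\cdots+w_{i_k}$. A smooth $f$ near $a$ has order $N$ at $a$ if $X_If(a)=0$ whenever $\langle I\rangle<N$ and $X_If(a)\ne0$ for some $I$ with $\langle I\rangle=N$. Local coordinates centered at $a$ are linearly adapted to the $H$-frame if $X_j(0)=\partial_j$ for all $j$; they are privileged coordinates at $a$ adapted to $(X_1,\ldots,X_n)$ if moreover each coordinate $x_j$ has order $w_j$ at $a$. In privileged coordinates, $t^{w_j}\delta_t^*X_j$ converges as $t\to0$ ($C^\infty$ uniformly on compact sets) to a polynomial vector field $X_j^{(a)}$ on $\mathbb{R}^n$, the model vector field of $X_j$. The group $G(a)$: equip $\mathbb{R}^n$, with canonical basis $(\epsilon_j)$, with the nilpotent Lie bracket $[\epsilon_i,\epsilon_j]=\sum_{w_k=w_i+w_j}L_{ij}^k(a)\epsilon_k$ (zero if $w_i+w_j>r$). $G(a)$ is $\mathbb{R}^n$ with the Dynkin (Baker-Campbell-Hausdorff) product $x\cdot y=x+y+\frac12[x,y]+\frac1{12}([x,[x,y]]+[y,[y,x]])+\cdots$ (finite sum). $X_j^a$ is the left-invariant vector field on $G(a)$ with $X_j^a(0)=\partial_j$. Carnot coordinates at $a$ adapted to $(X_1,\ldots,X_n)$ are privileged coordinates at $a$ adapted to $(X_1,\ldots,X_n)$ in which the model vector field of $X_j$ is $X_j^a$ for every $j$. The map $\varepsilon_a$: in the given local coordinates, $T_a$ is the unique affine map such that $x\mapsto T_a(x)$ gives coordinates centered at $a$ and linearly adapted to the $H$-frame. Starting from the latter coordinates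 there is (known fact) a unique polynomial change of coordinates $\hat\psi_a$ with components $\hat\psi_{a}(y)_k=y_k+\sum_{\langle\alpha\rangle<w_k,\,|\alpha|\ge2}a_{k\alpha}y^\alpha$, $a_{k\alpha}\in\mathbb{R}$, which produces privileged coordinates at $a$ adapted to the $H$-frame. Put $\psi_a=\hat\psi_a\circ T_a$; let $X_j^{(a)}$ be the model vector fields in the privileged coordinates given by $\psi_a$, and let $\exp_{X^{(a)}}(x)$ be the time-one flow of $x_1X_1^{(a)}+\cdots+x_nX_n^{(a)}$ starting at $0$ (this is a polynomial diffeomorphism of $\mathbb{R}^n$). Then $\varepsilon_a=\exp_{X^{(a)}}^{-1}\circ\psi_a:\mathbb{R}^n\to\mathbb{R}^n$. *)

theory Defs
  imports "HOL-Analysis.Analysis"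
begin

section \<open>Smooth manifolds, tangent vectors and vector fields\<close>

primrec Ck_on :: "nat \<Rightarrow> 'a::real_normed_vector set \<Rightarrow> ('a \<Rightarrow> 'b::real_normed_vector) \<Rightarrow> bool" where
  "Ck_on 0 S f \<longleftrightarrow> continuous_on S f"
| "Ck_on (Suc k) S f \<longleftrightarrow>
     (\<forall>x\<in>S. f differentiable (at x)) \<and> (\<forall>v. Ck_on k S (\<lambda>x. frechet_derivative f (at x) v))"

text \<open>Only used for open \<open>S\<close>.\<close>

definition smooth_on :: "'a::real_normed_vector set \<Rightarrow> ('a \<Rightarrow> 'b::real_normed_vector) \<Rightarrow> bool" where
  "smooth_on S f \<longleftrightarrow> (\<forall>k. Ck_on k S f)"

text \<open>A chart is a pair of a domain and a (total) map, of which only the values on the domain matter.\<close>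

type_synonym ('m, 'n) chart = "'m set \<times> ('m \<Rightarrow> real ^ 'n)"

definition chart_inv :: "('m, 'n) chart \<Rightarrow> real ^ 'n \<Rightarrow> 'm" where
  "chart_inv c = inv_into (fst c) (snd c)"

definition topological_chart :: "('m::topological_space, 'n::finite) chart \<Rightarrow> bool" where
  "topological_chart c \<longleftrightarrow> open (fst c) \<and> open (snd c ` fst c) \<and>
     homeomorphism (fst c) (snd c ` fst c) (snd c) (chart_inv c)"

definition transition :: "('m, 'n) chart \<Rightarrow> ('m, 'n) chart \<Rightarrow> real ^ 'n \<Rightarrow> real ^ 'n" where
  "transition c c' = snd c' \<circ> chart_inv c"

definition compatible_charts :: "('m, 'n::finite) chart \<Rightarrow> ('m, 'n) chart \<Rightarrow> bool" where
  "compatible_charts c c' \<longleftrightarrow>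
     smooth_on (snd c ` (fst c \<inter> fst c')) (transition c c') \<and>
     smooth_on (snd c' ` (fst c \<inter> fst c')) (transition c' c)"

text \<open>A smooth structure is a maximal atlas; local coordinates are then simply its elements.\<close>

definition smooth_structure :: "('m::topological_space, 'n::finite) chart set \<Rightarrow> bool" where
  "smooth_structure A \<longleftrightarrow>
     (\<forall>c\<in>A. topological_chart c) \<and>
     \<Union> (fst ` A) = UNIV \<and>
     (\<forall>c\<in>A. \<forall>c'\<in>A. compatible_charts c c') \<and>
     (\<forall>c. topological_chart c \<and> (\<forall>c'\<in>A. compatible_charts c c') \<longrightarrow> c \<in> A)"

text \<open>A tangent vector at \<open>p\<close> is the family of its component vectors in the charts around \<open>p\<close>,
  which are related by the differentials of the transition maps. It is set to \<open>0\<close> on all other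
  charts, so that evaluation at any chart around \<open>p\<close> identifies the tangent space with
  \<open>real ^ 'n\<close>.\<close>

type_synonym ('m, 'n) tvec = "('m, 'n) chart \<Rightarrow> real ^ 'n"

definition tangent_space :: "('m, 'n::finite) chart set \<Rightarrow> 'm \<Rightarrow> ('m, 'n) tvec set" where
  "tangent_space A p = {v.
     (\<forall>c. \<not> (c \<in> A \<and> p \<in> fst c) \<longrightarrow> v c = 0) \<and>
     (\<forall>c\<in>A. \<forall>c'\<in>A. p \<in> fst c \<inter> fst c' \<longrightarrow>
        v c' = frechet_derivative (transition c c') (at (snd c p)) (v c))}"

text \<open>The expression in the chart \<open>c\<close> of a vector field on the manifold.\<close>

definition rep :: "('m, 'n) chart \<Rightarrow> ('m \<Rightarrow> ('m, 'n) tvec) \<Rightarrow> real ^ 'n \<Rightarrow> real ^ 'n" where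
  "rep c X x = X (chart_inv c x) c"

definition smooth_vf ::
  "('m::topological_space, 'n::finite) chart set \<Rightarrow> 'm set \<Rightarrow> ('m \<Rightarrow> ('m, 'n) tvec) \<Rightarrow> bool" where
  "smooth_vf A U X \<longleftrightarrow> open U \<and> (\<forall>p\<in>U. X p \<in> tangent_space A p) \<and>
     (\<forall>c\<in>A. smooth_on (snd c ` (fst c \<inter> U)) (rep c X))"

definition lie_bracket ::
  "('m, 'n::finite) chart set \<Rightarrow> ('m \<Rightarrow> ('m, 'n) tvec) \<Rightarrow> ('m \<Rightarrow> ('m, 'n) tvec) \<Rightarrow> 'm \<Rightarrow> ('m, 'n) tvec" where
  "lie_bracket A X Y p = (\<lambda>c. if c \<in> A \<and> p \<in> fst c
     then frechet_derivative (rep c Y) (at (snd c p)) (X p c)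
        - frechet_derivative (rep c X) (at (snd c p)) (Y p c)
     else 0)"


section \<open>Carnot manifolds and \<open>H\<close>-frames\<close>

text \<open>Smooth subbundle of the tangent bundle of constant rank \<open>d\<close>, through local smooth frames.\<close>

definition subbundle ::
  "('m::topological_space, 'n::finite) chart set \<Rightarrow> nat \<Rightarrow> ('m \<Rightarrow> ('m, 'n) tvec set) \<Rightarrow> bool" where
  "subbundle A d B \<longleftrightarrow> (\<forall>p. B p \<subseteq> tangent_space A p) \<and>
     (\<forall>p. \<exists>U Y. open U \<and> p \<in> U \<and> (\<forall>i<d. smooth_vf A U (Y i)) \<and>
        (\<forall>q\<in>U. \<forall>c\<in>A. q \<in> fst c \<longrightarrow>
           (\<lambda>v. v c) ` B q = span ((\<lambda>i::nat. Y i q c) ` {..<d}) \<and>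
           dim ((\<lambda>v. v c) ` B q) = d))"

text \<open>Step \<open>r\<close>, filtration \<open>H 1, \<dots>, H r\<close>, with \<open>rk w\<close> the rank of \<open>H w\<close>;
  values of \<open>H\<close> and \<open>rk\<close> outside \<open>1, \<dots>, r\<close> play no role.\<close>

definition carnot_manifold ::
  "('m::topological_space, 'n::finite) chart set \<Rightarrow> nat \<Rightarrow> (nat \<Rightarrow> 'm \<Rightarrow> ('m, 'n) tvec set) \<Rightarrow> (nat \<Rightarrow> nat) \<Rightarrow> bool" where
  "carnot_manifold A r H rk \<longleftrightarrow> smooth_structure A \<and> 1 \<le> r \<and>
     (\<forall>w\<in>{1..r}. subbundle A (rk w) (H w)) \<and>
     (\<forall>w w' p. 1 \<le> w \<and> w \<le> w' \<and> w' \<le> r \<longrightarrow> H w p \<subseteq> H w' p) \<and>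
     (\<forall>p. H r p = tangent_space A p) \<and>
     (\<forall>w w' U X Y. 1 \<le> w \<and> 1 \<le> w' \<and> w + w' \<le> r \<and>
        smooth_vf A U X \<and> smooth_vf A U Y \<and>
        (\<forall>p\<in>U. X p \<in> H w p) \<and> (\<forall>p\<in>U. Y p \<in> H w' p) \<longrightarrow>
        (\<forall>p\<in>U. lie_bracket A X Y p \<in> H (w + w') p))"

text \<open>The linear order on the index type numbers the coordinates; \<open>card {..j}\<close> is the number
  of \<open>j\<close> among \<open>1, \<dots>, n\<close>.\<close>

definition weight :: "(nat \<Rightarrow> nat) \<Rightarrow> 'n::{finite,linorder} \<Rightarrow> nat" where
  "weight rk j = (LEAST w. 1 \<le> w \<and> card {..j} \<le> rk w)"

definition H_frame ::
  "('m::topological_space, 'n::{finite,linorder}) chart set \<Rightarrow> (nat \<Rightarrow> 'm \<Rightarrow> ('m, 'n) tvec set) \<Rightarrow> (nat \<Rightarrow> nat)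
    \<Rightarrow> 'm \<Rightarrow> 'm set \<Rightarrow> ('n \<Rightarrow> 'm \<Rightarrow> ('m, 'n) tvec) \<Rightarrow> bool" where
  "H_frame A H rk a W X \<longleftrightarrow> open W \<and> a \<in> W \<and>
     (\<forall>j. smooth_vf A W (X j)) \<and>
     (\<forall>j. \<forall>p\<in>W. X j p \<in> H (weight rk j) p) \<and>
     (\<forall>p\<in>W. \<forall>c\<in>A. p \<in> fst c \<longrightarrow>
        inj (\<lambda>j. X j p c) \<and> independent (range (\<lambda>j. X j p c)) \<and> span (range (\<lambda>j. X j p c)) = UNIV)"

text \<open>\<open>structure_coeff A X p i j $ k\<close> is the value at \<open>p\<close> of the function \<open>L_ij^k\<close>.\<close>

definition structure_coeff ::
  "('m, 'n::finite) chart set \<Rightarrow> ('n \<Rightarrow> 'm \<Rightarrow> ('m, 'n) tvec) \<Rightarrow> 'm \<Rightarrow> 'n \<Rightarrow> 'n \<Rightarrow> real ^ 'n" where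
  "structure_coeff A X p i j = (THE l. \<forall>c\<in>A. p \<in> fst c \<longrightarrow>
     lie_bracket A (X i) (X j) p c = (\<Sum>k\<in>UNIV. (l $ k) *\<^sub>R X k p c))"


section \<open>Dilations, order and privileged coordinates\<close>

definition dil :: "('n::finite \<Rightarrow> nat) \<Rightarrow> real \<Rightarrow> real ^ 'n \<Rightarrow> real ^ 'n" where
  "dil w t x = (\<chi> k. t ^ w k * x $ k)"

definition dil_pullback ::
  "('n::finite \<Rightarrow> nat) \<Rightarrow> real \<Rightarrow> (real ^ 'n \<Rightarrow> real ^ 'n) \<Rightarrow> real ^ 'n \<Rightarrow> real ^ 'n" where
  "dil_pullback w t Z x = (\<chi> k. Z (dil w t x) $ k / t ^ w k)"

primrec deriv_word ::
  "('n \<Rightarrow> real ^ 'n \<Rightarrow> real ^ 'n) \<Rightarrow> 'n list \<Rightarrow> (real ^ 'n \<Rightarrow> real) \<Rightarrow> real ^ 'n \<Rightarrow> real" where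
  "deriv_word Z [] f = f"
| "deriv_word Z (i # I) f = (\<lambda>x. frechet_derivative (deriv_word Z I f) (at x) (Z i x))"

definition has_order ::
  "('n \<Rightarrow> nat) \<Rightarrow> ('n::finite \<Rightarrow> real ^ 'n \<Rightarrow> real ^ 'n) \<Rightarrow> (real ^ 'n \<Rightarrow> real) \<Rightarrow> nat \<Rightarrow> real ^ 'n \<Rightarrow> bool" where
  "has_order w Z f N x \<longleftrightarrow>
     (\<forall>I. sum_list (map w I) < N \<longrightarrow> deriv_word Z I f x = 0) \<and>
     (\<exists>I. sum_list (map w I) = N \<and> deriv_word Z I f x \<noteq> 0)"

definition linearly_adapted ::
  "('m, 'n::finite) chart set \<Rightarrow> ('n \<Rightarrow> 'm \<Rightarrow> ('m, 'n) tvec) \<Rightarrow> 'm \<Rightarrow> ('m, 'n) chart \<Rightarrow> bool" where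
  "linearly_adapted A X a c \<longleftrightarrow> c \<in> A \<and> a \<in> fst c \<and> snd c a = 0 \<and> (\<forall>j. rep c (X j) 0 = axis j 1)"

definition privileged_coordinates ::
  "('m, 'n::{finite,linorder}) chart set \<Rightarrow> (nat \<Rightarrow> nat) \<Rightarrow> ('n \<Rightarrow> 'm \<Rightarrow> ('m, 'n) tvec) \<Rightarrow> 'm
    \<Rightarrow> ('m, 'n) chart \<Rightarrow> bool" where
  "privileged_coordinates A rk X a c \<longleftrightarrow> linearly_adapted A X a c \<and>
     (\<forall>j. has_order (weight rk) (\<lambda>i. rep c (X i)) (\<lambda>x. x $ j) (weight rk j) 0)"

primrec partial_deriv ::
  "'n::finite list \<Rightarrow> (real ^ 'n \<Rightarrow> real ^ 'n) \<Rightarrow> real ^ 'n \<Rightarrow> real ^ 'n" where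
  "partial_deriv [] Z = Z"
| "partial_deriv (i # I) Z = (\<lambda>x. frechet_derivative (partial_deriv I Z) (at x) (axis i 1))"

text \<open>\<open>Y\<close> is the model vector field of \<open>Z\<close>, a field of weight \<open>d\<close> near \<open>0\<close>: all partial
  derivatives of \<open>t ^ d\<close> times the dilated field converge uniformly on compact sets as \<open>t\<close> tends
  to \<open>0\<close>. On a given compact set the dilated field only involves values of \<open>Z\<close> near \<open>0\<close> once
  \<open>t\<close> is small.\<close>

definition is_model_field ::
  "('n::finite \<Rightarrow> nat) \<Rightarrow> nat \<Rightarrow> (real ^ 'n \<Rightarrow> real ^ 'n) \<Rightarrow> (real ^ 'n \<Rightarrow> real ^ 'n) \<Rightarrow> bool" where
  "is_model_field w d Z Y \<longleftrightarrow> polynomial_function Y \<and>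
     (\<forall>K I. compact K \<longrightarrow>
        uniform_limit K (\<lambda>t. partial_deriv I (\<lambda>x. t ^ d *\<^sub>R dil_pullback w t Z x)) (partial_deriv I Y) (at 0))"


section \<open>The group \<open>G(a)\<close> and Carnot coordinates\<close>

definition lie_alg_bracket ::
  "('n::finite \<Rightarrow> nat) \<Rightarrow> ('n \<Rightarrow> 'n \<Rightarrow> real ^ 'n) \<Rightarrow> real ^ 'n \<Rightarrow> real ^ 'n \<Rightarrow> real ^ 'n" where
  "lie_alg_bracket w L x y = (\<Sum>i\<in>UNIV. \<Sum>j\<in>UNIV. (x $ i * y $ j) *\<^sub>R
     (\<Sum>k | w k = w i + w j. (L i j $ k) *\<^sub>R axis k 1))"

fun nested_bracket :: "('v \<Rightarrow> 'v \<Rightarrow> 'v) \<Rightarrow> 'v::zero list \<Rightarrow> 'v" where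
  "nested_bracket br [] = 0"
| "nested_bracket br [v] = v"
| "nested_bracket br (v # u # vs) = br v (nested_bracket br (u # vs))"

text \<open>Dynkin's formula
  \<open>\<Sum>m (-1)^(m+1)/m \<Sum>(p_i,q_i) [x^p_1 y^q_1 \<dots> x^p_m y^q_m] / ((\<Sum>i p_i+q_i) \<Prod>i p_i! q_i!)\<close>
  with right-nested brackets and \<open>p_i + q_i > 0\<close>, for a Lie algebra which is nilpotent of step
  \<open>r\<close>: terms of total degree greater than \<open>r\<close> vanish and are left out.\<close>

definition dynkin_product :: "nat \<Rightarrow> ('v \<Rightarrow> 'v \<Rightarrow> 'v) \<Rightarrow> 'v \<Rightarrow> 'v \<Rightarrow> 'v::real_vector" where
  "dynkin_product r br x y =
     (\<Sum>m\<in>{1..r}. \<Sum>ps\<in>{ps :: (nat \<times> nat) list. length ps = m \<and> (\<forall>(p, q)\<in>set ps. p + q > 0) \<and>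
                                     (\<Sum>(p, q)\<leftarrow>ps. p + q) \<le> r}.
        ((-1) ^ (m + 1) / (real m * real (\<Sum>(p, q)\<leftarrow>ps. p + q) * (\<Prod>(p, q)\<leftarrow>ps. fact p * fact q))) *\<^sub>R
        nested_bracket br (concat (map (\<lambda>(p, q). replicate p x @ replicate q y) ps)))"

definition group_mult ::
  "('m, 'n::{finite,linorder}) chart set \<Rightarrow> nat \<Rightarrow> (nat \<Rightarrow> nat) \<Rightarrow> ('n \<Rightarrow> 'm \<Rightarrow> ('m, 'n) tvec) \<Rightarrow> 'm
    \<Rightarrow> real ^ 'n::{finite,linorder} \<Rightarrow> real ^ 'n::{finite,linorder} \<Rightarrow> real ^ 'n::{finite,linorder}" where
  "group_mult A r rk X a = dynkin_product r (lie_alg_bracket (weight rk) (structure_coeff A X a))"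

text \<open>The left-invariant vector field with value \<open>axis j 1\<close> at the unit \<open>0\<close>: its value at \<open>x\<close> is the
  image of that vector under the differential at \<open>0\<close> of the left translation by \<open>x\<close>.\<close>

definition left_invariant_field ::
  "(real ^ 'n \<Rightarrow> real ^ 'n \<Rightarrow> real ^ 'n) \<Rightarrow> 'n::finite \<Rightarrow> real ^ 'n \<Rightarrow> real ^ 'n" where
  "left_invariant_field law j x = frechet_derivative (\<lambda>y. law x y) (at 0) (axis j 1)"

definition carnot_coordinates ::
  "('m, 'n::{finite,linorder}) chart set \<Rightarrow> nat \<Rightarrow> (nat \<Rightarrow> nat) \<Rightarrow> ('n \<Rightarrow> 'm \<Rightarrow> ('m, 'n) tvec) \<Rightarrow> 'm
    \<Rightarrow> ('m, 'n) chart \<Rightarrow> bool" where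
  "carnot_coordinates A r rk X a c \<longleftrightarrow> privileged_coordinates A rk X a c \<and>
     (\<forall>j. is_model_field (weight rk) (weight rk j) (rep c (X j))
            (left_invariant_field (group_mult A r rk X a) j))"


section \<open>The map \<open>\<epsilon>\<^sub>a\<close>\<close>

definition affine_map :: "('a::real_vector \<Rightarrow> 'b::real_vector) \<Rightarrow> bool" where
  "affine_map T \<longleftrightarrow> (\<exists>B b. linear B \<and> T = (\<lambda>x. B x + b))"

text \<open>The shape required of the polynomial change of coordinates: \<open>y_k\<close> plus monomials
  \<open>y^\<alpha>\<close> with \<open>\<langle>\<alpha>\<rangle> < w_k\<close> and \<open>|\<alpha>| \<ge> 2\<close>. As weights are positive, there are finitely many.\<close>

definition lower_weight_polynomial_map ::
  "('n::finite \<Rightarrow> nat) \<Rightarrow> (real ^ 'n \<Rightarrow> real ^ 'n) \<Rightarrow> bool" where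
  "lower_weight_polynomial_map w P \<longleftrightarrow> (\<exists>coef :: 'n \<Rightarrow> ('n \<Rightarrow> nat) \<Rightarrow> real. \<forall>y k.
     P y $ k = y $ k +
       (\<Sum>\<alpha> | (\<Sum>i\<in>UNIV. w i * \<alpha> i) < w k \<and> 2 \<le> (\<Sum>i\<in>UNIV. \<alpha> i).
          coef k \<alpha> * (\<Prod>i\<in>UNIV. (y $ i) ^ \<alpha> i)))"

text \<open>Time-one flow of \<open>\<Sum>j x_j Y_j\<close> starting at \<open>0\<close>.\<close>

definition exp_fields :: "('n \<Rightarrow> real ^ 'n \<Rightarrow> real ^ 'n) \<Rightarrow> real ^ 'n \<Rightarrow> real ^ 'n::finite" where
  "exp_fields Y x = (THE z. \<exists>\<gamma>. \<gamma> 0 = 0 \<and> \<gamma> 1 = z \<and>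
     (\<forall>t\<in>{0..1}. (\<gamma> has_vector_derivative (\<Sum>j\<in>UNIV. (x $ j) *\<^sub>R Y j (\<gamma> t))) (at t within {0..1::real})))"

text \<open>\<open>\<epsilon>\<close> is the \<open>\<epsilon>\<close>-Carnot coordinate map at \<open>a\<close> associated with the local coordinates \<open>c\<close>.
  The objects \<open>T\<close>, \<open>P\<close> and \<open>Y j\<close> (namely \<open>T\<^sub>a\<close>, the polynomial map, and the model vector fields)
  are uniquely determined by the properties by which they are described.\<close>

definition eps_carnot_map ::
  "('m, 'n::{finite,linorder}) chart set \<Rightarrow> (nat \<Rightarrow> nat) \<Rightarrow> ('n \<Rightarrow> 'm \<Rightarrow> ('m, 'n) tvec) \<Rightarrow> 'm
    \<Rightarrow> ('m, 'n) chart \<Rightarrow> (real ^ 'n::{finite,linorder} \<Rightarrow> real ^ 'n::{finite,linorder}) \<Rightarrow> bool" where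
  "eps_carnot_map A rk X a c \<epsilon> \<longleftrightarrow> (\<exists>T P Y.
     affine_map T \<and> linearly_adapted A X a (fst c, T \<circ> snd c) \<and>
     lower_weight_polynomial_map (weight rk) P \<and>
     privileged_coordinates A rk X a (fst c, P \<circ> T \<circ> snd c) \<and>
     (\<forall>j. is_model_field (weight rk) (weight rk j) (rep (fst c, P \<circ> T \<circ> snd c) (X j)) (Y j)) \<and>
     \<epsilon> = inv (exp_fields Y) \<circ> (P \<circ> T))"

end

theory Submission
  imports Defs
begin

text \<open>
  In the privileged coordinates given by \<open>\<psi>\<^sub>a\<close>, rescaling the relations between the \<open>X\<^sub>j\<close> shows that the
  model fields \<open>Y\<^sub>j\<close> are homogeneous and satisfy the bracket relations of the Lie algebra of \<open>G(a)\<close>. Hence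
  the flow equation of \<open>\<Sum> x\<^sub>j Y\<^sub>j\<close> is triangular, its time-one map \<open>exp\<close> is a polynomial diffeomorphism that
  commutes with dilations, and the linearised flow equation gives
  \<open>d exp\<^sub>x (v) = Y\<^bsub>\<Psi> v\<^esub> (exp x)\<close> with \<open>\<Psi> = (1 - e\<^sup>-\<^sup>a\<^sup>d\<^sup>x) / ad x\<close>. A left-invariant field of \<open>G(a)\<close> only sees the
  part of the Dynkin series that is linear in \<open>y\<close>, which is \<open>\<Psi>\<close> inverted; so \<open>exp\<close> pulls \<open>Y\<^sub>j\<close> back to
  the left-invariant field. As \<open>exp\<close> commutes with dilations, these pullbacks are the model fields in the
  new coordinates, and convergence to model fields already forces the coordinates to have the right
  orders.
\<close>

section \<open>The linear part of the Dynkin product\<close>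

text \<open>The group and the flow are compared through two power series in \<open>ad x\<close>. On
  the group side, the letters after a single \<open>y\<close> in a right-nested bracket must be none
  or one \<open>x\<close>, since a bracket of several \<open>x\<close> is 0. So the linear part of
  Dynkin's series is a series in \<open>ad x\<close>, and it sums to z / (1 - e^(-z)), the
  generating function of B_n / n! for the Bernoulli numbers with B_1 = 1/2. On the flow side, (1 -
  e^(-z)) / z is the integral of e^(-sz) over 0 \<le> s \<le> 1: variation of constants for c' = v -
  [x, c]. Nilpotency makes both series finite. Two constraints shape the analysis. A frame is given
  only near \<open>a\<close>, so its dilates are controlled on a given compact set only for small
  parameters; convergence statements therefore ask for regularity eventually and on compact sets.
  And component k of a model field depends only on coordinates of weight below w_k, so existence,
  uniqueness and inversion become inductions on the weight.\<close>

text \<open>\<open>block_gf m\<close> is the generating function, in the number of letters \<open>x\<close>, of the contribution to the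
  Dynkin series of the \<open>m\<close>-block words with exactly one letter \<open>y\<close>; such a word only survives if at
  most one \<open>x\<close> follows the \<open>y\<close>. With \<open>u = e\<^sup>z - 1\<close>, summing over \<open>m\<close> amounts to \<open>z = ln (1 + u)\<close>.\<close>

definition block_gf :: "nat \<Rightarrow> real fps" where
  "block_gf m = (if m = 0 then 0 else if m = 1 then fps_exp 1
     else (fps_exp 1 - 1) ^ (m - 2) * (fps_exp 1 - 1 - fps_X) * fps_exp 1)"

text \<open>The series \<open>(1 - e\<^sup>-\<^sup>z) / z\<close>, whose inverse turns out to be the linear part of the Dynkin series.\<close>

definition dexp_series :: "real fps" where
  "dexp_series = Abs_fps (\<lambda>l. (-1) ^ l / fact (Suc l))"

text \<open>A further block without \<open>y\<close> in front contributes the factor e^z - 1. The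
  correction at m = 1 comes from the pair of blocks \<open>x^p y\<close> and \<open>x\<close>, where
  [y, x] brings the minus sign.\<close>

lemma block_gf_Suc:
  assumes "1 \<le> m"
  shows "block_gf (Suc m) = (fps_exp 1 - 1) * block_gf m - (if m = 1 then fps_X * fps_exp 1 else 0)"
proof (cases "m = 1")
  case False
  then have "m - 1 = Suc (m - 2)" using assms by simp
  then show ?thesis using False assms by (simp add: block_gf_def algebra_simps)
qed (simp add: block_gf_def algebra_simps)

text \<open>With F defined by ln (1 + X) = X + X^2 F, the terms m \<ge> 2 add up to F(u) (u - z)
  e^z, and F(u) = (z - u) / u^2. As u has no constant term it is not a unit, so the sum is described
  by its multiple u^2 T. Stopping at m = r is harmless: the later terms are divisible by
  z^r.\<close>

lemma sum_block_gf:
  defines "u \<equiv> fps_exp 1 - (1 :: real fps)"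
  assumes T: "u\<^sup>2 * T = fps_exp 1 * (2 * u * fps_X - fps_X\<^sup>2)" and "N < r"
  shows "(\<Sum>m=1..r. (-1) ^ (m + 1) / real m * fps_nth (block_gf m) N) = fps_nth T N"
proof -
  define F where "F = Abs_fps (\<lambda>i. (-1) ^ (i + 1) / real (i + 2))"
  have u0: "fps_nth u 0 = 0" and u1: "fps_nth u 1 = 1" by (simp_all add: u_def)
  have Ln: "fps_ln 1 = fps_X + fps_X ^ 2 * F"
  proof (rule fps_ext)
    fix n
    show "fps_nth (fps_ln 1) n = fps_nth (fps_X + fps_X ^ 2 * F) n"
    proof (cases "n < 2")
      case True
      then show ?thesis by (cases n) (auto simp: fps_ln_nth fps_X_power_mult_nth)
    next
      case False
      then obtain k where "n = Suc (Suc k)" by (metis add_2_eq_Suc le_Suc_ex not_less)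
      then show ?thesis by (simp add: fps_ln_nth fps_X_power_mult_nth F_def)
    qed
  qed
  have "fps_ln 1 oo u = fps_X"
    unfolding u_def by (subst fps_ln_fps_exp_inv) (auto intro!: fps_inv)
  then have X: "fps_X = u + u\<^sup>2 * (F oo u)"
    unfolding Ln using u0 by (simp add: fps_compose_add_distrib fps_compose_mult_distrib flip: fps_compose_power)
  have "u\<^sup>2 * T = u\<^sup>2 * (fps_exp 1 + (F oo u) * (u - fps_X) * fps_exp 1)"
    unfolding T using X by algebra
  moreover have "u \<noteq> 0" using u1 by auto
  ultimately have T2: "T = fps_exp 1 + (F oo u) * (u - fps_X) * fps_exp 1" by simp
  obtain k where r: "r = Suc k" using assms(3) by (cases r) auto
  \<comment> \<open>The index i stands for m = i + 2, so the powers below k are the terms m = 2,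
    ..., r, and R collects the tail.\<close>
  define R where "R = fps_shift k F"
  have "F = (\<Sum>i<k. fps_const (fps_nth F i) * fps_X ^ i) + fps_X ^ k * R"
    by (rule fps_ext) (simp add: fps_sum_nth fps_X_power_mult_nth R_def if_distrib cong: if_cong)
  then have "F oo u = ((\<Sum>i<k. fps_const (fps_nth F i) * fps_X ^ i) + fps_X ^ k * R) oo u"
    by (rule arg_cong)
  also have "\<dots> = (\<Sum>i<k. fps_const (fps_nth F i) * u ^ i) + u ^ k * (R oo u)"
    using u0 by (simp add: fps_compose_add_distrib fps_compose_sum_distrib fps_compose_mult_distrib
        flip: fps_compose_power)
  finally have "T = fps_exp 1 + (\<Sum>i<k. fps_const (fps_nth F i) * (u ^ i * (u - fps_X) * fps_exp 1))
     + u ^ k * (u - fps_X) * ((R oo u) * fps_exp 1)"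
    unfolding T2 by (simp add: sum_distrib_right algebra_simps sum_distrib_left)
  moreover have "fps_nth (u ^ k * (u - fps_X) * ((R oo u) * fps_exp 1)) N = 0"
  proof -
    have "fps_X dvd f" if "fps_nth f 0 = 0" for f :: "real fps"
    proof
      show "f = fps_X * fps_shift 1 f" using that by (intro fps_ext) simp
    qed
    then have "fps_X dvd u" "fps_X dvd u - fps_X" using u0 by auto
    then have "fps_X ^ r dvd u ^ k * (u - fps_X)" unfolding r
      by (metis dvd_power_same mult.commute mult_dvd_mono power_Suc)
    then obtain g where "u ^ k * (u - fps_X) = fps_X ^ r * g" by auto
    then show ?thesis using assms(3) by (simp add: mult.assoc fps_X_power_mult_nth)
  qed
  ultimately have "fps_nth T N = fps_nth (fps_exp 1) N + (\<Sum>i<k. fps_nth F i * fps_nth (u ^ i * (u - fps_X) * fps_exp 1) N)"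
    by (simp add: fps_sum_nth)
  also have "(\<Sum>i<k. fps_nth F i * fps_nth (u ^ i * (u - fps_X) * fps_exp 1) N) =
      (\<Sum>m=2..r. (-1) ^ (m + 1) / real m * fps_nth (block_gf m) N)"
    by (rule sum.reindex_bij_witness[of _ "\<lambda>m. m - 2" "\<lambda>i. i + 2"])
       (auto simp: F_def block_gf_def r u_def)
  finally show ?thesis
    using r by (simp add: sum.atLeast_Suc_atMost numeral_2_eq_2 block_gf_def)
qed

text \<open>The divisor N + 1 is the total degree of a word with N letters \<open>x\<close> and one
  \<open>y\<close>, which Dynkin's formula has in its denominator.\<close>

definition dynkin_coeff :: "nat \<Rightarrow> nat \<Rightarrow> real" where
  "dynkin_coeff r N = (\<Sum>m=1..r. (-1) ^ (m + 1) / real m * fps_nth (block_gf m) N) / real (Suc N)"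

text \<open>Below index r these are the coefficients of P = z / (1 - e^(-z)). Multiplication by N +
  1 means passing to the derivative of z P, and from u P = z e^z this derivative satisfies the
  equation asked of T in \<open>sum_block_gf\<close>.\<close>

lemma dynkin_coefficients:
  assumes "n < r"
  shows "(\<Sum>i\<le>n. fps_nth dexp_series i * dynkin_coeff r (n - i)) = (if n = 0 then 1 else 0)"
proof -
  define u where "u = fps_exp 1 - (1 :: real fps)"
  define P where "P = inverse dexp_series"
  have "fps_nth dexp_series 0 \<noteq> 0" by (simp add: dexp_series_def)
  then have P: "P * dexp_series = 1" unfolding P_def by (simp add: inverse_mult_eq_1)
  have "fps_X * dexp_series = 1 - fps_exp (-1)"
  proof (rule fps_ext)
    fix n
    show "fps_nth (fps_X * dexp_series) n = fps_nth (1 - fps_exp (-1)) n"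
      by (cases n) (simp_all add: dexp_series_def fps_exp_def)
  qed
  moreover have "fps_exp (-1) * fps_exp (1::real) = 1" by (simp flip: fps_exp_add_mult)
  ultimately have "fps_X * dexp_series * fps_exp 1 = u" unfolding u_def by algebra
  then have "u * P = fps_X * (P * dexp_series) * fps_exp 1" by (simp add: mult_ac)
  then have Pu: "u * P = fps_X * fps_exp 1" using P by simp
  have du: "fps_deriv u = fps_exp 1" by (simp add: u_def)
  have "fps_deriv (u * (fps_X * P)) = fps_deriv (fps_X\<^sup>2 * fps_exp 1)"
    using Pu by (simp add: power2_eq_square mult.assoc mult.left_commute)
  then have "fps_exp 1 * (fps_X * P) + u * fps_deriv (fps_X * P) = 2 * fps_X * fps_exp 1 + fps_X\<^sup>2 * fps_exp 1"
    using du by (simp add: power2_eq_square algebra_simps)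
  moreover have "u = fps_exp 1 - 1" by (simp add: u_def)
  ultimately have T: "u\<^sup>2 * fps_deriv (fps_X * P) = fps_exp 1 * (2 * u * fps_X - fps_X\<^sup>2)"
    using Pu by algebra
  have *: "(\<Sum>m=1..r. (-1) ^ (m + 1) / real m * fps_nth (block_gf m) N) =
      fps_nth (fps_deriv (fps_X * P)) N" if "N < r" for N
    by (rule sum_block_gf[OF T[unfolded u_def] that])
  have "fps_nth (fps_deriv (fps_X * P)) N = real (Suc N) * fps_nth P N" for N
    by (auto simp: algebra_simps)
  then have C: "dynkin_coeff r N = fps_nth P N" if "N < r" for N
    unfolding dynkin_coeff_def *[OF that] by (simp del: of_nat_Suc)
  have "(\<Sum>i\<le>n. fps_nth dexp_series i * dynkin_coeff r (n - i)) = fps_nth (dexp_series * P) n"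
    unfolding fps_mult_nth atLeast0AtMost using C assms(1) by (auto intro!: sum.cong)
  then show ?thesis using P by (simp add: mult.commute)
qed


lemma polynomial_function_bilinear:
  fixes br :: "'b::euclidean_space \<Rightarrow> 'c::euclidean_space \<Rightarrow> 'd::euclidean_space"
  assumes "bilinear br" "polynomial_function f" "polynomial_function g"
  shows "polynomial_function (\<lambda>x. br (f x) (g x))"
proof -
  have 1: "br u v = (\<Sum>(i, j)\<in>Basis \<times> Basis. (u \<bullet> i) *\<^sub>R (v \<bullet> j) *\<^sub>R br i j)" for u v
  proof -
    have "br u v = br (\<Sum>i\<in>Basis. (u \<bullet> i) *\<^sub>R i) (\<Sum>j\<in>Basis. (v \<bullet> j) *\<^sub>R j)"
      by (simp add: euclidean_representation)
    also have "\<dots> = (\<Sum>(i, j)\<in>Basis \<times> Basis. br ((u \<bullet> i) *\<^sub>R i) ((v \<bullet> j) *\<^sub>R j))"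
      using assms(1) by (rule bilinear_sum)
    finally show ?thesis
      using assms(1) by (simp add: bilinear_lmul bilinear_rmul case_prod_unfold)
  qed
  have p: "polynomial_function (\<lambda>x. (f x \<bullet> i) *\<^sub>R (g x \<bullet> j) *\<^sub>R c)" for i j and c :: 'd
    by (rule polynomial_function_mult[OF polynomial_function_inner[OF assms(2)]
        polynomial_function_mult[OF polynomial_function_inner[OF assms(3)] polynomial_function_const]])
  have "polynomial_function (\<lambda>x. \<Sum>(i, j)\<in>Basis \<times> Basis. (f x \<bullet> i) *\<^sub>R (g x \<bullet> j) *\<^sub>R br i j)"
    unfolding case_prod_unfold by (rule polynomial_function_sum) (simp, rule p)
  then show ?thesis by (subst 1)
qed

section \<open>Words with exactly one letter \<open>y\<close>\<close>

definition block_word :: "bool list \<Rightarrow> 'v \<Rightarrow> 'v \<Rightarrow> 'v list" where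
  "block_word bs x y = map (\<lambda>b. if b then y else x) bs"

text \<open>Recording only the positions of \<open>y\<close> fixes the shape of a word while the
  vectors vary, so that scaling and polynomiality in \<open>y\<close> become inductions over the
  flags.\<close>

definition block_flags :: "(nat \<times> nat) list \<Rightarrow> bool list" where
  "block_flags ps = concat (map (\<lambda>(p, q). replicate p False @ replicate q True) ps)"

lemma block_word_flags:
  "concat (map (\<lambda>(p, q). replicate p x @ replicate q y) ps) = block_word (block_flags ps) x y"
  by (induction ps) (auto simp: block_word_def block_flags_def)

lemma count_block_flags: "count_list (block_flags ps) True = sum_list (map snd ps)"
proof -
  have "count_list (replicate n b) True = (if b then n else 0)" for n b by (induction n) auto
  then show ?thesis by (induction ps) (auto simp: block_flags_def count_list_append)
qed

definition blocks :: "nat \<Rightarrow> nat \<Rightarrow> nat \<Rightarrow> (nat \<times> nat) list set" where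
  "blocks m N q = {ps. length ps = m \<and> (\<forall>(p, q)\<in>set ps. p + q > 0) \<and>
     sum_list (map fst ps) = N \<and> sum_list (map snd ps) = q}"

lemma finite_blocks: "finite (blocks m N q)"
proof (rule finite_subset)
  show "blocks m N q \<subseteq> {ps. set ps \<subseteq> {..N} \<times> {..q} \<and> length ps = m}"
  proof -
    have "p \<le> sum_list (map fst ps)" "q \<le> sum_list (map snd ps)" if "(p, q) \<in> set ps" for p q and ps :: "(nat \<times> nat) list"
      using that member_le_sum_list[of p "map fst ps"] member_le_sum_list[of q "map snd ps"] by force+
    then show ?thesis by (auto simp: blocks_def)
  qed
qed (simp add: finite_lists_length_eq)

definition block_fact :: "(nat \<times> nat) list \<Rightarrow> real" where
  "block_fact ps = (\<Prod>(p, q)\<leftarrow>ps. fact p * fact q)"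

text \<open>A first block without \<open>y\<close> needs p \<ge> 1, as blocks are nonempty; a first
  block containing the only \<open>y\<close> may have p = 0. Hence the two different ranges.\<close>

lemma blocks_1_Suc:
  "blocks (Suc m) N 1 = (\<lambda>(p, ps). (p, 0) # ps) ` (SIGMA p:{1..N}. blocks m (N - p) 1) \<union>
     (\<lambda>(p, ps). (p, 1) # ps) ` (SIGMA p:{..N}. blocks m (N - p) 0)" (is "_ = ?R")
proof
  show "blocks (Suc m) N 1 \<subseteq> ?R"
  proof
    fix qs assume *: "qs \<in> blocks (Suc m) N 1"
    then obtain p q ps where "qs = (p, q) # ps" unfolding blocks_def by (cases qs) auto
    then show "qs \<in> ?R" using * by (cases q) (auto simp: blocks_def image_iff)
  qed
qed (auto simp: blocks_def)

locale alternating_bracket =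
  fixes br :: "'v::euclidean_space \<Rightarrow> 'v \<Rightarrow> 'v"
  assumes bilinear_br: "bilinear br" and br_self [simp]: "br x x = 0"
begin

lemma br_0 [simp]: "br x 0 = 0" "br 0 x = 0"
  using bilinear_br by (simp_all add: bilinear_lzero bilinear_rzero)

lemma br_swap: "br y x = - br x y"
proof -
  have "br (x + y) (x + y) = br x y + br y x"
    using bilinear_br by (simp add: bilinear_ladd bilinear_radd del: br_self) simp
  then show ?thesis by (simp add: eq_neg_iff_add_eq_0 add.commute)
qed

lemma linear_ad: "linear (br x)" and linear_ad_funpow: "linear (br x ^^ n)"
proof -
  show 1: "linear (br x)" using bilinear_br by (simp add: bilinear_def)
  show "linear (br x ^^ n)"
    by (induction n) (use 1 in \<open>simp_all add: bounded_linear.linear[OF bounded_linear_ident] linear_compose[unfolded o_def] id_def o_def\<close>)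
qed

lemma nested_bracket_Cons: "ws \<noteq> [] \<Longrightarrow> nested_bracket br (x # ws) = br x (nested_bracket br ws)"
  by (cases ws) auto

lemma nested_bracket_replicate:
  "ws \<noteq> [] \<Longrightarrow> nested_bracket br (replicate p x @ ws) = (br x ^^ p) (nested_bracket br ws)"
  by (induction p) (auto simp: nested_bracket_Cons)

lemma nested_bracket_const: "nested_bracket br (replicate M x) = (if M = 1 then x else 0)"
proof (induction M)
  case (Suc M)
  then show ?case by (cases M) (auto simp: nested_bracket_Cons)
qed simp

lemma nested_block_word_scale:
  "nested_bracket br (block_word bs x (s *\<^sub>R y)) =
     s ^ count_list bs True *\<^sub>R nested_bracket br (block_word bs x y)"
proof (induction bs)
  case (Cons b bs)
  show ?case
  proof (cases "bs = []")
    case False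
    then have "nested_bracket br (block_word (b # bs) x z) =
        br (if b then z else x) (nested_bracket br (block_word bs x z))" for z
      by (simp add: block_word_def nested_bracket_Cons)
    then show ?thesis using Cons bilinear_br by (simp add: bilinear_lmul bilinear_rmul)
  qed (simp add: block_word_def)
qed (simp add: block_word_def)

lemma polynomial_nested_block_word:
  "polynomial_function (\<lambda>y. nested_bracket br (block_word bs x y))"
proof (induction bs)
  case Nil
  show ?case unfolding block_word_def by simp
next
  case (Cons b bs)
  have b: "polynomial_function (\<lambda>z. if b then z else x)" by (cases b) simp_all
  show ?case
  proof (cases "bs = []")
    case True
    then have *: "nested_bracket br (block_word (b # bs) x z) = (if b then z else x)" for z
      by (simp add: block_word_def)
    show ?thesis unfolding * by (rule b)
  next
    case False
    then have *: "nested_bracket br (block_word (b # bs) x z) =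
        br (if b then z else x) (nested_bracket br (block_word bs x z))" for z
      by (simp add: block_word_def nested_bracket_Cons)
    show ?thesis unfolding * by (rule polynomial_function_bilinear[OF bilinear_br b Cons.IH])
  qed
qed

definition block_val :: "'v \<Rightarrow> 'v \<Rightarrow> (nat \<times> nat) list \<Rightarrow> 'v" where
  "block_val x y ps = nested_bracket br (block_word (block_flags ps) x y)"

lemma block_flags_Cons [simp]:
  "block_flags ((p, q) # ps) = replicate p False @ replicate q True @ block_flags ps"
  by (simp add: block_flags_def)

lemma block_flags_ne: "sum_list (map snd ps) \<noteq> 0 \<Longrightarrow> block_flags ps \<noteq> []"
  using count_block_flags[of ps] by (metis count_list.simps(1))

lemma block_val_Cons_0:
  assumes "ps \<in> blocks m N 1"
  shows "block_val x y ((p, 0) # ps) = (br x ^^ p) (block_val x y ps)"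
proof -
  have "block_flags ps \<noteq> []" using assms by (intro block_flags_ne) (simp add: blocks_def)
  then show ?thesis by (simp add: block_val_def block_word_def nested_bracket_replicate)
qed

lemma block_flags_replicate: "sum_list (map snd ps) = 0 \<Longrightarrow>
    block_flags ps = replicate (sum_list (map fst ps)) False"
  by (induction ps) (auto simp: block_flags_def replicate_add)

text \<open>After the \<open>y\<close> come M letters \<open>x\<close>: a single one gives [y, x] =
  - [x, y], and two or more have a vanishing bracket among themselves.\<close>

lemma block_val_Cons_1:
  assumes "ps \<in> blocks m M 0"
  shows "block_val x y ((p, 1) # ps) =
    (if M = 0 then (br x ^^ p) y else if M = 1 then - (br x ^^ Suc p) y else 0)"
proof (cases "M = 0")
  case True
  with assms have "block_flags ps = []"
    by (simp add: blocks_def block_flags_replicate)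
  then show ?thesis using True nested_bracket_replicate[of "[y]" p x]
    by (simp add: block_val_def block_word_def)
next
  case False
  have "block_flags ps = replicate M False"
    using assms by (simp add: blocks_def block_flags_replicate)
  then have "block_val x y ((p, 1) # ps) = (br x ^^ p) (br y (if M = 1 then x else 0))"
    using False nested_bracket_replicate[of "y # replicate M x" p x]
    by (simp add: block_val_def block_word_def nested_bracket_Cons nested_bracket_const)
  then show ?thesis using False
    by (simp add: br_swap[of y x] linear_neg[OF linear_ad_funpow] funpow_swap1 linear_0[OF linear_ad_funpow])
qed

text \<open>Induction by splitting off the first block. Without \<open>y\<close> it acts as (ad x)^p
  / p!, which is a Cauchy product with e^z - 1. With the \<open>y\<close>, the m remaining blocks
  hold only letters \<open>x\<close>, at least one each, and more than one \<open>x\<close> kills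
  the bracket; so this case contributes only for m = 1.\<close>

lemma sum_blocks_1:
  assumes "1 \<le> m"
  shows "(\<Sum>ps\<in>blocks m N 1. (1 / block_fact ps) *\<^sub>R block_val x y ps) =
    fps_nth (block_gf m) N *\<^sub>R (br x ^^ N) y"
  using assms
proof (induction m arbitrary: N rule: dec_induct)
  case base
  have "blocks 0 M 0 = (if M = 0 then {[]} else {})" "blocks 0 M 1 = {}" for M
    by (auto simp: blocks_def)
  then have "blocks 1 N 1 = {[(N, 1)]}"
    using blocks_1_Suc[of 0 N] by (auto simp: image_iff split: if_splits)
  moreover have "[] \<in> blocks 0 0 0" by (simp add: blocks_def)
  ultimately show ?case
    using block_val_Cons_1[of "[]" 0 0 x y N] by (simp add: block_fact_def block_gf_def)
next
  case (step m)
  let ?f = "\<lambda>ps. (1 / block_fact ps) *\<^sub>R block_val x y ps"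
  have fin: "finite (SIGMA p:A. blocks m (g p) q)" if "finite A" for A :: "nat set" and g q
    using that by (simp add: finite_blocks finite_SigmaI)
  have "(\<Sum>ps\<in>blocks (Suc m) N 1. ?f ps) =
      (\<Sum>p=1..N. \<Sum>ps\<in>blocks m (N - p) 1. ?f ((p, 0) # ps)) +
      (\<Sum>p\<le>N. \<Sum>ps\<in>blocks m (N - p) 0. ?f ((p, 1) # ps))"
    unfolding blocks_1_Suc using fin
    by (subst sum.union_disjoint)
       (auto simp: sum.reindex inj_on_def sum.Sigma finite_blocks case_prod_unfold)
  also have "(\<Sum>p=1..N. \<Sum>ps\<in>blocks m (N - p) 1. ?f ((p, 0) # ps)) =
      fps_nth ((fps_exp 1 - 1) * block_gf m) N *\<^sub>R (br x ^^ N) y"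
  proof -
    have "(\<Sum>ps\<in>blocks m (N - p) 1. ?f ((p, 0) # ps)) =
        (fps_nth (fps_exp 1 - 1) p * fps_nth (block_gf m) (N - p)) *\<^sub>R (br x ^^ N) y" if "p \<in> {1..N}" for p
    proof -
      have "(\<Sum>ps\<in>blocks m (N - p) 1. ?f ((p, 0) # ps)) =
          (\<Sum>ps\<in>blocks m (N - p) 1. (1 / fact p) *\<^sub>R (br x ^^ p) (?f ps))"
        by (intro sum.cong refl)
           (simp add: block_val_Cons_0 linear_cmul[OF linear_ad_funpow] block_fact_def)
      also have "\<dots> = (1 / fact p) *\<^sub>R (br x ^^ p) (fps_nth (block_gf m) (N - p) *\<^sub>R (br x ^^ (N - p)) y)"
        unfolding step.IH[symmetric] by (simp add: linear_sum[OF linear_ad_funpow] scaleR_sum_right)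
      also have "\<dots> = (1 / fact p * fps_nth (block_gf m) (N - p)) *\<^sub>R (br x ^^ (p + (N - p))) y"
        unfolding funpow_add by (simp add: linear_cmul[OF linear_ad_funpow])
      finally show ?thesis using that by simp
    qed
    then show ?thesis
      by (simp add: fps_mult_nth sum.atLeast_Suc_atMost scaleR_sum_left)
  qed
  also have "(\<Sum>p\<le>N. \<Sum>ps\<in>blocks m (N - p) 0. ?f ((p, 1) # ps)) =
      - fps_nth (if m = 1 then fps_X * fps_exp 1 else 0) N *\<^sub>R (br x ^^ N) y"
  proof -
    have z: "(\<Sum>ps\<in>blocks m (N - p) 0. ?f ((p, 1) # ps)) =
        (if m = 1 \<and> p < N \<and> N - p = 1 then - (1 / fact p) *\<^sub>R (br x ^^ N) y else 0)" if "p \<le> N" for p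
    proof -
      have le: "m \<le> M" if "ps \<in> blocks m M 0" for ps M
      proof -
        have "sum_list (map (\<lambda>_. 1) ps) \<le> sum_list (map fst ps)"
          using that by (intro sum_list_mono)
            (fastforce simp: blocks_def sum_list_eq_0_iff)
        then show ?thesis using that by (simp add: blocks_def sum_list_triv)
      qed
      show ?thesis
      proof (cases "m = 1 \<and> p < N \<and> N - p = 1")
        case True
        have "blocks (Suc 0) (Suc 0) 0 = {[(1, 0)]}"
          by (auto simp: blocks_def length_Suc_conv)
        moreover have "[(1, 0)] \<in> blocks (Suc 0) (Suc 0) 0" by (simp add: blocks_def)
        moreover have "N = Suc p" "m = 1" using True by linarith+
        ultimately show ?thesis using block_val_Cons_1[of "[(1, 0)]" 1 1 x y p]
          by (simp add: block_fact_def)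
      next
        case False
        have "block_val x y ((p, 1) # ps) = 0" if "ps \<in> blocks m (N - p) 0" for ps
          using le[OF that] block_val_Cons_1[OF that, of x y p] False step.hyps by auto
        then show ?thesis using False by (auto simp: sum.neutral)
      qed
    qed
    show ?thesis
    proof (cases "m = 1 \<and> N \<noteq> 0")
      case True
      then obtain M where "N = Suc M" using not0_implies_Suc by blast
      then have "(\<Sum>p\<le>N. \<Sum>ps\<in>blocks m (N - p) 0. ?f ((p, 1) # ps)) =
          (\<Sum>p\<le>N. if p = M then - (1 / fact p) *\<^sub>R (br x ^^ N) y else 0)"
        using True by (intro sum.cong refl, subst z) auto
      then show ?thesis using True \<open>N = Suc M\<close> by simp
    next
      case False
      have "(\<Sum>p\<le>N. \<Sum>ps\<in>blocks m (N - p) 0. ?f ((p, 1) # ps)) = 0"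
        by (rule sum.neutral, rule ballI, subst z) (use False in auto)
      then show ?thesis using False by auto
    qed
  qed
  finally show ?case
    by (simp add: block_gf_Suc[OF step.hyps(1)] algebra_simps)
qed

text \<open>On the ray \<open>s *\<^sub>R v\<close> a word with q letters \<open>y\<close> scales by
  s^q, so the derivative at s = 0 keeps exactly the words with one \<open>y\<close>.\<close>

lemma frechet_derivative_dynkin_product:
  "frechet_derivative (dynkin_product r br x) (at 0) v =
     (\<Sum>N<r. dynkin_coeff r N *\<^sub>R (br x ^^ N) v)"
proof -
  define S where "S m = {ps :: (nat \<times> nat) list. length ps = m \<and> (\<forall>(p, q)\<in>set ps. p + q > 0) \<and>
      (\<Sum>(p, q)\<leftarrow>ps. p + q) \<le> r}" for m
  define c where "c m ps = (-1) ^ (m + 1) / (real m * real (\<Sum>(p, q)\<leftarrow>ps. p + q) * block_fact ps)" for m ps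
  define q where "q ps = sum_list (map snd ps)" for ps :: "(nat \<times> nat) list"
  have tot: "(\<Sum>(p, q)\<leftarrow>ps. p + q) = sum_list (map fst ps) + sum_list (map snd ps)" for ps :: "(nat \<times> nat) list"
    by (simp add: case_prod_unfold sum_list_addf)
  have S: "S m = (\<Union>n\<le>r. \<Union>k\<le>r - n. blocks m n k)" for m
    by (auto simp: S_def blocks_def tot)
  have finS: "finite (S m)" for m unfolding S by (simp add: finite_blocks)
  have f: "dynkin_product r br x = (\<lambda>y. \<Sum>m\<in>{1..r}. \<Sum>ps\<in>S m. c m ps *\<^sub>R block_val x y ps)"
    by (rule ext) (simp add: dynkin_product_def block_word_flags block_val_def c_def S_def block_fact_def)
  have "polynomial_function (dynkin_product r br x)"
    unfolding f block_val_def
    by (intro polynomial_function_sum polynomial_function_cmul polynomial_nested_block_word finS) simp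
  then have "(dynkin_product r br x has_derivative frechet_derivative (dynkin_product r br x) (at 0)) (at (0 *\<^sub>R v))"
    using differentiable_at_polynomial_function frechet_derivative_works by (metis scaleR_zero_left)
  then have "((\<lambda>s. dynkin_product r br x (s *\<^sub>R v)) has_derivative
      (\<lambda>s. frechet_derivative (dynkin_product r br x) (at 0) (s *\<^sub>R v))) (at 0)"
    by (rule has_derivative_compose[rotated]) (auto intro!: derivative_eq_intros)
  then have "((\<lambda>s. dynkin_product r br x (s *\<^sub>R v)) has_vector_derivative
      frechet_derivative (dynkin_product r br x) (at 0) v) (at 0)"
    unfolding has_vector_derivative_def
    using \<open>polynomial_function (dynkin_product r br x)\<close>
    by (simp add: linear_cmul[OF linear_frechet_derivative[OF differentiable_at_polynomial_function]])
  moreover have "((\<lambda>s. dynkin_product r br x (s *\<^sub>R v)) has_vector_derivative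
     (\<Sum>m\<in>{1..r}. \<Sum>ps\<in>S m. (if q ps = 1 then c m ps else 0) *\<^sub>R block_val x v ps)) (at 0)"
  proof -
    have "((\<lambda>s. s ^ k *\<^sub>R c m ps *\<^sub>R block_val x v ps) has_vector_derivative
        (if k = 1 then c m ps else 0) *\<^sub>R block_val x v ps) (at 0)" for k m ps
      by (cases k; cases "k - 1") (auto intro!: derivative_eq_intros simp: has_vector_derivative_def)
    moreover have "dynkin_product r br x (s *\<^sub>R v) =
        (\<Sum>m\<in>{1..r}. \<Sum>ps\<in>S m. s ^ q ps *\<^sub>R c m ps *\<^sub>R block_val x v ps)" for s
      unfolding f block_val_def nested_block_word_scale count_block_flags q_def
      by (simp add: mult.commute)
    ultimately show ?thesis by (auto intro!: has_vector_derivative_sum)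
  qed
  ultimately have "frechet_derivative (dynkin_product r br x) (at 0) v =
      (\<Sum>m\<in>{1..r}. \<Sum>ps\<in>S m. (if q ps = 1 then c m ps else 0) *\<^sub>R block_val x v ps)"
    by (rule vector_derivative_unique_at)
  also have "\<dots> = (\<Sum>m\<in>{1..r}. \<Sum>N<r. ((-1) ^ (m + 1) / (real m * real (Suc N)) * fps_nth (block_gf m) N) *\<^sub>R (br x ^^ N) v)"
  proof (rule sum.cong[OF refl])
    fix m assume m: "m \<in> {1..r}"
    \<comment> \<open>Such a word with N letters \<open>x\<close> has degree N + 1, so the
      truncation at degree r reads N < r.\<close>
    have "(\<Sum>ps\<in>S m. (if q ps = 1 then c m ps else 0) *\<^sub>R block_val x v ps) =
        (\<Sum>ps\<in>(\<Union>N\<in>{..<r}. blocks m N 1). c m ps *\<^sub>R block_val x v ps)"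
      by (rule sum.mono_neutral_cong_right) (auto simp: finS, auto simp: q_def S_def blocks_def tot)
    also have "\<dots> = (\<Sum>N<r. \<Sum>ps\<in>blocks m N 1. c m ps *\<^sub>R block_val x v ps)"
      by (rule sum.UNION_disjoint) (auto simp: finite_blocks, auto simp: blocks_def)
    also have "\<dots> = (\<Sum>N<r. ((-1) ^ (m + 1) / (real m * real (Suc N))) *\<^sub>R
        (\<Sum>ps\<in>blocks m N 1. (1 / block_fact ps) *\<^sub>R block_val x v ps))"
      unfolding scaleR_sum_right by (intro sum.cong refl) (auto simp: c_def tot blocks_def)
    also have "\<dots> = (\<Sum>N<r. ((-1) ^ (m + 1) / (real m * real (Suc N)) * fps_nth (block_gf m) N) *\<^sub>R (br x ^^ N) v)"
      using m by (intro sum.cong refl, subst sum_blocks_1) auto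
    finally show "(\<Sum>ps\<in>S m. (if q ps = 1 then c m ps else 0) *\<^sub>R block_val x v ps) = \<dots>" .
  qed
  also have "\<dots> = (\<Sum>N<r. dynkin_coeff r N *\<^sub>R (br x ^^ N) v)"
    by (subst sum.swap, intro sum.cong refl) (simp add: dynkin_coeff_def sum_divide_distrib scaleR_sum_left)
  finally show ?thesis .
qed

section \<open>Truncated power series in \<open>ad x\<close>\<close>

definition dexp_ad :: "nat \<Rightarrow> 'v \<Rightarrow> 'v \<Rightarrow> 'v" where
  "dexp_ad r x v = (\<Sum>l<r. fps_nth dexp_series l *\<^sub>R (br x ^^ l) v)"

definition dynkin_ad :: "nat \<Rightarrow> 'v \<Rightarrow> 'v \<Rightarrow> 'v" where
  "dynkin_ad r x v = (\<Sum>N<r. dynkin_coeff r N *\<^sub>R (br x ^^ N) v)"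

text \<open>Nilpotency cuts the square of index pairs down to the triangle l + N < r, where the two
  truncated coefficient sequences are inverse to each other under the Cauchy product.\<close>

lemma dexp_dynkin_ad:
  assumes "\<And>k. r \<le> k \<Longrightarrow> (br x ^^ k) v = 0" and "0 < r"
  shows "dexp_ad r x (dynkin_ad r x v) = v"
proof -
  let ?T = "\<lambda>l N. (fps_nth dexp_series l * dynkin_coeff r N) *\<^sub>R (br x ^^ (l + N)) v"
  have "dexp_ad r x (dynkin_ad r x v) = (\<Sum>l<r. \<Sum>N<r. ?T l N)"
    unfolding dexp_ad_def dynkin_ad_def
    by (simp add: linear_sum[OF linear_ad_funpow] linear_cmul[OF linear_ad_funpow] scaleR_sum_right funpow_add)
  also have "\<dots> = (\<Sum>l<r. \<Sum>N<r - l. ?T l N)"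
    by (intro sum.cong refl sum.mono_neutral_right) (auto simp: assms)
  also have "\<dots> = (\<Sum>n<r. \<Sum>i\<le>n. ?T i (n - i))"
  proof -
    have "(\<Sum>l<r. \<Sum>N<r - l. ?T l N) = (\<Sum>(l, N)\<in>{(i, j). i + j < r}. ?T l N)"
      by (subst sum.Sigma) (auto intro!: sum.cong)
    then show ?thesis by (simp add: sum.triangle_reindex)
  qed
  also have "\<dots> = (\<Sum>n<r. (if n = 0 then 1 else 0) *\<^sub>R (br x ^^ n) v)"
    by (intro sum.cong refl) (simp add: dynkin_coefficients flip: scaleR_sum_left)
  also have "\<dots> = v" using assms(2) by (simp add: if_distrib[of "\<lambda>c. c *\<^sub>R _"] cong: if_cong)
  finally show ?thesis .
qed

lemma polynomial_ad_funpow: "polynomial_function (\<lambda>x. (br x ^^ n) v)"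
proof (induction n)
  case (Suc n)
  show ?case using polynomial_function_bilinear[OF bilinear_br polynomial_function_id Suc] by simp
qed simp

lemma polynomial_dynkin_ad: "polynomial_function (\<lambda>x. dynkin_ad r x v)"
  unfolding dynkin_ad_def by (intro polynomial_function_sum polynomial_function_cmul polynomial_ad_funpow) simp

end

section \<open>Locally uniform convergence of all derivatives\<close>

text \<open>On constant families this is \<open>C\<^sup>k\<close> smoothness, so the closure properties below serve for both.\<close>

primrec ctendsto ::
  "nat \<Rightarrow> 't filter \<Rightarrow> 'a::euclidean_space set \<Rightarrow> ('t \<Rightarrow> 'a \<Rightarrow> 'b::real_normed_vector) \<Rightarrow> ('a \<Rightarrow> 'b) \<Rightarrow> bool" where
  "ctendsto 0 F S f g \<longleftrightarrow> continuous_on S g \<and> (\<forall>K. compact K \<and> K \<subseteq> S \<longrightarrow> uniform_limit K f g F)"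
| "ctendsto (Suc k) F S f g \<longleftrightarrow>
     continuous_on S g \<and> (\<forall>K. compact K \<and> K \<subseteq> S \<longrightarrow> uniform_limit K f g F) \<and>
     (\<forall>x\<in>S. g differentiable (at x)) \<and>
     (\<forall>K. compact K \<and> K \<subseteq> S \<longrightarrow> (\<forall>\<^sub>F t in F. \<forall>x\<in>K. f t differentiable (at x))) \<and>
     (\<forall>v\<in>Basis. ctendsto k F S (\<lambda>t x. frechet_derivative (f t) (at x) v) (\<lambda>x. frechet_derivative g (at x) v))"

lemma ctendsto_imp_0: "ctendsto k F S f g \<Longrightarrow> ctendsto 0 F S f g"
  by (cases k) auto

lemma ctendsto_uniform_limit: "ctendsto k F S f g \<Longrightarrow> compact K \<Longrightarrow> K \<subseteq> S \<Longrightarrow> uniform_limit K f g F"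
  using ctendsto_imp_0 by fastforce

lemma ctendsto_Suc_D: "ctendsto (Suc k) F S f g \<Longrightarrow> ctendsto k F S f g"
  by (induction k arbitrary: f g) auto

lemma frechet_derivative_cong_open:
  assumes "open T" "x \<in> T" "\<And>y. y \<in> T \<Longrightarrow> f y = g y"
  shows "frechet_derivative f (at x) = frechet_derivative g (at x)"
    and "f differentiable (at x) \<longleftrightarrow> g differentiable (at x)"
proof -
  have "(f has_derivative d) (at x) \<longleftrightarrow> (g has_derivative d) (at x)" for d
    using assms has_derivative_transform_within_open[of f d x UNIV T g]
      has_derivative_transform_within_open[of g d x UNIV T f] by auto
  then show "frechet_derivative f (at x) = frechet_derivative g (at x)"
    and "f differentiable (at x) \<longleftrightarrow> g differentiable (at x)"
    by (simp_all add: frechet_derivative_def differentiable_def)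
qed

lemma compact_in_interior:
  fixes K :: "'a::euclidean_space set"
  assumes "compact K" "open S" "K \<subseteq> S"
  obtains K' where "compact K'" "K \<subseteq> interior K'" "K' \<subseteq> S"
proof (cases "K = {}")
  case False
  obtain e where e: "e > 0" "{x. infdist x K \<le> e} \<subseteq> S"
    using compact_in_open_separated[OF False assms] by blast
  have "open {x. infdist x K < e}" by (intro open_Collect_less continuous_intros)
  moreover have "K \<subseteq> {x. infdist x K < e}" "{x. infdist x K < e} \<subseteq> {x. infdist x K \<le> e}" using e by auto
  ultimately have "K \<subseteq> interior {x. infdist x K \<le> e}"
    by (meson interior_maximal order_trans)
  then show ?thesis using that[OF compact_infdist_le[OF False assms(1) e(1)]] e(2) by simp
qed (use that[of "{}"] in simp)

text \<open>Equality on a compact set does not determine derivatives at its points, so the families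
  are compared on a larger compact set that has the given one in its interior.\<close>

lemma ctendsto_cong:
  assumes "open S" "\<And>K. compact K \<Longrightarrow> K \<subseteq> S \<Longrightarrow> \<forall>\<^sub>F t in F. \<forall>x\<in>K. f t x = f' t x"
    "\<And>x. x \<in> S \<Longrightarrow> g x = g' x" "ctendsto k F S f g"
  shows "ctendsto k F S f' g'"
  using assms(2-4)
proof (induction k arbitrary: f g f' g')
  case 0
  have "uniform_limit K f' g' F" if "compact K" "K \<subseteq> S" for K
  proof -
    have "uniform_limit K f g F \<longleftrightarrow> uniform_limit K f' g' F"
      using 0(1)[OF that] 0(2) that by (intro uniform_limit_cong) auto
    then show ?thesis using 0 that by simp
  qed
  moreover have "continuous_on S g'" using 0 continuous_on_cong[of S S g g'] by simp
  ultimately show ?case by simp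
next
  case (Suc k)
  have ev: "\<forall>\<^sub>F t in F. \<forall>x\<in>K. frechet_derivative (f t) (at x) = frechet_derivative (f' t) (at x) \<and>
      (f t differentiable (at x) \<longleftrightarrow> f' t differentiable (at x))" if K: "compact K" "K \<subseteq> S" for K
  proof -
    obtain K' where K': "compact K'" "K \<subseteq> interior K'" "K' \<subseteq> S"
      using compact_in_interior[OF K(1) assms(1) K(2)] by blast
    from Suc.prems(1)[OF K'(1,3)] show ?thesis
    proof eventually_elim
      case (elim t)
      show ?case
      proof
        fix x assume "x \<in> K"
        then have "x \<in> interior K'" "open (interior K')" using K'(2) by auto
        moreover have "f t y = f' t y" if "y \<in> interior K'" for y
          using elim that interior_subset by blast
        ultimately show "frechet_derivative (f t) (at x) = frechet_derivative (f' t) (at x) \<and>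
            (f t differentiable (at x) \<longleftrightarrow> f' t differentiable (at x))"
          using frechet_derivative_cong_open[of "interior K'" x "f t" "f' t"] by blast
      qed
    qed
  qed
  have gg: "frechet_derivative g (at x) = frechet_derivative g' (at x)"
      "g differentiable (at x) \<longleftrightarrow> g' differentiable (at x)" if "x \<in> S" for x
    using frechet_derivative_cong_open[OF assms(1) that, of g g'] Suc.prems(2) by blast+
  have "continuous_on S g'" using Suc.prems(2,3) continuous_on_cong[of S S g g'] by simp
  moreover have "uniform_limit K f' g' F" if "compact K" "K \<subseteq> S" for K
  proof -
    have "uniform_limit K f g F \<longleftrightarrow> uniform_limit K f' g' F"
      using Suc.prems(1)[OF that] Suc.prems(2) that by (intro uniform_limit_cong) auto
    then show ?thesis using Suc.prems(3) that by simp
  qed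
  moreover have "\<forall>\<^sub>F t in F. \<forall>x\<in>K. f' t differentiable (at x)" if "compact K" "K \<subseteq> S" for K
  proof -
    have "\<forall>\<^sub>F t in F. \<forall>x\<in>K. f t differentiable (at x)" using Suc.prems(3) that by simp
    then show ?thesis using ev[OF that] by eventually_elim auto
  qed
  moreover have ev': "\<forall>\<^sub>F t in F. \<forall>x\<in>K. frechet_derivative (f t) (at x) v = frechet_derivative (f' t) (at x) v"
    if "compact K" "K \<subseteq> S" for K v
    using ev[OF that] by eventually_elim simp
  moreover have "ctendsto k F S (\<lambda>t x. frechet_derivative (f' t) (at x) v) (\<lambda>x. frechet_derivative g' (at x) v)"
    if "v \<in> Basis" for v
    by (rule Suc.IH[of "\<lambda>t x. frechet_derivative (f t) (at x) v" _ "\<lambda>x. frechet_derivative g (at x) v"])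
       (use ev' gg Suc.prems(3) that in auto)
  ultimately show ?case using Suc.prems(3) gg by simp
qed

lemma ctendsto_SucI:
  assumes "open S" "ctendsto 0 F S f g"
    "\<And>K. compact K \<Longrightarrow> K \<subseteq> S \<Longrightarrow> \<forall>\<^sub>F t in F. \<forall>x\<in>K. (f t has_derivative f' t x) (at x)"
    "\<And>x. x \<in> S \<Longrightarrow> (g has_derivative g' x) (at x)"
    "\<And>v. v \<in> Basis \<Longrightarrow> ctendsto k F S (\<lambda>t x. f' t x v) (\<lambda>x. g' x v)"
  shows "ctendsto (Suc k) F S f g"
proof -
  have "ctendsto k F S (\<lambda>t x. frechet_derivative (f t) (at x) v) (\<lambda>x. frechet_derivative g (at x) v)"
    if "v \<in> Basis" for v
  proof (rule ctendsto_cong[OF assms(1) _ _ assms(5)[OF that]])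
    show "\<forall>\<^sub>F t in F. \<forall>x\<in>K. f' t x v = frechet_derivative (f t) (at x) v" if "compact K" "K \<subseteq> S" for K
      using assms(3)[OF that] by eventually_elim (metis frechet_derivative_at)
    show "g' x v = frechet_derivative g (at x) v" if "x \<in> S" for x
      using assms(4)[OF that] by (metis frechet_derivative_at)
  qed
  moreover have "\<forall>\<^sub>F t in F. \<forall>x\<in>K. f t differentiable (at x)" if "compact K" "K \<subseteq> S" for K
    using assms(3)[OF that] by eventually_elim (auto simp: differentiable_def)
  moreover have "\<forall>x\<in>S. g differentiable (at x)" using assms(4) by (auto simp: differentiable_def)
  ultimately show ?thesis using assms(2) by simp
qed

lemma ctendsto_Suc_derivative:
  assumes "ctendsto (Suc k) F S f g"
  shows "compact K \<Longrightarrow> K \<subseteq> S \<Longrightarrow>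
      \<forall>\<^sub>F t in F. \<forall>x\<in>K. (f t has_derivative frechet_derivative (f t) (at x)) (at x)"
    and "x \<in> S \<Longrightarrow> (g has_derivative frechet_derivative g (at x)) (at x)"
    and "v \<in> Basis \<Longrightarrow>
      ctendsto k F S (\<lambda>t x. frechet_derivative (f t) (at x) v) (\<lambda>x. frechet_derivative g (at x) v)"
  using assms by (auto simp flip: frechet_derivative_works)

lemma ctendsto_const: "ctendsto k F S (\<lambda>t x. c) (\<lambda>x. c)"
  by (induction k arbitrary: c) (auto intro!: uniform_limit_const)

lemma ctendsto_bounded_linear:
  assumes "open S" "bounded_linear h" "ctendsto k F S f g"
  shows "ctendsto k F S (\<lambda>t x. h (f t x)) (\<lambda>x. h (g x))"
  using assms(3)
proof (induction k arbitrary: f g)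
  case 0
  then show ?case
    by (auto intro!: bounded_linear.uniform_limit[OF assms(2)] bounded_linear.continuous_on[OF assms(2)])
next
  case (Suc k)
  note d = ctendsto_Suc_derivative[OF Suc.prems]
  have h: "(h has_derivative h) (at y)" for y using assms(2) by (rule bounded_linear_imp_has_derivative)
  show ?case
  proof (rule ctendsto_SucI[OF assms(1)])
    show "ctendsto 0 F S (\<lambda>t x. h (f t x)) (\<lambda>x. h (g x))"
      using ctendsto_imp_0[OF Suc.prems]
      by (auto intro!: bounded_linear.uniform_limit[OF assms(2)] bounded_linear.continuous_on[OF assms(2)])
    show "\<forall>\<^sub>F t in F. \<forall>x\<in>K. ((\<lambda>x. h (f t x)) has_derivative (\<lambda>v. h (frechet_derivative (f t) (at x) v))) (at x)"
      if "compact K" "K \<subseteq> S" for K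
      using d(1)[OF that] by eventually_elim (use has_derivative_compose[OF _ h] in blast)
    show "((\<lambda>x. h (g x)) has_derivative (\<lambda>v. h (frechet_derivative g (at x) v))) (at x)" if "x \<in> S" for x
      using has_derivative_compose[OF d(2)[OF that] h] .
  qed (use Suc.IH[OF d(3)] in auto)
qed

lemma ctendsto_add:
  assumes "open S" "ctendsto k F S f g" "ctendsto k F S f' g'"
  shows "ctendsto k F S (\<lambda>t x. f t x + f' t x) (\<lambda>x. g x + g' x)"
  using assms(2,3)
proof (induction k arbitrary: f g f' g')
  case 0
  then show ?case by (auto intro!: uniform_limit_add continuous_intros)
next
  case (Suc k)
  note d = ctendsto_Suc_derivative[OF Suc.prems(1)] and d' = ctendsto_Suc_derivative[OF Suc.prems(2)]
  show ?case
  proof (rule ctendsto_SucI[OF assms(1)])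
    show "ctendsto 0 F S (\<lambda>t x. f t x + f' t x) (\<lambda>x. g x + g' x)"
      using ctendsto_imp_0[OF Suc.prems(1)] ctendsto_imp_0[OF Suc.prems(2)]
      by (auto intro!: uniform_limit_add continuous_intros)
    show "\<forall>\<^sub>F t in F. \<forall>x\<in>K. ((\<lambda>x. f t x + f' t x) has_derivative
        (\<lambda>v. frechet_derivative (f t) (at x) v + frechet_derivative (f' t) (at x) v)) (at x)"
      if "compact K" "K \<subseteq> S" for K
      using d(1)[OF that] d'(1)[OF that] by eventually_elim (use has_derivative_add in blast)
    show "((\<lambda>x. g x + g' x) has_derivative
        (\<lambda>v. frechet_derivative g (at x) v + frechet_derivative g' (at x) v)) (at x)" if "x \<in> S" for x
      using has_derivative_add[OF d(2)[OF that] d'(2)[OF that]] .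
  qed (use Suc.IH[OF d(3) d'(3)] in auto)
qed

lemma ctendsto_sum:
  assumes "open S" "\<And>i. i \<in> I \<Longrightarrow> ctendsto k F S (f i) (g i)"
  shows "ctendsto k F S (\<lambda>t x. \<Sum>i\<in>I. f i t x) (\<lambda>x. \<Sum>i\<in>I. g i x)"
  using assms(2)
  by (induction I rule: infinite_finite_induct) (auto intro!: ctendsto_add[OF assms(1)] ctendsto_const)

lemma ctendsto_0_scaleR:
  assumes "ctendsto 0 F S c d" "ctendsto 0 F S f g"
  shows "ctendsto 0 F S (\<lambda>t x. c t x *\<^sub>R f t x) (\<lambda>x. d x *\<^sub>R g x)"
proof -
  have "uniform_limit K (\<lambda>t x. c t x *\<^sub>R f t x) (\<lambda>x. d x *\<^sub>R g x) F" if "compact K" "K \<subseteq> S" for K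
  proof -
    \<comment> \<open>Products of uniform limits are uniform limits where the limits are bounded,
      which compactness provides.\<close>
    have "bounded (d ` K)" "bounded (g ` K)"
      using assms that by (auto intro!: compact_imp_bounded compact_continuous_image elim: continuous_on_subset)
    then show ?thesis
      using assms that by (intro bounded_bilinear.bounded_uniform_limit[OF bounded_bilinear_scaleR]) auto
  qed
  then show ?thesis using assms by (auto intro!: continuous_intros)
qed

lemma ctendsto_scaleR:
  assumes "open S" "ctendsto k F S c d" "ctendsto k F S f g"
  shows "ctendsto k F S (\<lambda>t x. c t x *\<^sub>R f t x) (\<lambda>x. d x *\<^sub>R g x)"
  using assms(2,3)
proof (induction k arbitrary: c d f g)
  case 0
  then show ?case by (rule ctendsto_0_scaleR)
next
  case (Suc k)
  note d = ctendsto_Suc_derivative[OF Suc.prems(1)] and d' = ctendsto_Suc_derivative[OF Suc.prems(2)]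
  show ?case
  proof (rule ctendsto_SucI[OF assms(1)])
    show "ctendsto 0 F S (\<lambda>t x. c t x *\<^sub>R f t x) (\<lambda>x. d x *\<^sub>R g x)"
      using Suc.prems by (blast intro: ctendsto_0_scaleR ctendsto_imp_0)
    show "\<forall>\<^sub>F t in F. \<forall>x\<in>K. ((\<lambda>x. c t x *\<^sub>R f t x) has_derivative
        (\<lambda>v. c t x *\<^sub>R frechet_derivative (f t) (at x) v + frechet_derivative (c t) (at x) v *\<^sub>R f t x)) (at x)"
      if "compact K" "K \<subseteq> S" for K
      using d(1)[OF that] d'(1)[OF that] by eventually_elim (use has_derivative_scaleR in blast)
    show "((\<lambda>x. d x *\<^sub>R g x) has_derivative
        (\<lambda>v. d x *\<^sub>R frechet_derivative g (at x) v + frechet_derivative d (at x) v *\<^sub>R g x)) (at x)"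
      if "x \<in> S" for x
      using has_derivative_scaleR[OF d(2)[OF that] d'(2)[OF that]] .
    show "ctendsto k F S
        (\<lambda>t x. c t x *\<^sub>R frechet_derivative (f t) (at x) v + frechet_derivative (c t) (at x) v *\<^sub>R f t x)
        (\<lambda>x. d x *\<^sub>R frechet_derivative g (at x) v + frechet_derivative d (at x) v *\<^sub>R g x)"
      if "v \<in> Basis" for v
      by (intro ctendsto_add[OF assms(1)] Suc.IH d(3) d'(3) that ctendsto_Suc_D[OF Suc.prems(1)]
          ctendsto_Suc_D[OF Suc.prems(2)])
  qed
qed

lemma linear_Basis_expansion:
  fixes v :: "'a::euclidean_space"
  assumes "linear L"
  shows "L v = (\<Sum>b\<in>Basis. (v \<bullet> b) *\<^sub>R L b)"
  by (subst euclidean_representation[of v, symmetric])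
     (simp only: linear_sum[OF assms] linear_cmul[OF assms])

lemma ctendsto_0_compose:
  assumes "continuous_on T h" "h ` T \<subseteq> S" "ctendsto 0 F S f g"
  shows "ctendsto 0 F T (\<lambda>t x. f t (h x)) (\<lambda>x. g (h x))"
proof -
  have "uniform_limit K (\<lambda>t x. f t (h x)) (\<lambda>x. g (h x)) F" if "compact K" "K \<subseteq> T" for K
  proof -
    have "compact (h ` K)" "h ` K \<subseteq> S"
      using assms that by (auto intro!: compact_continuous_image elim: continuous_on_subset)
    then have "uniform_limit (h ` K) f g F" using assms(3) by simp
    then show ?thesis by (simp add: uniform_limit_iff)
  qed
  moreover have "continuous_on T (\<lambda>x. g (h x))"
    using assms by (auto intro: continuous_on_compose2)
  ultimately show ?thesis by simp
qed

text \<open>In the chain rule the direction dh(x) v varies with x, whereas \<open>ctendsto\<close>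
  controls derivatives in fixed basis directions. Expanding in the basis turns the derivative into a
  finite sum of products, to which the induction hypothesis applies.\<close>

lemma ctendsto_compose:
  assumes "open S" "open T" "h ` T \<subseteq> S" "ctendsto k F T (\<lambda>_. h) h" "ctendsto k F S f g"
  shows "ctendsto k F T (\<lambda>t x. f t (h x)) (\<lambda>x. g (h x))"
  using assms(4,5)
proof (induction k arbitrary: f g)
  case 0
  then show ?case using ctendsto_0_compose[OF _ assms(3), where f = f and g = g and F = F] by simp
next
  case (Suc k)
  note d = ctendsto_Suc_derivative[OF Suc.prems(2)] and d' = ctendsto_Suc_derivative[OF Suc.prems(1)]
  show ?case
  proof (rule ctendsto_SucI[OF assms(2)])
    show "ctendsto 0 F T (\<lambda>t x. f t (h x)) (\<lambda>x. g (h x))"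
      using ctendsto_imp_0[OF Suc.prems(1)] ctendsto_imp_0[OF Suc.prems(2)] ctendsto_0_compose[OF _ assms(3)]
      by auto
    show "((\<lambda>x. g (h x)) has_derivative
        (\<lambda>v. \<Sum>b\<in>Basis. (frechet_derivative h (at x) v \<bullet> b) *\<^sub>R frechet_derivative g (at (h x)) b)) (at x)"
      if "x \<in> T" for x
    proof -
      have "h x \<in> S" using that assms(3) by auto
      then have "(g has_derivative frechet_derivative g (at (h x))) (at (h x))" by (rule d(2))
      from has_derivative_compose[OF d'(2)[OF that] this] show ?thesis
        by (simp only: linear_Basis_expansion[OF has_derivative_linear[OF \<open>(g has_derivative _) _\<close>], symmetric])
    qed
    show "\<forall>\<^sub>F t in F. \<forall>x\<in>K. ((\<lambda>x. f t (h x)) has_derivative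
        (\<lambda>v. \<Sum>b\<in>Basis. (frechet_derivative h (at x) v \<bullet> b) *\<^sub>R frechet_derivative (f t) (at (h x)) b)) (at x)"
      if "compact K" "K \<subseteq> T" for K
    proof -
      have "continuous_on T h" using ctendsto_imp_0[OF Suc.prems(1)] by simp
      then have "compact (h ` K)" "h ` K \<subseteq> S"
        using assms(3) that by (auto intro!: compact_continuous_image elim: continuous_on_subset)
      from d(1)[OF this] show ?thesis
      proof eventually_elim
        case (elim t)
        show ?case
        proof
          fix x assume "x \<in> K"
          then have "x \<in> T" and f: "(f t has_derivative frechet_derivative (f t) (at (h x))) (at (h x))"
            using elim that by auto
          from has_derivative_compose[OF d'(2)[OF this(1)] f]
          show "((\<lambda>x. f t (h x)) has_derivative
            (\<lambda>v. \<Sum>b\<in>Basis. (frechet_derivative h (at x) v \<bullet> b) *\<^sub>R frechet_derivative (f t) (at (h x)) b)) (at x)"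
            by (simp only: linear_Basis_expansion[OF has_derivative_linear[OF f], symmetric])
        qed
      qed
    qed
    show "ctendsto k F T
        (\<lambda>t x. \<Sum>b\<in>Basis. (frechet_derivative h (at x) v \<bullet> b) *\<^sub>R frechet_derivative (f t) (at (h x)) b)
        (\<lambda>x. \<Sum>b\<in>Basis. (frechet_derivative h (at x) v \<bullet> b) *\<^sub>R frechet_derivative g (at (h x)) b)"
      if "v \<in> Basis" for v
      by (intro ctendsto_sum[OF assms(2)] ctendsto_scaleR[OF assms(2)]
          ctendsto_bounded_linear[OF assms(2) bounded_linear_inner_left] d'(3) that
          Suc.IH[OF ctendsto_Suc_D[OF Suc.prems(1)]] d(3))
  qed
qed

text \<open>\<open>Ck_on\<close> differentiates in all directions, \<open>ctendsto\<close> in basis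
  directions only; linearity of the derivative makes up the difference.\<close>

lemma ctendsto_const_family:
  assumes "open S"
  shows "ctendsto k F S (\<lambda>_. f) f \<longleftrightarrow> Ck_on k S f"
proof (induction k arbitrary: f)
  case 0
  show ?case by (auto simp: uniform_limit_iff)
next
  case (Suc k)
  show ?case
  proof
    assume *: "ctendsto (Suc k) F S (\<lambda>_. f) f"
    note d = ctendsto_Suc_derivative[OF *]
    have "Ck_on k S (\<lambda>x. frechet_derivative f (at x) v)" for v
    proof -
      have "ctendsto k F S (\<lambda>_ x. \<Sum>b\<in>Basis. (v \<bullet> b) *\<^sub>R frechet_derivative f (at x) b)
          (\<lambda>x. \<Sum>b\<in>Basis. (v \<bullet> b) *\<^sub>R frechet_derivative f (at x) b)"
        by (intro ctendsto_sum[OF assms] ctendsto_scaleR[OF assms] ctendsto_const d(3))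
      then have "ctendsto k F S (\<lambda>_ x. frechet_derivative f (at x) v) (\<lambda>x. frechet_derivative f (at x) v)"
        by (rule ctendsto_cong[OF assms, rotated 2])
           (auto intro!: eventuallyI linear_Basis_expansion[symmetric] has_derivative_linear[OF d(2)])
      then show ?thesis using Suc.IH by blast
    qed
    then show "Ck_on (Suc k) S f" using * by simp
  next
    assume *: "Ck_on (Suc k) S f"
    then have "continuous_on S f"
      by (auto intro!: continuous_at_imp_continuous_on differentiable_imp_continuous_within)
    then show "ctendsto (Suc k) F S (\<lambda>_. f) f"
      using * Suc.IH by (auto simp: uniform_limit_iff intro!: eventuallyI)
  qed
qed

lemma ctendsto_smooth: "open S \<Longrightarrow> smooth_on S f \<Longrightarrow> ctendsto k F S (\<lambda>_. f) f"
  by (simp add: ctendsto_const_family smooth_on_def)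

lemma smooth_onI: "open S \<Longrightarrow> (\<And>k. ctendsto k sequentially S (\<lambda>_. f) f) \<Longrightarrow> smooth_on S f"
  by (simp add: ctendsto_const_family smooth_on_def)

lemma smooth_on_subset:
  assumes "smooth_on S f" "T \<subseteq> S"
  shows "smooth_on T f"
proof -
  have "Ck_on k S f \<Longrightarrow> Ck_on k T f" for k
    by (induction k arbitrary: f) (use assms(2) in \<open>auto elim: continuous_on_subset\<close>)
  then show ?thesis using assms(1) by (auto simp: smooth_on_def)
qed

lemma smooth_on_cong:
  fixes S :: "'a::euclidean_space set"
  assumes "open S" "\<And>x. x \<in> S \<Longrightarrow> f x = g x" "smooth_on S f"
  shows "smooth_on S g"
  by (rule smooth_onI[OF assms(1) ctendsto_cong[OF assms(1) _ _ ctendsto_smooth[OF assms(1,3)]]])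
     (use assms(2) in \<open>auto intro!: eventuallyI\<close>)

lemma smooth_on_compose:
  fixes S :: "'a::euclidean_space set" and T :: "'b::euclidean_space set"
  assumes "open S" "open T" "smooth_on S g" "smooth_on T f" "f ` T \<subseteq> S"
  shows "smooth_on T (\<lambda>x. g (f x))"
  by (rule smooth_onI[OF assms(2) ctendsto_compose[OF assms(1,2,5)]]) (simp_all add: ctendsto_smooth assms)

lemma smooth_on_scaleR:
  fixes S :: "'a::euclidean_space set"
  assumes "open S" "smooth_on S c" "smooth_on S f"
  shows "smooth_on S (\<lambda>x. c x *\<^sub>R f x)"
  by (rule smooth_onI[OF assms(1) ctendsto_scaleR[OF assms(1)]]) (simp_all add: ctendsto_smooth assms)

lemma smooth_on_sum:
  fixes S :: "'a::euclidean_space set"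
  assumes "open S" "\<And>i. i \<in> I \<Longrightarrow> smooth_on S (f i)"
  shows "smooth_on S (\<lambda>x. \<Sum>i\<in>I. f i x)"
  by (rule smooth_onI[OF assms(1) ctendsto_sum[OF assms(1)]]) (simp add: ctendsto_smooth assms)

lemma smooth_on_bounded_linear_compose:
  fixes S :: "'a::euclidean_space set"
  assumes "open S" "bounded_linear h" "smooth_on S f"
  shows "smooth_on S (\<lambda>x. h (f x))"
  by (rule smooth_onI[OF assms(1) ctendsto_bounded_linear[OF assms(1,2)]]) (simp_all add: ctendsto_smooth assms)

lemma smooth_on_frechet_derivative:
  assumes "smooth_on S f"
  shows "smooth_on S (\<lambda>x. frechet_derivative f (at x) v)"
  using assms unfolding smooth_on_def by (metis Ck_on.simps(2))

lemma smooth_on_differentiable: "smooth_on S f \<Longrightarrow> x \<in> S \<Longrightarrow> f differentiable (at x)"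
  unfolding smooth_on_def by (metis Ck_on.simps(2))

lemma smooth_on_has_derivative:
  "smooth_on S f \<Longrightarrow> x \<in> S \<Longrightarrow> (f has_derivative frechet_derivative f (at x)) (at x)"
  using smooth_on_differentiable frechet_derivative_works by blast

lemma smooth_on_continuous: "smooth_on S f \<Longrightarrow> continuous_on S f"
  unfolding smooth_on_def by (metis Ck_on.simps(1))

lemma smooth_on_bounded_linear:
  fixes f :: "'a::euclidean_space \<Rightarrow> 'b::real_normed_vector"
  assumes "bounded_linear f"
  shows "smooth_on UNIV f"
proof -
  have D: "frechet_derivative f (at x) = f" for x
    using assms by (metis bounded_linear_imp_has_derivative frechet_derivative_at)
  have c: "continuous_on UNIV f" using assms by (simp add: linear_continuous_on)
  have "Ck_on k UNIV f" for k
  proof (cases k)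
    case (Suc m)
    have "Ck_on m UNIV (\<lambda>x :: 'a. f v)" for v
      using ctendsto_const[of m sequentially UNIV "f v"] by (simp add: ctendsto_const_family)
    then show ?thesis using Suc D assms by (simp add: bounded_linear_imp_differentiable)
  qed (simp add: c)
  then show ?thesis by (simp add: smooth_on_def)
qed

lemma smooth_on_polynomial:
  fixes f :: "'a::euclidean_space \<Rightarrow> 'b::euclidean_space"
  assumes "polynomial_function f"
  shows "smooth_on UNIV f"
proof -
  have r: "ctendsto k sequentially UNIV (\<lambda>_. p) p" if "real_polynomial_function p" for k and p :: "'a \<Rightarrow> real"
    using that
  proof induction
    case (linear p)
    then show ?case by (simp add: ctendsto_smooth smooth_on_bounded_linear)
  next
    case (mult p q)
    then show ?case using ctendsto_scaleR[OF open_UNIV mult.IH] by simp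
  qed (simp_all add: ctendsto_const ctendsto_add)
  have "ctendsto k sequentially UNIV (\<lambda>_ x. \<Sum>b\<in>Basis. (f x \<bullet> b) *\<^sub>R b) (\<lambda>x. \<Sum>b\<in>Basis. (f x \<bullet> b) *\<^sub>R b)" for k
    using assms unfolding polynomial_function_iff_Basis_inner
    by (intro ctendsto_sum ctendsto_scaleR ctendsto_const r) auto
  then show ?thesis by (intro smooth_onI) (simp_all add: euclidean_representation)
qed

section \<open>Iterated partial derivatives\<close>

lemma Basis_vec_axis: "v \<in> (Basis :: (real ^ 'n::finite) set) \<longleftrightarrow> (\<exists>i. v = axis i 1)"
  by (auto simp: Basis_vec_def)

lemma smooth_on_partial_deriv: "smooth_on S f \<Longrightarrow> smooth_on S (partial_deriv I f)"
  by (induction I) (auto intro: smooth_on_frechet_derivative)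

lemma ctendsto_imp_partial_deriv:
  fixes f :: "'t \<Rightarrow> real ^ 'n::finite \<Rightarrow> real ^ 'n"
  assumes "\<And>k. ctendsto k F S f g"
  shows "ctendsto k F S (\<lambda>t. partial_deriv I (f t)) (partial_deriv I g)"
proof (induction I arbitrary: k)
  case (Cons i I)
  then show ?case
    using ctendsto_Suc_derivative(3)[OF Cons[of "Suc k"], of "axis i 1"] by (auto simp: Basis_vec_axis)
qed (simp add: assms)

text \<open>Smoothness is asked eventually on each compact set because dilates of a field given near
  0 offer no more. On a compact \<open>K\<close> it still means full differentiability at each
  point, as \<open>Ck_on\<close> differentiates \<open>at x\<close> and not within the set.\<close>

lemma partial_deriv_imp_ctendsto:
  fixes f :: "'t \<Rightarrow> real ^ 'n::finite \<Rightarrow> real ^ 'n"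
  assumes "smooth_on S g"
    and "\<And>K. compact K \<Longrightarrow> K \<subseteq> S \<Longrightarrow> \<forall>\<^sub>F t in F. smooth_on K (f t)"
    and "\<And>K I. compact K \<Longrightarrow> K \<subseteq> S \<Longrightarrow> uniform_limit K (\<lambda>t. partial_deriv I (f t)) (partial_deriv I g) F"
  shows "ctendsto k F S f g"
proof -
  have "ctendsto k F S (\<lambda>t. partial_deriv I (f t)) (partial_deriv I g)" for I
  proof (induction k arbitrary: I)
    case 0
    show ?case using assms(3) smooth_on_continuous[OF smooth_on_partial_deriv[OF assms(1)]] by simp
  next
    case (Suc k)
    have "ctendsto 0 F S (\<lambda>t. partial_deriv I (f t)) (partial_deriv I g)"
      using assms(3) smooth_on_continuous[OF smooth_on_partial_deriv[OF assms(1)]] by simp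
    moreover have "\<forall>\<^sub>F t in F. \<forall>x\<in>K. partial_deriv I (f t) differentiable (at x)" if "compact K" "K \<subseteq> S" for K
      using assms(2)[OF that] by eventually_elim (meson smooth_on_differentiable smooth_on_partial_deriv)
    moreover have "ctendsto k F S (\<lambda>t x. frechet_derivative (partial_deriv I (f t)) (at x) v)
        (\<lambda>x. frechet_derivative (partial_deriv I g) (at x) v)" if "v \<in> Basis" for v
      using that Suc.IH[of "_ # I"] by (auto simp: Basis_vec_axis)
    ultimately show ?case
      using smooth_on_differentiable[OF smooth_on_partial_deriv[OF assms(1)]] by simp
  qed
  from this[of "[]"] show ?thesis by simp
qed

section \<open>Polynomial functions\<close>

text \<open>Prepares integration along rays: at t x a part of degree d is t^d times its value at x,
  which has an explicit antiderivative in t.\<close>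

lemma polynomial_homogeneous_decomposition:
  assumes "real_polynomial_function f"
  shows "\<exists>h D. (\<forall>d :: nat. real_polynomial_function (h d)) \<and> (\<forall>d>D. h d = (\<lambda>_. 0)) \<and>
    (\<forall>d s x. h d (s *\<^sub>R x) = s ^ d * h d x) \<and> (\<forall>x. f x = (\<Sum>d\<le>D. h d x))"
  using assms
proof induction
  case (linear f)
  have "(\<Sum>d\<le>(1::nat). (if d = 1 then f x else 0)) = f x" for x by simp
  then show ?case using linear
    by (intro exI[of _ "\<lambda>d. if d = 1 then f else (\<lambda>_. 0)"] exI[of _ 1])
      (auto simp: linear_cmul[OF bounded_linear.linear] real_polynomial_function.intros(1)
        real_polynomial_function.intros(2))
next
  case (const c)
  show ?case
    by (intro exI[of _ "\<lambda>d _. if d = 0 then c else 0"] exI[of _ 0])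
      (auto simp: real_polynomial_function.intros(2))
next
  case (add f g)
  from add.IH(1) obtain h1 D1 where
    1: "\<forall>d. real_polynomial_function (h1 d)" "\<forall>d>D1. h1 d = (\<lambda>_. 0)"
      "\<forall>d s x. h1 d (s *\<^sub>R x) = s ^ d * h1 d x" "\<forall>x. f x = (\<Sum>d\<le>D1. h1 d x)"
    by blast
  from add.IH(2) obtain h2 D2 where
    2: "\<forall>d. real_polynomial_function (h2 d)" "\<forall>d>D2. h2 d = (\<lambda>_. 0)"
      "\<forall>d s x. h2 d (s *\<^sub>R x) = s ^ d * h2 d x" "\<forall>x. g x = (\<Sum>d\<le>D2. h2 d x)"
    by blast
  have "f x = (\<Sum>d\<le>max D1 D2. h1 d x)" "g x = (\<Sum>d\<le>max D1 D2. h2 d x)" for x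
    unfolding 1(4)[rule_format] 2(4)[rule_format] by (rule sum.mono_neutral_left; use 1(2) 2(2) in auto)+
  then show ?case using 1 2
    by (intro exI[of _ "\<lambda>d x. h1 d x + h2 d x"] exI[of _ "max D1 D2"])
      (auto simp: algebra_simps sum.distrib intro: real_polynomial_function.intros(3))
next
  case (mult f g)
  from mult.IH(1) obtain h1 D1 where
    1: "\<forall>d. real_polynomial_function (h1 d)" "\<forall>d>D1. h1 d = (\<lambda>_. 0)"
      "\<forall>d s x. h1 d (s *\<^sub>R x) = s ^ d * h1 d x" "\<forall>x. f x = (\<Sum>d\<le>D1. h1 d x)"
    by blast
  from mult.IH(2) obtain h2 D2 where
    2: "\<forall>d. real_polynomial_function (h2 d)" "\<forall>d>D2. h2 d = (\<lambda>_. 0)"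
      "\<forall>d s x. h2 d (s *\<^sub>R x) = s ^ d * h2 d x" "\<forall>x. g x = (\<Sum>d\<le>D2. h2 d x)"
    by blast
  have "f x * g x = (\<Sum>d\<le>D1 + D2. \<Sum>k\<le>d. h1 k x * h2 (d - k) x)" for x
    using polynomial_product[of D1 "\<lambda>d. h1 d x" D2 "\<lambda>d. h2 d x" 1] 1(2,4) 2(2,4) by simp
  moreover have "(\<Sum>k\<le>d. h1 k x * h2 (d - k) x) = 0" if "d > D1 + D2" for d x
  proof (rule sum.neutral, rule ballI)
    fix k
    have "k > D1 \<or> d - k > D2" using that by linarith
    then show "h1 k x * h2 (d - k) x = 0" using 1(2) 2(2) by auto
  qed
  moreover have "(\<Sum>k\<le>d. h1 k (s *\<^sub>R x) * h2 (d - k) (s *\<^sub>R x)) = s ^ d * (\<Sum>k\<le>d. h1 k x * h2 (d - k) x)"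
    for d s x
    unfolding sum_distrib_left
  proof (rule sum.cong[OF refl])
    fix k assume "k \<in> {..d}"
    then have "s ^ d = s ^ k * s ^ (d - k)" by (simp flip: power_add)
    then show "h1 k (s *\<^sub>R x) * h2 (d - k) (s *\<^sub>R x) = s ^ d * (h1 k x * h2 (d - k) x)"
      using 1(3) 2(3) by simp
  qed
  ultimately show ?case using 1(1) 2(1)
    by (intro exI[of _ "\<lambda>d x. \<Sum>k\<le>d. h1 k x * h2 (d - k) x"] exI[of _ "D1 + D2"])
      (auto intro!: real_polynomial_function_sum real_polynomial_function.intros(4))
qed

text \<open>Integrating t^d gives t^(d+1) / (d + 1), and the factor x_j raises the degree to d + 1
  as well, so the integral is again one polynomial evaluated at t x. This keeps Picard iteration
  within polynomial maps.\<close>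

lemma polynomial_ray_antiderivative:
  assumes "\<And>j. real_polynomial_function (q j :: real ^ 'n::finite \<Rightarrow> real)"
  obtains g where "real_polynomial_function g" "g 0 = 0"
    "\<And>x t. ((\<lambda>t. g (t *\<^sub>R x)) has_real_derivative (\<Sum>j\<in>UNIV. x $ j * q j (t *\<^sub>R x))) (at t)"
proof -
  have "\<forall>j. \<exists>h D. (\<forall>d :: nat. real_polynomial_function (h d)) \<and> (\<forall>d>D. h d = (\<lambda>_. 0)) \<and>
    (\<forall>d s x. h d (s *\<^sub>R x) = s ^ d * h d x) \<and> (\<forall>x. q j x = (\<Sum>d\<le>D. h d x))"
    using assms by (blast intro: polynomial_homogeneous_decomposition)
  then obtain h D where h: "\<And>j d. real_polynomial_function (h j d)"
    "\<And>j d s x. h j d (s *\<^sub>R x) = s ^ d * h j d x" "\<And>j x. q j x = (\<Sum>d\<le>D j. h j d x)"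
    by metis
  define g where "g x = (\<Sum>j\<in>UNIV. \<Sum>d\<le>D j. x $ j * h j d x / real (Suc d))" for x
  show ?thesis
  proof
    show "real_polynomial_function g"
      unfolding g_def
      by (intro real_polynomial_function_sum real_polynomial_function_divide
          real_polynomial_function.intros(4)[OF real_polynomial_function.intros(1)[OF bounded_linear_vec_nth] h(1)])
         simp_all
    show "g 0 = 0" by (simp add: g_def)
    fix x t
    have g: "g (t *\<^sub>R x) = (\<Sum>j\<in>UNIV. \<Sum>d\<le>D j. t ^ Suc d / real (Suc d) * (x $ j * h j d x))" for t
      unfolding g_def by (intro sum.cong refl) (simp add: h(2))
    have "((\<lambda>t. t ^ Suc d / real (Suc d) * c) has_real_derivative t ^ d * c) (at t)" for d c
      by (rule derivative_eq_intros refl | simp del: of_nat_Suc)+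
    then have "((\<lambda>t. g (t *\<^sub>R x)) has_real_derivative
        (\<Sum>j\<in>UNIV. \<Sum>d\<le>D j. t ^ d * (x $ j * h j d x))) (at t)"
      unfolding g by (intro DERIV_sum)
    also have "(\<Sum>j\<in>UNIV. \<Sum>d\<le>D j. t ^ d * (x $ j * h j d x)) = (\<Sum>j\<in>UNIV. x $ j * q j (t *\<^sub>R x))"
      by (simp add: h(2,3) sum_distrib_left algebra_simps)
    finally show "((\<lambda>t. g (t *\<^sub>R x)) has_real_derivative (\<Sum>j\<in>UNIV. x $ j * q j (t *\<^sub>R x))) (at t)" .
  qed
qed

lemma Ball_Basis_vec: "(\<forall>b\<in>(Basis :: (real ^ 'n::finite) set). P b) \<longleftrightarrow> (\<forall>k. P (axis k 1))"
  by (metis Basis_vec_axis)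

lemma sum_scaleR_axis: "(\<Sum>i\<in>UNIV. u $ i *\<^sub>R axis i 1) = (u :: real ^ 'n::finite)"
  by (simp add: vec_eq_iff sum_component axis_def if_distrib cong: if_cong)

lemma linear_vec_expansion:
  fixes u :: "real ^ 'n::finite"
  assumes "linear h"
  shows "h u = (\<Sum>i\<in>UNIV. u $ i *\<^sub>R h (axis i 1))"
proof -
  have "h u = h (\<Sum>i\<in>UNIV. u $ i *\<^sub>R axis i 1)" by (simp only: sum_scaleR_axis)
  then show ?thesis by (simp add: linear_sum[OF assms] linear_cmul[OF assms])
qed

lemma polynomial_function_vec_iff:
  fixes f :: "'a::real_normed_vector \<Rightarrow> real ^ 'n::finite"
  shows "polynomial_function f \<longleftrightarrow> (\<forall>k. real_polynomial_function (\<lambda>x. f x $ k))"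
  unfolding polynomial_function_iff_Basis_inner Ball_Basis_vec by (simp add: inner_axis)

lemma has_vector_derivative_vec_iff:
  fixes f :: "real \<Rightarrow> real ^ 'n::finite"
  shows "(f has_vector_derivative d) (at t within S) \<longleftrightarrow>
    (\<forall>k. ((\<lambda>t. f t $ k) has_real_derivative d $ k) (at t within S))"
proof -
  have "(\<lambda>x. x * d $ k) = (*) (d $ k)" for k by auto
  then show ?thesis
    unfolding has_vector_derivative_def has_derivative_componentwise_within[of f] Ball_Basis_vec
    by (simp add: inner_axis has_field_derivative_def)
qed

text \<open>Induction on the construction of polynomials; for products, the mixed terms of the
  Leibniz rule are symmetric in \<open>u\<close> and \<open>v\<close>.\<close>

lemma symmetric_second_derivative_polynomial:
  fixes f :: "'a::euclidean_space \<Rightarrow> real"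
  assumes "real_polynomial_function f"
  shows "frechet_derivative (\<lambda>y. frechet_derivative f (at y) u) (at x) v =
    frechet_derivative (\<lambda>y. frechet_derivative f (at y) v) (at x) u"
  using assms
proof (induction arbitrary: u v)
  case (linear f)
  then have "frechet_derivative f (at y) = f" for y
    by (metis bounded_linear_imp_has_derivative frechet_derivative_at)
  then show ?case by simp
next
  case (add f g)
  have s: "smooth_on UNIV f" "smooth_on UNIV g"
    using add.hyps by (auto intro: smooth_on_polynomial simp flip: real_polynomial_function_eq)
  note d = s[THEN smooth_on_has_derivative, OF UNIV_I]
  note dd = s[THEN smooth_on_frechet_derivative, THEN smooth_on_has_derivative, OF UNIV_I]
  have 1: "frechet_derivative (\<lambda>x. f x + g x) (at y) u = frechet_derivative f (at y) u + frechet_derivative g (at y) u" for y u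
    by (subst frechet_derivative_at[OF has_derivative_add[OF d], symmetric]) simp
  have "frechet_derivative (\<lambda>y. frechet_derivative f (at y) u + frechet_derivative g (at y) u) (at x) v =
      frechet_derivative (\<lambda>y. frechet_derivative f (at y) u) (at x) v +
      frechet_derivative (\<lambda>y. frechet_derivative g (at y) u) (at x) v" for u v
    by (subst frechet_derivative_at[OF has_derivative_add[OF dd], symmetric]) simp
  then show ?case unfolding 1 using add.IH by simp
next
  case (mult f g)
  have s: "smooth_on UNIV f" "smooth_on UNIV g"
    using mult.hyps by (auto intro: smooth_on_polynomial simp flip: real_polynomial_function_eq)
  note d = s[THEN smooth_on_has_derivative, OF UNIV_I]
  note dd = s[THEN smooth_on_frechet_derivative, THEN smooth_on_has_derivative, OF UNIV_I]
  have 1: "frechet_derivative (\<lambda>x. f x * g x) (at y) u =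
      f y * frechet_derivative g (at y) u + frechet_derivative f (at y) u * g y" for y u
    by (subst frechet_derivative_at[OF has_derivative_mult[OF d], symmetric]) simp
  have "frechet_derivative (\<lambda>y. f y * frechet_derivative g (at y) u + frechet_derivative f (at y) u * g y) (at x) v =
      (f x * frechet_derivative (\<lambda>y. frechet_derivative g (at y) u) (at x) v +
        frechet_derivative f (at x) v * frechet_derivative g (at x) u) +
      (frechet_derivative f (at x) u * frechet_derivative g (at x) v +
        frechet_derivative (\<lambda>y. frechet_derivative f (at y) u) (at x) v * g x)" for u v
    by (subst frechet_derivative_at[OF has_derivative_add[OF has_derivative_mult[OF d(1) dd(2)]
          has_derivative_mult[OF dd(1) d(2)]], symmetric]) simp
  then show ?case unfolding 1 using mult.IH by simp
qed simp

lemma frechet_derivative_vec_nth: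
  assumes "f differentiable (at x)"
  shows "frechet_derivative (\<lambda>x. f x $ k) (at x) v = frechet_derivative f (at x) v $ k"
  using assms has_derivative_compose[OF _ bounded_linear_imp_has_derivative[OF bounded_linear_vec_nth]]
  unfolding frechet_derivative_works by (metis frechet_derivative_at)

lemma symmetric_second_derivative_polynomial_vec:
  fixes f :: "'a::euclidean_space \<Rightarrow> real ^ 'n::finite"
  assumes "polynomial_function f"
  shows "frechet_derivative (\<lambda>y. frechet_derivative f (at y) u) (at x) v =
    frechet_derivative (\<lambda>y. frechet_derivative f (at y) v) (at x) u"
proof -
  have s: "smooth_on UNIV f" using assms by (rule smooth_on_polynomial)
  have "frechet_derivative (\<lambda>y. frechet_derivative f (at y) u) (at x) v $ k =
      frechet_derivative (\<lambda>y. frechet_derivative (\<lambda>x. f x $ k) (at y) u) (at x) v" for u v k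
    using frechet_derivative_vec_nth[OF smooth_on_differentiable[OF s UNIV_I]]
      frechet_derivative_vec_nth[OF smooth_on_differentiable[OF smooth_on_frechet_derivative[OF s] UNIV_I]]
    by simp
  then show ?thesis
    using assms symmetric_second_derivative_polynomial[of "\<lambda>x. f x $ _"]
    by (simp add: vec_eq_iff polynomial_function_vec_iff)
qed

lemma polynomial_lipschitz_on_cball:
  fixes f :: "'a::euclidean_space \<Rightarrow> real"
  assumes "real_polynomial_function f"
  shows "\<exists>B. \<forall>x y. norm x \<le> R \<longrightarrow> norm y \<le> R \<longrightarrow> \<bar>f x - f y\<bar> \<le> B * norm (x - y)"
proof -
  have s: "smooth_on UNIV f"
    using assms by (auto intro: smooth_on_polynomial simp flip: real_polynomial_function_eq)
  have "\<exists>B. \<forall>x\<in>cball 0 R. norm (frechet_derivative f (at x) b) \<le> B" for b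
    using compact_continuous_image[OF continuous_on_subset[OF smooth_on_continuous[OF
      smooth_on_frechet_derivative[OF s]] subset_UNIV] compact_cball, THEN compact_imp_bounded]
    by (fastforce simp: bounded_iff)
  then obtain B where B: "\<And>b x. x \<in> cball 0 R \<Longrightarrow> norm (frechet_derivative f (at x) b) \<le> B b"
    by metis
  have "norm (f x - f y) \<le> (\<Sum>b\<in>Basis. B b) * norm (x - y)" if "norm x \<le> R" "norm y \<le> R" for x y
  proof (rule differentiable_bound[OF convex_cball[of 0 R]])
    show "(f has_derivative frechet_derivative f (at z)) (at z within cball 0 R)" for z
      using smooth_on_has_derivative[OF s UNIV_I] has_derivative_at_withinI by blast
    show "onorm (frechet_derivative f (at z)) \<le> (\<Sum>b\<in>Basis. B b)" if "z \<in> cball 0 R" for z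
    proof (rule onorm_bound)
      show "0 \<le> (\<Sum>b\<in>Basis. B b)"
        using B[OF that] by (intro sum_nonneg) (meson norm_ge_zero order_trans)
      fix v
      have "norm (frechet_derivative f (at z) v) = norm (\<Sum>b\<in>Basis. (v \<bullet> b) *\<^sub>R frechet_derivative f (at z) b)"
        by (subst linear_Basis_expansion[OF has_derivative_linear[OF smooth_on_has_derivative[OF s UNIV_I]]]) simp
      also have "\<dots> \<le> (\<Sum>b\<in>Basis. norm v * B b)"
        by (rule sum_norm_le) (use B[OF that] Basis_le_norm in \<open>auto simp: abs_mult intro!: mult_mono\<close>)
      finally show "norm (frechet_derivative f (at z) v) \<le> (\<Sum>b\<in>Basis. B b) * norm v"
        by (simp add: sum_distrib_left mult.commute)
    qed
  qed (use that in auto)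
  then show ?thesis by auto
qed

section \<open>Graded Lie algebras of polynomial vector fields\<close>

lemma dil_nth [simp]: "dil w t x $ k = t ^ w k * x $ k"
  by (simp add: dil_def)

text \<open>Homogeneity of degree - w_j is written without denominators, so that it covers s = 0.
  Antisymmetry of L concerns only the triples that enter \<open>lie_alg_bracket\<close>, since only
  these values of \<open>structure_coeff\<close> are determined by the bracket condition.\<close>

locale graded_fields =
  fixes w :: "'n::finite \<Rightarrow> nat" and r :: nat
    and L :: "'n \<Rightarrow> 'n \<Rightarrow> real ^ 'n" and Y :: "'n \<Rightarrow> real ^ 'n \<Rightarrow> real ^ 'n"
  assumes w_pos: "1 \<le> w j" and w_le: "w j \<le> r"
    and poly_Y: "polynomial_function (Y j)"
    and homog_Y: "s ^ w j * Y j (dil w s x) $ k = s ^ w k * Y j x $ k"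
    and Y_0: "Y j 0 = axis j 1"
    and L_alt: "w k = w i + w j \<Longrightarrow> L j i $ k = - L i j $ k"
    and Y_bracket: "frechet_derivative (Y j) (at p) (Y i p) - frechet_derivative (Y i) (at p) (Y j p) =
      (\<Sum>k | w k = w i + w j. L i j $ k *\<^sub>R Y k p)"
begin

abbreviation "br \<equiv> lie_alg_bracket w L"

lemma br_nth: "br x y $ k = (\<Sum>i\<in>UNIV. \<Sum>j\<in>UNIV. x $ i * y $ j * (if w k = w i + w j then L i j $ k else 0))"
proof -
  have "(\<Sum>l | w l = w i + w j. L i j $ l *\<^sub>R axis l (1::real)) $ k = (if w k = w i + w j then L i j $ k else 0)" for i j
    by (simp add: sum_component axis_def if_distrib cong: if_cong) 
  then show ?thesis by (simp add: lie_alg_bracket_def sum_component)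
qed

sublocale alternating_bracket br
proof
  show "bilinear br"
    unfolding bilinear_def
    by (intro conjI allI linearI)
       (simp_all add: vec_eq_iff br_nth algebra_simps sum.distrib sum_distrib_left)
  fix x
  have "br x x $ k = - br x x $ k" for k
  proof -
    have *: "x $ j * x $ i * (if w k = w j + w i then L j i $ k else 0) =
        - (x $ i * x $ j * (if w k = w i + w j then L i j $ k else 0))" for i j
      using L_alt[of k i j] by (simp add: add.commute)
    have "br x x $ k = (\<Sum>i\<in>UNIV. \<Sum>j\<in>UNIV. x $ j * x $ i * (if w k = w j + w i then L j i $ k else 0))"
      unfolding br_nth by (rule sum.swap)
    also have "\<dots> = - br x x $ k"
      unfolding br_nth sum_negf[symmetric] by (intro sum.cong refl, rule *)
    finally show ?thesis .
  qed
  then show "br x x = 0" by (simp add: vec_eq_iff)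
qed

text \<open>Each bracket with x raises weights by at least 1, all weights being positive, so k of
  them leave no component of weight at most k.\<close>

lemma ad_funpow_nth: "w j \<le> k \<Longrightarrow> (br x ^^ k) v $ j = 0"
proof (induction k arbitrary: j)
  case 0
  then show ?case using w_pos[of j] by simp
next
  case (Suc k)
  have z: "x $ i * (br x ^^ k) v $ l * (if w j = w i + w l then L i l $ j else 0) = 0" for i l
    using Suc w_pos[of i] by (cases "w l \<le> k") auto
  then show ?case by (simp only: funpow.simps comp_apply br_nth z sum.neutral_const)
qed

lemma ad_funpow_eq_0: "r \<le> k \<Longrightarrow> (br x ^^ k) v = 0"
  using w_le by (auto simp: vec_eq_iff intro!: ad_funpow_nth intro: order_trans)

lemma real_poly_Y: "real_polynomial_function (\<lambda>p. Y j p $ k)"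
  using poly_Y by (simp add: polynomial_function_vec_iff)

lemma dil_0_left [simp]: "dil w 0 x = 0"
proof -
  have "0 < w i" for i using w_pos[of i] by auto
  then show ?thesis by (simp add: vec_eq_iff zero_power)
qed

text \<open>For w_k \<le> w_j the expression s^(w_j - w_k) Y_j(\<delta>_s p)_k does not depend on s
  \<noteq> 0, and its limit at s = 0 only involves \<open>Y j 0\<close>. The convention 0^0 = 1
  covers equal weights.\<close>

lemma Y_top:
  assumes "w k \<le> w j"
  shows "Y j p $ k = axis j 1 $ k"
proof -
  let ?f = "\<lambda>s. s ^ (w j - w k) * Y j (dil w s p) $ k"
  have "continuous_on UNIV (\<lambda>s. dil w s p)"
    unfolding dil_def by (intro continuous_intros)
  then have "continuous_on UNIV ?f"
    by (intro continuous_intros continuous_on_compose2[OF continuous_on_polymonial_function[OF poly_Y]]) auto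
  then have "\<forall>x. (?f \<longlongrightarrow> ?f x) (at x)" unfolding continuous_on_def by simp
  then have l0: "(?f \<longlongrightarrow> ?f 0) (at 0)" by (rule spec)
  have "?f s = Y j p $ k" if "s \<noteq> 0" for s
  proof -
    have "s ^ w k * ?f s = s ^ w j * Y j (dil w s p) $ k"
      using assms by (simp flip: power_add mult.assoc)
    then show ?thesis using that homog_Y[of s j p k] by simp
  qed
  then have "(?f \<longlongrightarrow> Y j p $ k) (at 0)"
    by (intro tendsto_eventually) (auto simp: eventually_at_filter)
  then have "Y j p $ k = ?f 0"
    using tendsto_unique[OF at_neq_bot _ l0] by blast
  then show ?thesis using assms by (auto simp: Y_0 axis_def)
qed

text \<open>Dilating \<open>p\<close> and \<open>q\<close> by \<open>s\<close> makes their distance \<open>O(s ^ w k)\<close>, whereas the value of a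
  component of weight \<open>w k - w j\<close> only gains the factor \<open>s ^ (w k - w j)\<close>.\<close>

lemma Y_lower:
  assumes "\<And>l. w l < w k \<Longrightarrow> p $ l = q $ l"
  shows "Y j p $ k = Y j q $ k"
proof (cases "w k \<le> w j")
  case False
  define R where "R = max (norm p) (norm q)"
  obtain B where B: "\<And>x y. norm x \<le> R \<Longrightarrow> norm y \<le> R \<Longrightarrow> \<bar>Y j x $ k - Y j y $ k\<bar> \<le> B * norm (x - y)"
    using polynomial_lipschitz_on_cball[OF real_poly_Y] by blast
  define C where "C = \<bar>B\<bar> * norm (p - q)"
  have le: "\<bar>Y j p $ k - Y j q $ k\<bar> \<le> C * s ^ w j" if "0 < s" "s \<le> 1" for s
  proof -
    have dil_le: "norm (dil w s x) \<le> norm x" for x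
    proof (rule norm_le_componentwise_cart)
      fix i
      have "\<bar>s ^ w i\<bar> \<le> 1" using that by (simp add: power_le_one)
      then show "norm (dil w s x $ i) \<le> norm (x $ i)"
        by (simp add: abs_mult mult_left_le_one_le)
    qed
    have "norm (dil w s p - dil w s q) \<le> norm (s ^ w k *\<^sub>R (p - q))"
    proof (rule norm_le_componentwise_cart)
      fix i
      show "norm ((dil w s p - dil w s q) $ i) \<le> norm ((s ^ w k *\<^sub>R (p - q)) $ i)"
      proof (cases "w i < w k")
        case False
        then have "s ^ w i \<le> s ^ w k" using that by (simp add: power_decreasing)
        then show ?thesis using that
          by (simp add: abs_mult mult_right_mono flip: right_diff_distrib)
      qed (simp add: assms)
    qed
    then have "\<bar>B\<bar> * norm (dil w s p - dil w s q) \<le> C * s ^ w k"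
      using that by (simp add: C_def mult_left_mono mult.assoc mult.commute[of "s ^ w k"])
    moreover have "\<bar>Y j (dil w s p) $ k - Y j (dil w s q) $ k\<bar> \<le> \<bar>B\<bar> * norm (dil w s p - dil w s q)"
      by (rule order_trans[OF B])
         (use dil_le[of p] dil_le[of q] in \<open>auto simp: R_def intro!: mult_right_mono\<close>)
    ultimately have "s ^ w j * \<bar>Y j (dil w s p) $ k - Y j (dil w s q) $ k\<bar> \<le> s ^ w j * (C * s ^ w k)"
      using that by (intro mult_left_mono) auto
    moreover have "s ^ w j * \<bar>Y j (dil w s p) $ k - Y j (dil w s q) $ k\<bar> =
        \<bar>s ^ w j * Y j (dil w s p) $ k - s ^ w j * Y j (dil w s q) $ k\<bar>"
      using that by (simp add: abs_mult flip: right_diff_distrib)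
    moreover have "\<dots> = s ^ w k * \<bar>Y j p $ k - Y j q $ k\<bar>"
      using that by (simp add: homog_Y abs_mult flip: right_diff_distrib)
    ultimately have "s ^ w k * \<bar>Y j p $ k - Y j q $ k\<bar> \<le> s ^ w k * (C * s ^ w j)"
      by (simp add: mult_ac)
    then show ?thesis using that by simp
  qed
  have "((\<lambda>s. C * s ^ w j) \<longlongrightarrow> C * 0 ^ w j) (at_right 0)" by (intro tendsto_intros)
  moreover have "\<forall>\<^sub>F s in at_right 0. \<bar>Y j p $ k - Y j q $ k\<bar> \<le> C * s ^ w j"
    unfolding eventually_at_right_field using le by (intro exI[of _ 1]) auto
  ultimately have "\<bar>Y j p $ k - Y j q $ k\<bar> \<le> C * 0 ^ w j"
    by (intro tendsto_lowerbound) auto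
  then show ?thesis using w_pos[of j] by (simp add: power_0_left)
qed (simp add: Y_top)

definition field :: "real ^ 'n \<Rightarrow> real ^ 'n \<Rightarrow> real ^ 'n" where
  "field u p = (\<Sum>j\<in>UNIV. u $ j *\<^sub>R Y j p)"

lemma field_nth: "field u p $ k = (\<Sum>j\<in>UNIV. u $ j * Y j p $ k)"
  by (simp add: field_def sum_component)

lemma field_axis: "field (axis j 1) p = Y j p"
proof -
  have "field (axis j 1) p = (\<Sum>i\<in>UNIV. if i = j then Y i p else 0)"
    unfolding field_def by (intro sum.cong refl) (auto simp: axis_def)
  then show ?thesis by simp
qed

lemma linear_field: "linear (\<lambda>u. field u p)"
  by (rule linearI) (simp_all add: field_def algebra_simps sum.distrib scaleR_sum_right)

lemma Y_has_derivative: "(Y j has_derivative frechet_derivative (Y j) (at p)) (at p)"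
  using smooth_on_has_derivative[OF smooth_on_polynomial[OF poly_Y]] by simp

definition dfield :: "real ^ 'n \<Rightarrow> real ^ 'n \<Rightarrow> real ^ 'n \<Rightarrow> real ^ 'n" where
  "dfield u p v = (\<Sum>j\<in>UNIV. u $ j *\<^sub>R frechet_derivative (Y j) (at p) v)"

lemma field_has_derivative: "(field u has_derivative dfield u p) (at p)"
  unfolding field_def dfield_def
  by (intro has_derivative_sum has_derivative_scaleR_right Y_has_derivative)

lemma linear_dfield: "linear (dfield u p)"
  using field_has_derivative by (rule has_derivative_linear)

text \<open>\<open>Y_bracket\<close> extended bilinearly: \<open>field\<close> is a homomorphism
  from \<open>br\<close> to the bracket of vector fields.\<close>

lemma field_bracket: "dfield v p (field u p) - dfield u p (field v p) = field (br u v) p"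
proof -
  have lin: "linear (frechet_derivative (Y j) (at p))" for j
    using Y_has_derivative by (rule has_derivative_linear)
  have "dfield v p (field u p) = (\<Sum>j\<in>UNIV. \<Sum>i\<in>UNIV. (u $ i * v $ j) *\<^sub>R frechet_derivative (Y j) (at p) (Y i p))" for u v
    unfolding dfield_def field_def
    by (simp add: linear_sum[OF lin] linear_cmul[OF lin] scaleR_sum_right mult.commute)
  note 1 = this
  have "dfield v p (field u p) - dfield u p (field v p) =
      (\<Sum>i\<in>UNIV. \<Sum>j\<in>UNIV. (u $ i * v $ j) *\<^sub>R
        (frechet_derivative (Y j) (at p) (Y i p) - frechet_derivative (Y i) (at p) (Y j p)))"
    unfolding 1[of u v] 1[of v u]
    by (subst sum.swap) (simp add: sum_subtractf scaleR_diff_right mult.commute)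
  also have "\<dots> = (\<Sum>i\<in>UNIV. \<Sum>j\<in>UNIV. (u $ i * v $ j) *\<^sub>R
        field (\<Sum>k | w k = w i + w j. L i j $ k *\<^sub>R axis k 1) p)"
    unfolding Y_bracket by (simp add: linear_sum[OF linear_field] linear_cmul[OF linear_field] field_axis)
  also have "\<dots> = field (br u v) p"
    unfolding lie_alg_bracket_def by (simp add: linear_sum[OF linear_field] linear_cmul[OF linear_field])
  finally show ?thesis .
qed

text \<open>Infinitesimal form of \<open>Y_lower\<close>: moving in a direction without components
  of weight below w_k leaves component k of every Y_j constant.\<close>

lemma dfield_lower:
  assumes "\<And>l. w l < w k \<Longrightarrow> v $ l = 0"
  shows "dfield u p v $ k = 0"
proof -
  have "frechet_derivative (Y j) (at p) v $ k = 0" for j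
  proof -
    have "((\<lambda>t. Y j (p + t *\<^sub>R v) $ k) has_derivative (\<lambda>t. frechet_derivative (Y j) (at p) (t *\<^sub>R v) $ k)) (at 0)"
    proof -
      have "((\<lambda>t. p + t *\<^sub>R v) has_derivative (\<lambda>t. t *\<^sub>R v)) (at 0)"
        by (auto intro!: derivative_eq_intros)
      from has_derivative_compose[OF this, of "Y j" "frechet_derivative (Y j) (at p)"]
      show ?thesis using Y_has_derivative[of j p]
        by (auto intro!: bounded_linear.has_derivative[OF bounded_linear_vec_nth])
    qed
    moreover have "Y j (p + t *\<^sub>R v) $ k = Y j p $ k" for t
      by (rule Y_lower) (simp add: assms)
    ultimately have "(\<lambda>t. frechet_derivative (Y j) (at p) (t *\<^sub>R v) $ k) = (\<lambda>t. 0)"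
      using has_derivative_unique[OF _ has_derivative_const] by simp
    then show ?thesis by (metis scaleR_one)
  qed
  then show ?thesis by (simp add: dfield_def sum_component)
qed

section \<open>The flow equation and its time-one map\<close>

lemma field_lower:
  assumes "\<And>l. w l < w k \<Longrightarrow> p $ l = q $ l"
  shows "field u p $ k = field u q $ k"
  unfolding field_nth by (intro sum.cong refl) (metis Y_lower assms)

text \<open>Component k of the right-hand side only involves components of smaller weight, so
  induction on the weight reduces uniqueness to functions with zero derivative.\<close>

lemma graded_ode_unique:
  fixes \<gamma> \<delta> :: "real \<Rightarrow> real ^ 'n"
  assumes "convex S" "0 \<in> S" "t \<in> S" "\<gamma> 0 = \<delta> 0"
    and "\<And>t. t \<in> S \<Longrightarrow> (\<gamma> has_vector_derivative field x (\<gamma> t)) (at t within S)"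
    and "\<And>t. t \<in> S \<Longrightarrow> (\<delta> has_vector_derivative field x (\<delta> t)) (at t within S)"
  shows "\<gamma> t = \<delta> t"
proof -
  have "\<forall>t\<in>S. \<gamma> t $ k = \<delta> t $ k" for k
  proof (induction "w k" arbitrary: k rule: less_induct)
    case less
    have "((\<lambda>t. \<gamma> t $ k - \<delta> t $ k) has_real_derivative 0) (at t within S)" if "t \<in> S" for t
    proof -
      have "field x (\<gamma> t) $ k = field x (\<delta> t) $ k"
        by (rule field_lower) (use less that in auto)
      then show ?thesis
        using DERIV_diff[OF assms(5)[OF that, unfolded has_vector_derivative_vec_iff, rule_format, of k]
            assms(6)[OF that, unfolded has_vector_derivative_vec_iff, rule_format, of k]] by simp
    qed
    from has_field_derivative_zero_constant[OF assms(1) this]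
    obtain c where "\<And>t. t \<in> S \<Longrightarrow> \<gamma> t $ k - \<delta> t $ k = c" by blast
    from this this[OF assms(2)] assms(4) show ?case by simp
  qed
  then show ?thesis using assms(3) by (simp add: vec_eq_iff)
qed

text \<open>One Picard step. The solution for x at time t is sought in the form e (t x), so that a
  single polynomial map encodes the curves for all x.\<close>

lemma ex_flow_step:
  fixes e :: "real ^ 'n \<Rightarrow> real ^ 'n"
  assumes "polynomial_function e"
  shows "\<exists>e'. polynomial_function e' \<and> e' 0 = 0 \<and>
    (\<forall>x t. ((\<lambda>t. e' (t *\<^sub>R x)) has_vector_derivative field x (e (t *\<^sub>R x))) (at t))"
proof -
  have p: "real_polynomial_function (\<lambda>x. Y j (e x) $ k)" for j k
    using polynomial_function_compose[OF assms poly_Y] by (simp add: polynomial_function_vec_iff o_def)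
  have "\<exists>g. real_polynomial_function g \<and> g 0 = 0 \<and>
    (\<forall>x t. ((\<lambda>t. g (t *\<^sub>R x)) has_real_derivative field x (e (t *\<^sub>R x)) $ k) (at t))" for k
  proof -
    obtain g where "real_polynomial_function g" "g 0 = 0"
      "\<And>x t. ((\<lambda>t. g (t *\<^sub>R x)) has_real_derivative (\<Sum>j\<in>UNIV. x $ j * Y j (e (t *\<^sub>R x)) $ k)) (at t)"
      by (rule polynomial_ray_antiderivative[where q = "\<lambda>j x. Y j (e x) $ k", OF p]) (rule that)
    then show ?thesis unfolding field_nth by (intro exI[of _ g] conjI allI)
  qed
  then obtain g where "\<And>k. real_polynomial_function (g k) \<and> g k 0 = 0 \<and>
    (\<forall>x t. ((\<lambda>t. g k (t *\<^sub>R x)) has_real_derivative field x (e (t *\<^sub>R x)) $ k) (at t))" by metis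
  then show ?thesis
    by (intro exI[of _ "\<lambda>x. \<chi> k. g k x"])
       (auto simp: has_vector_derivative_vec_iff polynomial_function_vec_iff vec_eq_iff)
qed

text \<open>Picard iteration becomes stationary, since its \<open>m\<close>-th step fixes the components of weight \<open>m\<close>.\<close>

lemma ex_flow:
  "\<exists>e. polynomial_function e \<and> e 0 = 0 \<and>
    (\<forall>x t. ((\<lambda>t. e (t *\<^sub>R x)) has_vector_derivative field x (e (t *\<^sub>R x))) (at t))"
proof -
  have "\<exists>f. \<forall>m :: nat. (polynomial_function (f m) \<and> f m 0 = 0) \<and>
      (\<forall>x t. ((\<lambda>t. f (Suc m) (t *\<^sub>R x)) has_vector_derivative field x (f m (t *\<^sub>R x))) (at t))"
  proof (rule dependent_nat_choice)
    show "\<exists>e :: real ^ 'n \<Rightarrow> real ^ 'n. polynomial_function e \<and> e 0 = 0"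
      by (intro exI[of _ "\<lambda>_. 0"]) simp
  qed (use ex_flow_step in blast)
  then obtain f :: "nat \<Rightarrow> real ^ 'n \<Rightarrow> real ^ 'n" where f: "\<And>m. polynomial_function (f m)" "\<And>m. f m 0 = 0"
    "\<And>m x t. ((\<lambda>t. f (Suc m) (t *\<^sub>R x)) has_vector_derivative field x (f m (t *\<^sub>R x))) (at t)"
    by blast
  have "w k \<le> m \<Longrightarrow> f (Suc m) x $ k = f m x $ k" for m k x
  proof (induction m arbitrary: k x)
    case 0
    then show ?case using w_pos[of k] by simp
  next
    case (Suc m)
    have "((\<lambda>t. f (Suc (Suc m)) (t *\<^sub>R x) $ k - f (Suc m) (t *\<^sub>R x) $ k) has_real_derivative 0) (at t)" for t
    proof -
      have "field x (f (Suc m) (t *\<^sub>R x)) $ k = field x (f m (t *\<^sub>R x)) $ k"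
        by (rule field_lower) (use Suc in auto)
      then show ?thesis
        using DERIV_diff[OF f(3)[of "Suc m" x t, unfolded has_vector_derivative_vec_iff, rule_format, of k]
            f(3)[of m x t, unfolded has_vector_derivative_vec_iff, rule_format, of k]] by simp
    qed
    then have "f (Suc (Suc m)) (1 *\<^sub>R x) $ k - f (Suc m) (1 *\<^sub>R x) $ k =
        f (Suc (Suc m)) (0 *\<^sub>R x) $ k - f (Suc m) (0 *\<^sub>R x) $ k"
      by (intro DERIV_isconst_all) auto
    then show ?case by (simp add: f(2))
  qed
  then have "f (Suc r) = f r" using w_le by (simp add: fun_eq_iff vec_eq_iff)
  then have "((\<lambda>t. f r (t *\<^sub>R x)) has_vector_derivative field x (f r (t *\<^sub>R x))) (at t)" for x t
    using f(3)[of r x t] by (simp only:)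
  then show ?thesis using f(1)[of r] f(2)[of r] by (intro exI[of _ "f r"] conjI allI)
qed

definition flow :: "real ^ 'n \<Rightarrow> real ^ 'n" where
  "flow = (SOME e. polynomial_function e \<and> e 0 = 0 \<and>
    (\<forall>x t. ((\<lambda>t. e (t *\<^sub>R x)) has_vector_derivative field x (e (t *\<^sub>R x))) (at t)))"

lemma polynomial_flow: "polynomial_function flow" and flow_0 [simp]: "flow 0 = 0"
  and flow_ode: "((\<lambda>t. flow (t *\<^sub>R x)) has_vector_derivative field x (flow (t *\<^sub>R x))) (at t)"
proof -
  have *: "polynomial_function flow \<and> flow 0 = 0 \<and>
    (\<forall>x t. ((\<lambda>t. flow (t *\<^sub>R x)) has_vector_derivative field x (flow (t *\<^sub>R x))) (at t))"
    unfolding flow_def by (rule someI_ex[OF ex_flow])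
  then show "polynomial_function flow" "flow 0 = 0" by simp_all
  from * show "((\<lambda>t. flow (t *\<^sub>R x)) has_vector_derivative field x (flow (t *\<^sub>R x))) (at t)" by simp
qed

text \<open>The definite description in \<open>exp_fields\<close> is settled by uniqueness on the
  unit interval, where the derivatives at the ends are one-sided.\<close>

lemma exp_fields_eq_flow: "exp_fields Y = flow"
proof
  fix x
  show "exp_fields Y x = flow x"
    unfolding exp_fields_def
  proof (rule the_equality)
    show "\<exists>\<gamma>. \<gamma> 0 = 0 \<and> \<gamma> 1 = flow x \<and> (\<forall>t\<in>{0..1}. (\<gamma> has_vector_derivative
        (\<Sum>j\<in>UNIV. (x $ j) *\<^sub>R Y j (\<gamma> t))) (at t within {0..1::real}))"
      by (rule exI[of _ "\<lambda>t. flow (t *\<^sub>R x)"])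
         (auto simp: flow_ode has_vector_derivative_at_within simp flip: field_def)
    fix z
    assume "\<exists>\<gamma>. \<gamma> 0 = 0 \<and> \<gamma> 1 = z \<and> (\<forall>t\<in>{0..1}. (\<gamma> has_vector_derivative
        (\<Sum>j\<in>UNIV. (x $ j) *\<^sub>R Y j (\<gamma> t))) (at t within {0..1::real}))"
    then obtain \<gamma> where \<gamma>: "\<gamma> 0 = 0" "\<gamma> 1 = z"
      "\<And>t. t \<in> {0..1} \<Longrightarrow> (\<gamma> has_vector_derivative field x (\<gamma> t)) (at t within {0..1})"
      by (auto simp: field_def)
    have "\<gamma> 1 = flow (1 *\<^sub>R x)"
      by (rule graded_ode_unique[of "{0..1}" 1 \<gamma> "\<lambda>t. flow (t *\<^sub>R x)" x])
         (use \<gamma> in \<open>auto simp: flow_ode has_vector_derivative_at_within\<close>)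
    then show "z = flow x" using \<gamma> by simp
  qed
qed

text \<open>By homogeneity \<open>field (dil w s x)\<close> at \<delta>_s p is \<delta>_s applied to
  \<open>field x\<close> at p, so both curves solve the same equation.\<close>

lemma flow_dil: "flow (dil w s x) = dil w s (flow x)"
proof -
  have "flow (1 *\<^sub>R dil w s x) = dil w s (flow (1 *\<^sub>R x))"
  proof (rule graded_ode_unique[of UNIV 1 "\<lambda>t. flow (t *\<^sub>R dil w s x)" "\<lambda>t. dil w s (flow (t *\<^sub>R x))" "dil w s x"])
    show "((\<lambda>t. dil w s (flow (t *\<^sub>R x))) has_vector_derivative field (dil w s x) (dil w s (flow (t *\<^sub>R x)))) (at t)" for t
    proof -
      have "field (dil w s x) (dil w s (flow (t *\<^sub>R x))) $ k = s ^ w k * field x (flow (t *\<^sub>R x)) $ k" for k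
        unfolding field_nth sum_distrib_left
        using homog_Y[of s _ "flow (t *\<^sub>R x)" k] by (intro sum.cong refl) (simp add: mult_ac)
      then show ?thesis
        using flow_ode[of x t] unfolding has_vector_derivative_vec_iff by (auto intro: DERIV_cmult)
    qed
  qed (auto simp: flow_ode vec_eq_iff)
  then show ?thesis by simp
qed

text \<open>The time-one map is unipotent triangular: component k is x_k plus a function of
  coordinates of smaller weight. In \<open>field x p $ k\<close> the fields with w_j \<ge> w_k
  contribute just x_k, by \<open>Y_top\<close>.\<close>

lemma flow_lower:
  assumes "\<And>l. w l < w k \<Longrightarrow> x $ l = y $ l"
  shows "flow x $ k - x $ k = flow y $ k - y $ k"
  using assms
proof (induction "w k" arbitrary: k x y rule: less_induct)
  case less
  have "((\<lambda>t. (flow (t *\<^sub>R x) $ k - t * x $ k) - (flow (t *\<^sub>R y) $ k - t * y $ k)) has_real_derivative 0) (at t)" for t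
  proof -
    have eq: "flow (t *\<^sub>R x) $ l = flow (t *\<^sub>R y) $ l" if "w l < w k" for l
      using less.hyps[OF that, of "t *\<^sub>R x" "t *\<^sub>R y"] less.prems that by auto
    have "x $ j * (Y j (flow (t *\<^sub>R x)) $ k - axis j 1 $ k) = y $ j * (Y j (flow (t *\<^sub>R y)) $ k - axis j 1 $ k)" for j
    proof (cases "w k \<le> w j")
      case False
      then show ?thesis using less.prems Y_lower[OF eq] by simp
    qed (simp add: Y_top)
    then have 1: "(\<Sum>j\<in>UNIV. x $ j * (Y j (flow (t *\<^sub>R x)) $ k - axis j 1 $ k)) =
        (\<Sum>j\<in>UNIV. y $ j * (Y j (flow (t *\<^sub>R y)) $ k - axis j 1 $ k))" by simp
    have "(\<Sum>j\<in>UNIV. x $ j * (Y j p $ k - axis j 1 $ k)) = field x p $ k - x $ k" for x p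
    proof -
      have "(\<Sum>j\<in>UNIV. x $ j * axis j (1::real) $ k) = x $ k"
        by (simp add: axis_def if_distrib cong: if_cong)
      then show ?thesis by (simp add: field_nth right_diff_distrib sum_subtractf)
    qed
    then have "(field x (flow (t *\<^sub>R x)) $ k - x $ k) - (field y (flow (t *\<^sub>R y)) $ k - y $ k) = 0"
      using 1 by simp
    moreover have D: "((\<lambda>t. flow (t *\<^sub>R z) $ k - t * z $ k) has_real_derivative field z (flow (t *\<^sub>R z)) $ k - z $ k) (at t)" for z
      using flow_ode[of z t] unfolding has_vector_derivative_vec_iff
      by (auto intro!: derivative_eq_intros)
    ultimately show ?thesis using DERIV_diff[OF D[of x] D[of y]] by simp
  qed
  then have "(flow (1 *\<^sub>R x) $ k - 1 * x $ k) - (flow (1 *\<^sub>R y) $ k - 1 * y $ k) =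
      (flow (0 *\<^sub>R x) $ k - 0 * x $ k) - (flow (0 *\<^sub>R y) $ k - 0 * y $ k)"
    by (intro DERIV_isconst_all) auto
  then show ?case by simp
qed

text \<open>Iterates the fixed point form x = y - (flow x - x) of flow x = y. By
  \<open>flow_lower\<close>, step m settles the components of weight at most m, so r steps reach a
  polynomial right inverse; injectivity makes it two-sided.\<close>

lemma ex_flow_inverse: "\<exists>g. polynomial_function g \<and> (\<forall>x. g (flow x) = x) \<and> (\<forall>y. flow (g y) = y)"
proof -
  define g where "g = rec_nat (\<lambda>y :: real ^ 'n. 0) (\<lambda>_ g y. y - (flow (g y) - g y))"
  have g_Suc: "g (Suc m) y = y - (flow (g m y) - g m y)" for m y by (simp add: g_def)
  have poly: "polynomial_function (g m)" for m
  proof (induction m)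
    case (Suc m)
    have "polynomial_function (\<lambda>y. y - (flow (g m y) - g m y))"
      using polynomial_function_compose[OF Suc polynomial_flow] Suc
      by (intro polynomial_function_diff polynomial_function_id) (auto simp: o_def)
    then show ?case by (simp add: g_def)
  qed (simp add: g_def)
  have stat: "w k \<le> m \<Longrightarrow> g (Suc m) y $ k = g m y $ k" for m k y
  proof (induction m arbitrary: k)
    case 0
    then show ?case using w_pos[of k] by simp
  next
    case (Suc m)
    have "flow (g (Suc m) y) $ k - g (Suc m) y $ k = flow (g m y) $ k - g m y $ k"
      by (rule flow_lower) (use Suc in auto)
    then show ?case by (simp only: g_Suc[of "Suc m"] g_Suc[of m]) simp
  qed
  have "g (Suc r) y = g r y" for y using stat w_le by (auto simp: vec_eq_iff)
  then have right: "flow (g r y) = y" for y using g_Suc[of r y] by simp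
  have "x = y" if "flow x = flow y" for x y
  proof -
    have "x $ k = y $ k" for k
    proof (induction "w k" arbitrary: k rule: less_induct)
      case less
      then show ?case using flow_lower[of k x y] that by simp
    qed
    then show ?thesis by (simp add: vec_eq_iff)
  qed
  then have "g r (flow x) = x" for x using right by blast
  then show ?thesis using right poly by blast
qed

section \<open>The differential of the time-one map\<close>

abbreviation dflow :: "real ^ 'n \<Rightarrow> real ^ 'n \<Rightarrow> real ^ 'n" where
  "dflow x \<equiv> frechet_derivative flow (at x)"

lemma smooth_flow: "smooth_on UNIV flow"
  using polynomial_flow by (rule smooth_on_polynomial)

lemma flow_has_derivative: "(flow has_derivative dflow x) (at x)"
  using smooth_on_has_derivative[OF smooth_flow] by simp

lemma linear_dflow: "linear (dflow x)"
  using flow_has_derivative by (rule has_derivative_linear)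

lemma flow_euler: "dflow y y = field y (flow y)"
proof -
  have "((\<lambda>t. t *\<^sub>R y) has_derivative (\<lambda>t. t *\<^sub>R y)) (at 1)"
    by (auto intro!: derivative_eq_intros)
  then have "((\<lambda>t. flow (t *\<^sub>R y)) has_derivative (\<lambda>t. dflow (1 *\<^sub>R y) (t *\<^sub>R y))) (at 1)"
    using flow_has_derivative by (rule has_derivative_compose)
  then have "((\<lambda>t. flow (t *\<^sub>R y)) has_vector_derivative dflow y y) (at 1)"
    by (simp add: has_vector_derivative_def linear_cmul[OF linear_dflow])
  moreover have "((\<lambda>t. flow (t *\<^sub>R y)) has_vector_derivative field y (flow y)) (at 1)"
    using flow_ode[of y 1] by simp
  ultimately show ?thesis by (rule vector_derivative_unique_at)
qed

abbreviation d2flow :: "real ^ 'n \<Rightarrow> real ^ 'n \<Rightarrow> real ^ 'n \<Rightarrow> real ^ 'n" where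
  "d2flow x u \<equiv> frechet_derivative (\<lambda>y. dflow y u) (at x)"

lemma dflow_has_derivative: "((\<lambda>y. dflow y u) has_derivative d2flow x u) (at x)"
  using smooth_on_has_derivative[OF smooth_on_frechet_derivative[OF smooth_flow]] by simp

text \<open>The Euler identity \<open>flow_euler\<close>, differentiated in direction v. Its left
  side involves y both as base point and as direction; expanding the direction in coordinates
  separates the two for the product rule.\<close>

lemma flow_euler_derivative:
  "dflow y v + d2flow y y v = dfield y (flow y) (dflow y v) + field v (flow y)"
proof -
  have nth: "((\<lambda>z. z $ i) has_derivative (\<lambda>v. v $ i)) (at y)" for i and y :: "real ^ 'n"
    by (rule bounded_linear_imp_has_derivative[OF bounded_linear_vec_nth])
  have D: "dflow z u = (\<Sum>i\<in>UNIV. u $ i *\<^sub>R dflow z (axis i 1))" for z u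
    by (rule linear_vec_expansion[OF linear_dflow])
  have "((\<lambda>z. \<Sum>i\<in>UNIV. y $ i *\<^sub>R dflow z (axis i 1)) has_derivative
      (\<lambda>v. \<Sum>i\<in>UNIV. y $ i *\<^sub>R d2flow y (axis i 1) v)) (at y)"
    by (intro has_derivative_sum has_derivative_scaleR_right dflow_has_derivative)
  then have "((\<lambda>z. dflow z y) has_derivative (\<lambda>v. \<Sum>i\<in>UNIV. y $ i *\<^sub>R d2flow y (axis i 1) v)) (at y)"
    by (simp only: D[symmetric])
  from fun_cong[OF frechet_derivative_at[OF this], of v]
  have 1: "d2flow y y v = (\<Sum>i\<in>UNIV. y $ i *\<^sub>R d2flow y (axis i 1) v)" by (rule sym)
  have "((\<lambda>z. \<Sum>i\<in>UNIV. z $ i *\<^sub>R dflow z (axis i 1)) has_derivative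
      (\<lambda>v. \<Sum>i\<in>UNIV. y $ i *\<^sub>R d2flow y (axis i 1) v + v $ i *\<^sub>R dflow y (axis i 1))) (at y)"
    by (intro has_derivative_sum has_derivative_scaleR nth dflow_has_derivative)
  then have "((\<lambda>z. field z (flow z)) has_derivative
      (\<lambda>v. \<Sum>i\<in>UNIV. y $ i *\<^sub>R d2flow y (axis i 1) v + v $ i *\<^sub>R dflow y (axis i 1))) (at y)"
    by (simp only: D[symmetric] flow_euler)
  moreover have "((\<lambda>z. field z (flow z)) has_derivative
      (\<lambda>v. \<Sum>j\<in>UNIV. y $ j *\<^sub>R frechet_derivative (Y j) (at (flow y)) (dflow y v) + v $ j *\<^sub>R Y j (flow y))) (at y)"
    unfolding field_def
    by (intro has_derivative_sum has_derivative_scaleR nth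
        has_derivative_compose[OF flow_has_derivative Y_has_derivative])
  ultimately have "(\<lambda>v. \<Sum>i\<in>UNIV. y $ i *\<^sub>R d2flow y (axis i 1) v + v $ i *\<^sub>R dflow y (axis i 1)) =
      (\<lambda>v. \<Sum>j\<in>UNIV. y $ j *\<^sub>R frechet_derivative (Y j) (at (flow y)) (dflow y v) + v $ j *\<^sub>R Y j (flow y))"
    by (rule has_derivative_unique)
  from fun_cong[OF this, of v] show ?thesis
    unfolding 1 D[of y v] by (simp add: sum.distrib dfield_def field_def add.commute flip: D[of y v])
qed

text \<open>This is (1 - e^(-t ad x)) / ad x applied to v, the solution of c' = v - [x, c] with c(0)
  = 0; at t = 1 it is \<open>dexp_ad\<close>.\<close>

definition dexp_curve :: "real ^ 'n \<Rightarrow> real ^ 'n \<Rightarrow> real \<Rightarrow> real ^ 'n" where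
  "dexp_curve x v t = (\<Sum>l<r. (t ^ Suc l * fps_nth dexp_series l) *\<^sub>R (br x ^^ l) v)"

lemma dexp_curve_has_vector_derivative:
  "(dexp_curve x v has_vector_derivative v - br x (dexp_curve x v t)) (at t)"
proof -
  obtain r' where r: "r = Suc r'" using w_pos w_le not0_implies_Suc by (metis le_0_eq not_one_le_zero)
  have "((\<lambda>t. (t ^ Suc l * c) *\<^sub>R u) has_vector_derivative (real (Suc l) * t ^ l * c) *\<^sub>R u) (at t)" for l c and u :: "real ^ 'n"
    unfolding has_vector_derivative_def
    by (auto intro!: derivative_eq_intros simp: algebra_simps simp del: of_nat_Suc power_Suc)
  then have "(dexp_curve x v has_vector_derivative
      (\<Sum>l<r. (real (Suc l) * t ^ l * fps_nth dexp_series l) *\<^sub>R (br x ^^ l) v)) (at t)"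
    unfolding dexp_curve_def by (intro has_vector_derivative_sum)
  also have "(\<Sum>l<r. (real (Suc l) * t ^ l * fps_nth dexp_series l) *\<^sub>R (br x ^^ l) v) =
      v + (\<Sum>l<r'. (real (Suc (Suc l)) * t ^ Suc l * fps_nth dexp_series (Suc l)) *\<^sub>R (br x ^^ Suc l) v)"
    unfolding r by (subst sum.lessThan_Suc_shift) (simp add: dexp_series_def)
  also have "(\<Sum>l<r'. (real (Suc (Suc l)) * t ^ Suc l * fps_nth dexp_series (Suc l)) *\<^sub>R (br x ^^ Suc l) v) =
      (\<Sum>l<r'. - ((t ^ Suc l * fps_nth dexp_series l) *\<^sub>R br x ((br x ^^ l) v)))"
  proof (intro sum.cong refl)
    fix l
    have "real (Suc (Suc l)) * t ^ Suc l * fps_nth dexp_series (Suc l) = - (t ^ Suc l * fps_nth dexp_series l)"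
      by (simp add: dexp_series_def fact_Suc[of "Suc l"] del: of_nat_Suc fact_Suc)
    then show "(real (Suc (Suc l)) * t ^ Suc l * fps_nth dexp_series (Suc l)) *\<^sub>R (br x ^^ Suc l) v =
        - ((t ^ Suc l * fps_nth dexp_series l) *\<^sub>R br x ((br x ^^ l) v))" by simp
  qed
  also have "(\<Sum>l<r'. - ((t ^ Suc l * fps_nth dexp_series l) *\<^sub>R br x ((br x ^^ l) v))) = - br x (dexp_curve x v t)"
  proof -
    \<comment> \<open>The shifted sum lacks only the term of index r - 1, which nilpotency
      kills.\<close>
    have "br x ((br x ^^ r') v) = 0" using ad_funpow_eq_0[of r x v] by (simp add: r)
    then show ?thesis unfolding dexp_curve_def
      by (subst r) (simp add: sum_negf linear_add[OF linear_ad] linear_sum[OF linear_ad] linear_cmul[OF linear_ad])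
  qed
  finally show ?thesis by simp
qed

text \<open>Both sides solve the linearised flow equation \<open>J' = d(field x) J + field v\<close> along
  \<open>t \<mapsto> flow (t x)\<close>; the difference vanishes component by component.\<close>

lemma dflow_eq_field: "dflow x v = field (dexp_ad r x v) (flow x)"
proof -
  define \<gamma> where "\<gamma> t = flow (t *\<^sub>R x)" for t
  define c where "c = dexp_curve x v"
  define \<Delta> where "\<Delta> t = t *\<^sub>R dflow (t *\<^sub>R x) v - field (c t) (\<gamma> t)" for t
  have \<gamma>: "(\<gamma> has_vector_derivative field x (\<gamma> t)) (at t)" for t
    unfolding \<gamma>_def by (rule flow_ode)
  have \<Delta>: "(\<Delta> has_vector_derivative dfield x (\<gamma> t) (\<Delta> t)) (at t)" for t
  proof -
    have "((\<lambda>t. t *\<^sub>R x) has_derivative (\<lambda>s. s *\<^sub>R x)) (at t)"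
      by (auto intro!: derivative_eq_intros)
    then have "((\<lambda>t. dflow (t *\<^sub>R x) v) has_derivative (\<lambda>s. d2flow (t *\<^sub>R x) v (s *\<^sub>R x))) (at t)"
      using dflow_has_derivative by (rule has_derivative_compose)
    then have "((\<lambda>t. dflow (t *\<^sub>R x) v) has_vector_derivative d2flow (t *\<^sub>R x) v x) (at t)"
      by (simp add: has_vector_derivative_def linear_cmul[OF has_derivative_linear[OF dflow_has_derivative]])
    then have "((\<lambda>t. t *\<^sub>R dflow (t *\<^sub>R x) v) has_vector_derivative
        t *\<^sub>R d2flow (t *\<^sub>R x) v x + 1 *\<^sub>R dflow (t *\<^sub>R x) v) (at t)"
      by (intro has_vector_derivative_scaleR) auto
    moreover have "t *\<^sub>R d2flow (t *\<^sub>R x) v x + 1 *\<^sub>R dflow (t *\<^sub>R x) v =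
        dfield x (\<gamma> t) (t *\<^sub>R dflow (t *\<^sub>R x) v) + field v (\<gamma> t)"
    proof -
      have "t *\<^sub>R d2flow (t *\<^sub>R x) v x = d2flow (t *\<^sub>R x) v (t *\<^sub>R x)"
        by (simp add: linear_cmul[OF has_derivative_linear[OF dflow_has_derivative]])
      \<comment> \<open>Symmetry exchanges the derivative along the curve with the one in direction
        v, so that \<open>flow_euler_derivative\<close> applies at t x.\<close>
      also have "\<dots> = d2flow (t *\<^sub>R x) (t *\<^sub>R x) v"
        by (rule symmetric_second_derivative_polynomial_vec[OF polynomial_flow])
      finally have "t *\<^sub>R d2flow (t *\<^sub>R x) v x + 1 *\<^sub>R dflow (t *\<^sub>R x) v =
          dfield (t *\<^sub>R x) (\<gamma> t) (dflow (t *\<^sub>R x) v) + field v (\<gamma> t)"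
        using flow_euler_derivative[of "t *\<^sub>R x" v] by (simp add: \<gamma>_def add.commute)
      moreover have "dfield (t *\<^sub>R x) p u = dfield x p (t *\<^sub>R u)" for p u
        unfolding linear_cmul[OF linear_dfield] by (simp add: dfield_def scaleR_sum_right)
      ultimately show ?thesis by simp
    qed
    moreover have "((\<lambda>t. field (c t) (\<gamma> t)) has_vector_derivative
        dfield (c t) (\<gamma> t) (field x (\<gamma> t)) + field (v - br x (c t)) (\<gamma> t)) (at t)"
    proof -
      have "((\<lambda>t. Y j (\<gamma> t)) has_vector_derivative frechet_derivative (Y j) (at (\<gamma> t)) (field x (\<gamma> t))) (at t)" for j
        using has_derivative_compose[OF \<gamma>[unfolded has_vector_derivative_def] Y_has_derivative, of j t]
        by (simp add: has_vector_derivative_def linear_cmul[OF has_derivative_linear[OF Y_has_derivative]])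
      moreover have "((\<lambda>t. c t $ j) has_real_derivative (v - br x (c t)) $ j) (at t)" for j
        using dexp_curve_has_vector_derivative[of x v t] unfolding has_vector_derivative_vec_iff c_def by blast
      ultimately have "((\<lambda>t. \<Sum>j\<in>UNIV. c t $ j *\<^sub>R Y j (\<gamma> t)) has_vector_derivative
          (\<Sum>j\<in>UNIV. c t $ j *\<^sub>R frechet_derivative (Y j) (at (\<gamma> t)) (field x (\<gamma> t)) +
            (v - br x (c t)) $ j *\<^sub>R Y j (\<gamma> t))) (at t)"
        by (intro has_vector_derivative_sum has_vector_derivative_scaleR)
      then show ?thesis by (simp add: field_def dfield_def sum.distrib)
    qed
    ultimately have "(\<Delta> has_vector_derivative
        dfield x (\<gamma> t) (t *\<^sub>R dflow (t *\<^sub>R x) v) + field v (\<gamma> t) -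
        (dfield (c t) (\<gamma> t) (field x (\<gamma> t)) + field (v - br x (c t)) (\<gamma> t))) (at t)"
      unfolding \<Delta>_def by (auto intro: has_vector_derivative_diff)
    \<comment> \<open>The bracket relation turns d(field c)(field x) - field [x, c] into d(field
      x)(field c), so \<open>field (c t) (\<gamma> t)\<close> solves the same inhomogeneous linear
      equation and the terms \<open>field v\<close> cancel in the difference.\<close>
    then show ?thesis
      using field_bracket[of "c t" "\<gamma> t" x]
      by (simp add: \<Delta>_def linear_diff[OF linear_field] linear_diff[OF linear_dfield] algebra_simps)
  qed
  have "\<Delta> t $ k = 0" for t k
  proof (induction "w k" arbitrary: t k rule: less_induct)
    case less
    have "((\<lambda>t. \<Delta> t $ k) has_real_derivative 0) (at t)" for t
      using \<Delta>[of t, unfolded has_vector_derivative_vec_iff, rule_format, of k]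
      by (simp add: dfield_lower less)
    then have "\<Delta> t $ k = \<Delta> 0 $ k" by (intro DERIV_isconst_all) auto
    also have "\<dots> = 0"
      by (simp add: \<Delta>_def c_def dexp_curve_def linear_0[OF linear_field])
    finally show ?case .
  qed
  then have "\<Delta> 1 = 0" by (simp add: vec_eq_iff)
  then show ?thesis by (simp add: \<Delta>_def c_def \<gamma>_def dexp_curve_def dexp_ad_def)
qed

section \<open>The inverse map and left-invariant fields\<close>

definition flow_inv :: "real ^ 'n \<Rightarrow> real ^ 'n" where
  "flow_inv = inv flow"

lemma polynomial_flow_inv: "polynomial_function flow_inv"
  and flow_inv_flow [simp]: "flow_inv (flow x) = x" and flow_flow_inv [simp]: "flow (flow_inv y) = y"
proof -
  obtain g where g: "polynomial_function g" "\<And>x. g (flow x) = x" "\<And>y. flow (g y) = y"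
    using ex_flow_inverse by auto
  then have "flow_inv = g"
    unfolding flow_inv_def by (intro inv_unique_comp) (auto simp: fun_eq_iff)
  with g show "polynomial_function flow_inv" "flow_inv (flow x) = x" "flow (flow_inv y) = y" by auto
qed

lemma smooth_flow_inv: "smooth_on UNIV flow_inv"
  using polynomial_flow_inv by (rule smooth_on_polynomial)

lemma flow_inv_dil: "flow_inv (dil w s y) = dil w s (flow_inv y)"
  by (metis flow_dil flow_inv_flow flow_flow_inv)

lemma dflow_inv_dflow: "frechet_derivative flow_inv (at (flow x)) (dflow x v) = v"
proof -
  have "((\<lambda>x. flow_inv (flow x)) has_derivative (\<lambda>v. frechet_derivative flow_inv (at (flow x)) (dflow x v))) (at x)"
    by (rule has_derivative_compose[OF flow_has_derivative smooth_on_has_derivative[OF smooth_flow_inv UNIV_I]])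
  then have "((\<lambda>x. x) has_derivative (\<lambda>v. frechet_derivative flow_inv (at (flow x)) (dflow x v))) (at x)" by simp
  from fun_cong[OF has_derivative_unique[OF this has_derivative_ident]] show ?thesis .
qed

text \<open>Here the two series meet: applying \<open>dexp_ad r x\<close> to the right-hand side
  gives \<open>axis j 1\<close>, so \<open>dflow x\<close> maps that side to Y_j. The same
  expression is the left-invariant field.\<close>

lemma flow_inv_pushforward: "frechet_derivative flow_inv (at (flow x)) (Y j (flow x)) = dynkin_ad r x (axis j 1)"
proof -
  have "0 < r" using w_pos[of j] w_le[of j] by simp
  then have "dexp_ad r x (dynkin_ad r x (axis j 1)) = axis j 1"
    by (intro dexp_dynkin_ad ad_funpow_eq_0)
  then have "dflow x (dynkin_ad r x (axis j 1)) = Y j (flow x)"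
    by (simp add: dflow_eq_field field_axis)
  then show ?thesis by (metis dflow_inv_dflow)
qed

lemma left_invariant_field_eq:
  "left_invariant_field (dynkin_product r br) j x = dynkin_ad r x (axis j 1)"
  by (simp add: left_invariant_field_def frechet_derivative_dynkin_product dynkin_ad_def)

lemma left_invariant_field_0: "left_invariant_field (dynkin_product r br) j 0 = axis j 1"
proof -
  have "dflow 0 u = field u 0" for u
  proof -
    have "((\<lambda>t. t *\<^sub>R u) has_derivative (\<lambda>t. t *\<^sub>R u)) (at 0)"
      by (auto intro!: derivative_eq_intros)
    then have "((\<lambda>t. flow (t *\<^sub>R u)) has_derivative (\<lambda>t. dflow (0 *\<^sub>R u) (t *\<^sub>R u))) (at 0)"
      using flow_has_derivative by (rule has_derivative_compose)
    then have "((\<lambda>t. flow (t *\<^sub>R u)) has_vector_derivative dflow 0 u) (at 0)"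
      by (simp add: has_vector_derivative_def linear_cmul[OF linear_dflow])
    moreover have "((\<lambda>t. flow (t *\<^sub>R u)) has_vector_derivative field u 0) (at 0)"
      using flow_ode[of u 0] by simp
    ultimately show ?thesis by (rule vector_derivative_unique_at)
  qed
  from this[of "axis j 1"] have "dflow 0 (axis j 1) = axis j 1" by (simp add: field_axis Y_0)
  then show ?thesis
    using flow_inv_pushforward[of 0 j] dflow_inv_dflow[of 0 "axis j 1"]
    by (simp add: left_invariant_field_eq Y_0)
qed

end

section \<open>Dilated vector fields\<close>

definition dilated :: "('n::finite \<Rightarrow> nat) \<Rightarrow> nat \<Rightarrow> (real ^ 'n \<Rightarrow> real ^ 'n) \<Rightarrow> real \<Rightarrow> real ^ 'n \<Rightarrow> real ^ 'n" where
  "dilated w d Z t x = t ^ d *\<^sub>R dil_pullback w t Z x"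

lemma dilated_nth: "dilated w d Z t x $ k = t ^ d * (Z (dil w t x) $ k / t ^ w k)"
  by (simp add: dilated_def dil_pullback_def)

text \<open>Applying \<open>dil w t\<close> clears the denominators t^(w_k), so derivatives of
  dilated fields can be found by the chain rule.\<close>

lemma dil_dilated: "t \<noteq> 0 \<Longrightarrow> dil w t (dilated w d Z t x) = t ^ d *\<^sub>R Z (dil w t x)"
  by (simp add: vec_eq_iff dilated_nth)

lemma linear_dil: "linear (dil w t)"
  by (rule linearI) (simp_all add: vec_eq_iff algebra_simps)

lemma bounded_linear_dil: "bounded_linear (dil w t)"
  using linear_dil by (simp add: linear_conv_bounded_linear)

text \<open>For |t| < 1 and weights at least 1, |\<delta>_t x| \<le> |t| |x|, so the dilates of a
  compact set shrink uniformly to 0.\<close>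

lemma eventually_dil_subset:
  fixes w :: "'n::finite \<Rightarrow> nat"
  assumes "\<And>i. 1 \<le> w i" "compact K" "open U" "0 \<in> U"
  shows "\<forall>\<^sub>F t in at 0. t \<noteq> 0 \<and> dil w t ` K \<subseteq> U"
proof -
  obtain e where e: "e > 0" "ball 0 e \<subseteq> U" using assms(3,4) open_contains_ball by blast
  obtain R where R: "R > 0" "\<And>x. x \<in> K \<Longrightarrow> norm x \<le> R"
    using compact_imp_bounded[OF assms(2)] bounded_pos by blast
  have "dil w t x \<in> U" if "\<bar>t\<bar> < min 1 (e / R)" "x \<in> K" for t x
  proof -
    have "norm (dil w t x) \<le> norm (t *\<^sub>R x)"
    proof (rule norm_le_componentwise_cart)
      fix i
      have "\<bar>t\<bar> ^ w i \<le> \<bar>t\<bar> ^ 1" using assms(1)[of i] that by (intro power_decreasing) auto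
      then show "norm (dil w t x $ i) \<le> norm ((t *\<^sub>R x) $ i)"
        by (simp add: abs_mult power_abs mult_right_mono)
    qed
    also have "\<dots> \<le> \<bar>t\<bar> * R" using R(2)[OF that(2)] by (simp add: mult_left_mono)
    also have "\<dots> < e" using that R(1) by (simp add: pos_less_divide_eq)
    finally show ?thesis using e(2) by auto
  qed
  moreover have "min 1 (e / R) > 0" using e R by simp
  ultimately show ?thesis
    unfolding eventually_at by (intro exI[of _ "min 1 (e / R)"]) auto
qed

lemma smooth_on_dilated:
  fixes w :: "'n::finite \<Rightarrow> nat"
  assumes "open U" "smooth_on U Z"
  shows "smooth_on (dil w t -` U) (dilated w d Z t)" and "open (dil w t -` U)"
proof -
  show o: "open (dil w t -` U)"
    using assms(1) linear_continuous_on[OF bounded_linear_dil] by (intro open_vimage) auto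
  have "linear (\<lambda>v :: real ^ 'n. (\<chi> k. t ^ d * (v $ k / t ^ w k)) :: real ^ 'n)"
    by (rule linearI) (simp_all add: vec_eq_iff algebra_simps add_divide_distrib)
  then have l: "bounded_linear (\<lambda>v :: real ^ 'n. (\<chi> k. t ^ d * (v $ k / t ^ w k)) :: real ^ 'n)"
    by (simp add: linear_conv_bounded_linear)
  have "smooth_on (dil w t -` U) (\<lambda>x. Z (dil w t x))"
    by (rule smooth_on_compose[OF assms(1) o assms(2)
        smooth_on_subset[OF smooth_on_bounded_linear[OF bounded_linear_dil]]]) auto
  from smooth_on_bounded_linear_compose[OF o l this]
  show "smooth_on (dil w t -` U) (dilated w d Z t)"
    by (rule smooth_on_cong[OF o, rotated]) (simp add: vec_eq_iff dilated_nth)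
qed

lemma is_model_field_imp_ctendsto:
  assumes "\<And>i. 1 \<le> w i" "open U" "0 \<in> U" "smooth_on U Z" "is_model_field w d Z Y"
  shows "ctendsto k (at 0) UNIV (dilated w d Z) Y"
proof (rule partial_deriv_imp_ctendsto)
  show "smooth_on UNIV Y" using assms(5) by (auto simp: is_model_field_def intro: smooth_on_polynomial)
  show "\<forall>\<^sub>F t in at 0. smooth_on K (dilated w d Z t)" if "compact K" for K
    using eventually_dil_subset[where w = w, OF assms(1) that assms(2,3)]
  proof eventually_elim
    case (elim t)
    then show ?case using smooth_on_dilated(1)[OF assms(2,4), of w t d] by (auto intro: smooth_on_subset)
  qed
  show "uniform_limit K (\<lambda>t. partial_deriv I (dilated w d Z t)) (partial_deriv I Y) (at 0)" if "compact K" for K I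
    using assms(5) that unfolding is_model_field_def dilated_def[abs_def] by blast
qed

lemma ctendsto_imp_is_model_field:
  assumes "polynomial_function Y" "\<And>k. ctendsto k (at 0) UNIV (dilated w d Z) Y"
  shows "is_model_field w d Z Y"
  unfolding is_model_field_def
proof (intro conjI allI impI assms(1))
  fix K :: "(real ^ 'a) set" and I assume "compact K"
  then show "uniform_limit K (\<lambda>t. partial_deriv I (\<lambda>x. t ^ d *\<^sub>R dil_pullback w t Z x)) (partial_deriv I Y) (at 0)"
    using ctendsto_uniform_limit[OF ctendsto_imp_partial_deriv[OF assms(2)], of K]
    unfolding dilated_def[abs_def] by simp
qed

lemma tendsto_eventually_eq:
  fixes f g :: "'a::perfect_space \<Rightarrow> 'b::t2_space"
  assumes "(f \<longlongrightarrow> a) (at x)" "(g \<longlongrightarrow> b) (at x)" "\<forall>\<^sub>F t in at x. f t = g t"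
  shows "a = b"
  using tendsto_unique[OF at_neq_bot Lim_transform_eventually[OF assms(1,3)] assms(2)] .

lemma ctendsto_pointwise:
  assumes "ctendsto k F S f g" "x \<in> S"
  shows "((\<lambda>t. f t x) \<longlongrightarrow> g x) F"
  using ctendsto_uniform_limit[OF assms(1), of "{x}"] assms(2) by (auto intro: tendsto_uniform_limitI)

section \<open>Relations inherited by the model fields\<close>

locale model_fields =
  fixes w :: "'n::finite \<Rightarrow> nat" and U :: "(real ^ 'n) set"
    and Z Y :: "'n \<Rightarrow> real ^ 'n \<Rightarrow> real ^ 'n"
  assumes w_pos: "1 \<le> w j" and open_U: "open U" and zero_U: "0 \<in> U"
    and smooth_Z: "smooth_on U (Z j)" and Z_0: "Z j 0 = axis j 1"
    and model: "is_model_field w (w j) (Z j) (Y j)"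
begin

abbreviation "Zt t j \<equiv> dilated w (w j) (Z j) t"

lemma Zt_tendsto: "ctendsto k (at 0) UNIV (\<lambda>t. Zt t j) (Y j)"
  using is_model_field_imp_ctendsto[OF w_pos open_U zero_U smooth_Z model] .

lemma eventually_Zt: "\<forall>\<^sub>F t in at 0. t \<noteq> 0 \<and> dil w t x \<in> U"
  using eventually_dil_subset[OF w_pos _ open_U zero_U, of "{x}"] by simp

lemma Zt_pointwise: "((\<lambda>t. Zt t j x) \<longlongrightarrow> Y j x) (at 0)"
  using ctendsto_pointwise[OF Zt_tendsto] by simp

text \<open>As \<delta>_t \<delta>_s = \<delta>_(st), dilating by s \<noteq> 0 only reparametrises
  the limit defining Y_j. At s = 0 both sides vanish.\<close>

lemma model_homogeneous: "s ^ w j * Y j (dil w s x) $ k = s ^ w k * Y j x $ k"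
proof (cases "s = 0")
  case False
  have "((\<lambda>t. Zt t j (dil w s x) $ k) \<longlongrightarrow> Y j (dil w s x) $ k) (at 0)"
    by (intro tendsto_vec_nth Zt_pointwise)
  then have "((\<lambda>t. s ^ w j * Zt t j (dil w s x) $ k) \<longlongrightarrow> s ^ w j * Y j (dil w s x) $ k) (at 0)"
    by (rule tendsto_mult_left)
  note l = this
  have "((\<lambda>t. s ^ w k * Zt t j x $ k) \<longlongrightarrow> s ^ w k * Y j x $ k) (at 0)"
    by (intro tendsto_intros tendsto_mult_left tendsto_vec_nth Zt_pointwise)
  moreover have "filterlim (\<lambda>t. s * t) (at 0) (at 0)"
    using False by (auto intro!: tendsto_eq_intros simp: filterlim_at eventually_at_filter)
  ultimately have "((\<lambda>t. s ^ w k * Zt (s * t) j x $ k) \<longlongrightarrow> s ^ w k * Y j x $ k) (at 0)"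
    by (rule filterlim_compose)
  note r = this
  have "s ^ w j * Zt t j (dil w s x) $ k = s ^ w k * Zt (s * t) j x $ k" if "t \<noteq> 0" for t
  proof -
    have "dil w t (dil w s x) = dil w (s * t) x" by (simp add: vec_eq_iff power_mult_distrib)
    then show ?thesis using False that by (simp add: dilated_nth power_mult_distrib)
  qed
  then have "\<forall>\<^sub>F t in at 0. s ^ w j * Zt t j (dil w s x) $ k = s ^ w k * Zt (s * t) j x $ k"
    by (auto simp: eventually_at_filter)
  then show ?thesis by (rule tendsto_eventually_eq[OF l r])
qed (use w_pos[of j] w_pos[of k] in \<open>simp add: zero_power\<close>)

lemma model_0: "Y j 0 = axis j 1"
proof -
  have "\<forall>\<^sub>F t in at 0. Zt t j 0 $ k = axis j 1 $ k" for k
    by (auto simp: eventually_at_filter dilated_nth dil_def Z_0 axis_def zero_vec_def[symmetric])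
  then have "((\<lambda>t. Zt t j 0 $ k) \<longlongrightarrow> axis j 1 $ k) (at 0)" for k
    by (rule tendsto_eventually)
  moreover have "((\<lambda>t. Zt t j 0 $ k) \<longlongrightarrow> Y j 0 $ k) (at 0)" for k
    by (intro tendsto_vec_nth Zt_pointwise)
  ultimately show ?thesis
    using tendsto_unique[OF at_neq_bot] by (metis vec_eq_iff)
qed

lemma Zt_has_derivative:
  assumes "t \<noteq> 0" "dil w t p \<in> U"
  shows "(Zt t j has_derivative frechet_derivative (Zt t j) (at p)) (at p)"
    and "t ^ w k * frechet_derivative (Zt t j) (at p) v $ k =
      t ^ w j * frechet_derivative (Z j) (at (dil w t p)) (dil w t v) $ k"
proof -
  show D: "(Zt t j has_derivative frechet_derivative (Zt t j) (at p)) (at p)"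
    using smooth_on_has_derivative[OF smooth_on_dilated(1)[OF open_U smooth_Z]] assms by simp
  have "((\<lambda>x. dil w t (Zt t j x)) has_derivative (\<lambda>v. dil w t (frechet_derivative (Zt t j) (at p) v))) (at p)"
    by (rule bounded_linear.has_derivative[OF bounded_linear_dil D])
  moreover have "((\<lambda>x. t ^ w j *\<^sub>R Z j (dil w t x)) has_derivative
      (\<lambda>v. t ^ w j *\<^sub>R frechet_derivative (Z j) (at (dil w t p)) (dil w t v))) (at p)"
    by (intro has_derivative_scaleR_right has_derivative_compose[OF
        bounded_linear_imp_has_derivative[OF bounded_linear_dil] smooth_on_has_derivative[OF smooth_Z assms(2)]])
  ultimately have "(\<lambda>v. dil w t (frechet_derivative (Zt t j) (at p) v)) =
      (\<lambda>v. t ^ w j *\<^sub>R frechet_derivative (Z j) (at (dil w t p)) (dil w t v))"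
    using assms(1) by (simp add: dil_dilated has_derivative_unique)
  from fun_cong[OF this, of v] show "t ^ w k * frechet_derivative (Zt t j) (at p) v $ k =
      t ^ w j * frechet_derivative (Z j) (at (dil w t p)) (dil w t v) $ k"
    by (simp add: vec_eq_iff)
qed

text \<open>The direction moves with t as well; in the standard basis the expression is a sum of
  products of convergent factors.\<close>

lemma Zt_derivative_tendsto:
  "((\<lambda>t. frechet_derivative (Zt t j) (at p) (Zt t i p)) \<longlongrightarrow> frechet_derivative (Y j) (at p) (Y i p)) (at 0)"
proof -
  have 1: "ctendsto (Suc 0) (at 0) UNIV (\<lambda>t. Zt t j) (Y j)" by (rule Zt_tendsto)
  have "((\<lambda>t. \<Sum>l\<in>UNIV. Zt t i p $ l *\<^sub>R frechet_derivative (Zt t j) (at p) (axis l 1)) \<longlongrightarrow>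
      (\<Sum>l\<in>UNIV. Y i p $ l *\<^sub>R frechet_derivative (Y j) (at p) (axis l 1))) (at 0)"
    by (intro tendsto_sum tendsto_scaleR tendsto_vec_nth Zt_pointwise
        ctendsto_pointwise[OF ctendsto_Suc_derivative(3)[OF 1]]) (auto simp: Basis_vec_axis)
  also have "(\<Sum>l\<in>UNIV. Y i p $ l *\<^sub>R frechet_derivative (Y j) (at p) (axis l 1)) =
      frechet_derivative (Y j) (at p) (Y i p)"
    by (rule linear_vec_expansion[symmetric, OF has_derivative_linear[OF ctendsto_Suc_derivative(2)[OF 1 UNIV_I]]])
  finally show ?thesis
  proof (rule Lim_transform_eventually)
    show "\<forall>\<^sub>F t in at 0. (\<Sum>l\<in>UNIV. Zt t i p $ l *\<^sub>R frechet_derivative (Zt t j) (at p) (axis l 1)) =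
        frechet_derivative (Zt t j) (at p) (Zt t i p)"
      using eventually_Zt[of p]
      by eventually_elim (intro linear_vec_expansion[symmetric] has_derivative_linear[OF Zt_has_derivative(1)]; simp)
  qed
qed

text \<open>Dilation multiplies the coefficient of Z_l in the bracket relation by t^(w_i + w_j -
  w_l). Weights w_l above w_i + w_j are excluded by hypothesis, those below die in the limit, and
  equality keeps the coefficient at 0.\<close>

lemma model_bracket:
  assumes B: "\<And>q. q \<in> U \<Longrightarrow> frechet_derivative (Z j) (at q) (Z i q) - frechet_derivative (Z i) (at q) (Z j q) =
      (\<Sum>l\<in>UNIV. c q $ l *\<^sub>R Z l q)"
    and c: "\<And>q l. q \<in> U \<Longrightarrow> w i + w j < w l \<Longrightarrow> c q $ l = 0"
    and cont: "isCont c 0"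
  shows "frechet_derivative (Y j) (at p) (Y i p) - frechet_derivative (Y i) (at p) (Y j p) =
    (\<Sum>l | w l = w i + w j. c 0 $ l *\<^sub>R Y l p)"
proof -
  have "(frechet_derivative (Y j) (at p) (Y i p) - frechet_derivative (Y i) (at p) (Y j p)) $ k =
    (\<Sum>l | w l = w i + w j. c 0 $ l *\<^sub>R Y l p) $ k" for k
  proof -
    let ?B = "\<lambda>t. frechet_derivative (Zt t j) (at p) (Zt t i p) - frechet_derivative (Zt t i) (at p) (Zt t j p)"
    let ?R = "\<lambda>t. \<Sum>l | w l \<le> w i + w j. c (dil w t p) $ l * t ^ (w i + w j - w l) * Zt t l p $ k"
    have "((\<lambda>t. ?B t $ k) \<longlongrightarrow>
        (frechet_derivative (Y j) (at p) (Y i p) - frechet_derivative (Y i) (at p) (Y j p)) $ k) (at 0)"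
      by (intro tendsto_vec_nth tendsto_diff Zt_derivative_tendsto)
    note l = this
    have "(?R \<longlongrightarrow> (\<Sum>l | w l \<le> w i + w j. c 0 $ l * 0 ^ (w i + w j - w l) * Y l p $ k)) (at 0)"
    proof -
      have "((\<lambda>t. dil w t p) \<longlongrightarrow> dil w 0 p) (at 0)"
        unfolding dil_def by (intro tendsto_intros)
      moreover have "dil w 0 p = 0"
        using w_pos by (simp add: vec_eq_iff zero_power Suc_le_lessD)
      ultimately have "((\<lambda>t. c (dil w t p)) \<longlongrightarrow> c 0) (at 0)"
        using isCont_tendsto_compose[OF cont] by simp
      then show ?thesis by (intro tendsto_intros Zt_pointwise)
    qed
    note r = this
    have "\<forall>\<^sub>F t in at 0. ?B t $ k = ?R t"
      using eventually_Zt[of p]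
    proof eventually_elim
      case (elim t)
      let ?q = "dil w t p"
      have D: "t ^ w k * frechet_derivative (Zt t j) (at p) (Zt t i p) $ k =
          t ^ (w i + w j) * frechet_derivative (Z j) (at ?q) (Z i ?q) $ k" for i j
        using elim has_derivative_linear[OF smooth_on_has_derivative[OF smooth_Z[of j]], of ?q]
        by (simp add: Zt_has_derivative(2) dil_dilated linear_cmul power_add mult_ac)
      have "t ^ w k * ?B t $ k = t ^ (w i + w j) *
          (frechet_derivative (Z j) (at ?q) (Z i ?q) - frechet_derivative (Z i) (at ?q) (Z j ?q)) $ k"
        using D[of j i] D[of i j] by (simp add: right_diff_distrib add.commute)
      also have "\<dots> = (\<Sum>l\<in>UNIV. t ^ (w i + w j) * (c ?q $ l * Z l ?q $ k))"
        using elim by (simp add: B sum_component sum_distrib_left)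
      also have "\<dots> = (\<Sum>l | w l \<le> w i + w j. t ^ (w i + w j) * (c ?q $ l * Z l ?q $ k))"
        using elim c by (intro sum.mono_neutral_right) (auto simp: not_le)
      also have "\<dots> = (\<Sum>l | w l \<le> w i + w j. t ^ w k * (c ?q $ l * t ^ (w i + w j - w l) * Zt t l p $ k))"
      proof (intro sum.cong refl)
        fix l assume "l \<in> {l. w l \<le> w i + w j}"
        then have "t ^ (w i + w j) = t ^ (w i + w j - w l) * t ^ w l" by (simp flip: power_add)
        then show "t ^ (w i + w j) * (c ?q $ l * Z l ?q $ k) =
            t ^ w k * (c ?q $ l * t ^ (w i + w j - w l) * Zt t l p $ k)"
          using elim by (simp add: dilated_nth)
      qed
      also have "\<dots> = t ^ w k * ?R t" by (simp add: sum_distrib_left)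
      finally show ?case using elim by simp
    qed
    then have "(frechet_derivative (Y j) (at p) (Y i p) - frechet_derivative (Y i) (at p) (Y j p)) $ k =
        (\<Sum>l | w l \<le> w i + w j. c 0 $ l * 0 ^ (w i + w j - w l) * Y l p $ k)"
      by (rule tendsto_eventually_eq[OF l r])
    also have "\<dots> = (\<Sum>l | w l = w i + w j. c 0 $ l * Y l p $ k)"
      by (rule sum.mono_neutral_cong_right) auto
    finally show ?thesis by (simp add: sum_component)
  qed
  then show ?thesis by (simp add: vec_eq_iff)
qed

lemma smooth_on_deriv_word:
  assumes "smooth_on U f"
  shows "smooth_on U (deriv_word Z I f)"
proof (induction I)
  case (Cons i I)
  have "smooth_on U (\<lambda>x. \<Sum>l\<in>UNIV. Z i x $ l *\<^sub>R frechet_derivative (deriv_word Z I f) (at x) (axis l 1))"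
    by (intro smooth_on_sum smooth_on_scaleR open_U smooth_on_frechet_derivative Cons.IH
        smooth_on_bounded_linear_compose[OF open_U bounded_linear_vec_nth] smooth_Z)
  then show ?case
    by (rule smooth_on_cong[OF open_U, rotated])
       (simp add: linear_vec_expansion[symmetric, OF has_derivative_linear[OF smooth_on_has_derivative[OF Cons.IH]]]
         del: real_scaleR_def)
qed (simp add: assms)

text \<open>Each letter i contributes t^(w_i), since \<delta>_t maps the dilated field at x to
  t^(w_i) Z_i. With c = t^(-w_j) a coordinate x_j is reproduced by its own dilate.\<close>

lemma deriv_word_dilated:
  assumes "t \<noteq> 0" "smooth_on U f" "\<And>x. g x = c * f (dil w t x)" "dil w t x \<in> U"
  shows "deriv_word (Zt t) I g x = c * t ^ sum_list (map w I) * deriv_word Z I f (dil w t x)"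
  using assms(4)
proof (induction I arbitrary: x)
  case (Cons i I)
  let ?c = "c * t ^ sum_list (map w I)" and ?h = "deriv_word Z I f"
  have "((\<lambda>x. ?c * ?h (dil w t x)) has_derivative
      (\<lambda>v. ?c * frechet_derivative ?h (at (dil w t x)) (dil w t v))) (at x)"
    by (intro has_derivative_mult_right has_derivative_compose[OF
        bounded_linear_imp_has_derivative[OF bounded_linear_dil]
        smooth_on_has_derivative[OF smooth_on_deriv_word[OF assms(2)] Cons.prems]])
  then have "(deriv_word (Zt t) I g has_derivative
      (\<lambda>v. ?c * frechet_derivative ?h (at (dil w t x)) (dil w t v))) (at x)"
    by (rule has_derivative_transform_within_open[OF _ smooth_on_dilated(2)[OF open_U smooth_Z, of w t]])
       (use Cons in auto)
  from fun_cong[OF frechet_derivative_at[OF this], of "Zt t i x"]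
  have "frechet_derivative (deriv_word (Zt t) I g) (at x) (Zt t i x) =
      ?c * frechet_derivative ?h (at (dil w t x)) (t ^ w i *\<^sub>R Z i (dil w t x))"
    using assms(1) by (simp add: dil_dilated)
  then show ?case
    using has_derivative_linear[OF smooth_on_has_derivative[OF smooth_on_deriv_word[OF assms(2)] Cons.prems]]
    by (simp add: linear_cmul power_add)
qed (simp add: assms(3))

lemma deriv_word_Zt_tendsto:
  assumes "smooth_on UNIV g"
  shows "ctendsto k (at 0) UNIV (\<lambda>t. deriv_word (Zt t) I g) (deriv_word Y I g)"
proof (induction I arbitrary: k)
  case Nil
  show ?case using ctendsto_smooth[OF open_UNIV assms] by simp
next
  case (Cons i I)
  note d = ctendsto_Suc_derivative[OF Cons.IH[of "Suc k"]]
  have "ctendsto k (at 0) UNIV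
      (\<lambda>t x. \<Sum>l\<in>UNIV. Zt t i x $ l *\<^sub>R frechet_derivative (deriv_word (Zt t) I g) (at x) (axis l 1))
      (\<lambda>x. \<Sum>l\<in>UNIV. Y i x $ l *\<^sub>R frechet_derivative (deriv_word Y I g) (at x) (axis l 1))"
    by (intro ctendsto_sum ctendsto_scaleR open_UNIV
        ctendsto_bounded_linear[OF open_UNIV bounded_linear_vec_nth] Zt_tendsto d(3))
       (auto simp: Basis_vec_axis)
  then show ?case
  proof (rule ctendsto_cong[OF open_UNIV, rotated 2])
    show "\<forall>\<^sub>F t in at 0. \<forall>x\<in>K.
        (\<Sum>l\<in>UNIV. Zt t i x $ l *\<^sub>R frechet_derivative (deriv_word (Zt t) I g) (at x) (axis l 1)) =
        deriv_word (Zt t) (i # I) g x" if "compact K" for K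
      using d(1)[OF that subset_UNIV]
      by eventually_elim (auto intro!: linear_vec_expansion[symmetric] has_derivative_linear simp del: real_scaleR_def)
    show "(\<Sum>l\<in>UNIV. Y i x $ l *\<^sub>R frechet_derivative (deriv_word Y I g) (at x) (axis l 1)) =
        deriv_word Y (i # I) g x" for x
      using linear_vec_expansion[symmetric, OF has_derivative_linear[OF d(2)[OF UNIV_I]]] by (simp del: real_scaleR_def)
  qed
qed

text \<open>Since \<open>x $ j\<close> is homogeneous of degree \<open>w j\<close>, its derivative along a word of weight \<open>d\<close> is
  \<open>t ^ (w j - d)\<close> times the corresponding derivative along the dilated fields, which converges.\<close>

lemma has_order_coordinate: "has_order w Z (\<lambda>x. x $ j) (w j) 0"
  unfolding has_order_def
proof (intro conjI allI impI exI[of _ "[j]"])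
  fix I assume lt: "sum_list (map w I) < w j"
  have sm: "smooth_on S (\<lambda>x :: real ^ 'n. x $ j)" for S
    by (rule smooth_on_subset[OF smooth_on_bounded_linear[OF bounded_linear_vec_nth] subset_UNIV])
  let ?m = "w j - sum_list (map w I)" and ?g = "\<lambda>x :: real ^ 'n. x $ j"
  have "((\<lambda>t. t ^ ?m * deriv_word (Zt t) I ?g 0) \<longlongrightarrow> 0 ^ ?m * deriv_word Y I ?g 0) (at 0)"
    by (intro tendsto_intros ctendsto_pointwise[OF deriv_word_Zt_tendsto[OF sm]]) simp
  note l = this
  have "\<forall>\<^sub>F t in at 0. t ^ ?m * deriv_word (Zt t) I ?g 0 = deriv_word Z I ?g 0"
    using eventually_Zt[of 0]
  proof eventually_elim
    case (elim t)
    have 0: "dil w t 0 = 0" by (simp add: vec_eq_iff)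
    have "deriv_word (Zt t) I ?g 0 = 1 / t ^ w j * t ^ sum_list (map w I) * deriv_word Z I ?g (dil w t 0)"
      by (rule deriv_word_dilated) (use elim sm in auto)
    then have "t ^ ?m * deriv_word (Zt t) I ?g 0 =
        (t ^ ?m * t ^ sum_list (map w I)) / t ^ w j * deriv_word Z I ?g 0"
      unfolding 0 by simp
    also have "t ^ ?m * t ^ sum_list (map w I) = t ^ w j" using lt by (simp flip: power_add)
    finally show ?case using elim by simp
  qed
  then have "0 ^ ?m * deriv_word Y I ?g 0 = deriv_word Z I ?g 0"
    by (rule tendsto_eventually_eq[OF l tendsto_const])
  then show "deriv_word Z I ?g 0 = 0" using lt by (simp add: zero_power)
next
  have "frechet_derivative (\<lambda>x :: real ^ 'n. x $ j) (at 0) = (\<lambda>x. x $ j)"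
    by (metis bounded_linear_imp_has_derivative bounded_linear_vec_nth frechet_derivative_at)
  then show "deriv_word Z [j] (\<lambda>x. x $ j) 0 \<noteq> 0" by (simp add: Z_0)
qed simp

end

section \<open>Pullback of model fields along the time-one map\<close>

context graded_fields begin

lemma frechet_derivative_flow_inv_dil:
  "frechet_derivative flow_inv (at (dil w t y)) (dil w t u) = dil w t (frechet_derivative flow_inv (at y) u)"
proof -
  have D: "(flow_inv has_derivative frechet_derivative flow_inv (at y)) (at y)" for y
    using smooth_on_has_derivative[OF smooth_flow_inv] by simp
  have "((\<lambda>y. flow_inv (dil w t y)) has_derivative (\<lambda>u. frechet_derivative flow_inv (at (dil w t y)) (dil w t u))) (at y)"
    by (rule has_derivative_compose[OF bounded_linear_imp_has_derivative[OF bounded_linear_dil] D])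
  moreover have "((\<lambda>y. dil w t (flow_inv y)) has_derivative (\<lambda>u. dil w t (frechet_derivative flow_inv (at y) u))) (at y)"
    by (rule bounded_linear.has_derivative[OF bounded_linear_dil D])
  ultimately show ?thesis
    unfolding flow_inv_dil by (metis has_derivative_unique)
qed

text \<open>Since the flow commutes with dilations, the dilates of Z' are the pullbacks of the
  dilates of Z, and convergence passes through fixed smooth maps. Prescribing Z' over
  \<open>U\<close> suffices, because dilations carry every compact set into the preimage of
  \<open>U\<close>.\<close>

lemma is_model_field_flow_pullback:
  assumes "open U" "0 \<in> U" "smooth_on U Z" "is_model_field w (w j) Z (Y j)"
    and Z': "\<And>x. flow x \<in> U \<Longrightarrow> Z' x = frechet_derivative flow_inv (at (flow x)) (Z (flow x))"
  shows "is_model_field w (w j) Z' (left_invariant_field (dynkin_product r br) j)"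
proof (rule ctendsto_imp_is_model_field)
  show "polynomial_function (left_invariant_field (dynkin_product r br) j)"
    using polynomial_dynkin_ad[of r "axis j 1"] by (simp add: left_invariant_field_eq[abs_def])
  fix k
  let ?G = "\<lambda>x. frechet_derivative flow_inv (at (flow x))"
  have D: "(flow_inv has_derivative frechet_derivative flow_inv (at y)) (at y)" for y
    using smooth_on_has_derivative[OF smooth_flow_inv] by simp
  have exp: "?G x u = (\<Sum>l\<in>UNIV. u $ l *\<^sub>R ?G x (axis l 1))" for x u
    by (rule linear_vec_expansion[OF has_derivative_linear[OF D]])
  have "ctendsto k (at 0) UNIV
      (\<lambda>t x. \<Sum>l\<in>UNIV. dilated w (w j) Z t (flow x) $ l *\<^sub>R ?G x (axis l 1))
      (\<lambda>x. \<Sum>l\<in>UNIV. Y j (flow x) $ l *\<^sub>R ?G x (axis l 1))"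
  proof (intro ctendsto_sum ctendsto_scaleR open_UNIV)
    fix l
    have "ctendsto k (at 0) UNIV (\<lambda>t x. dilated w (w j) Z t (flow x)) (\<lambda>x. Y j (flow x))"
      by (rule ctendsto_compose[OF open_UNIV open_UNIV subset_UNIV ctendsto_smooth[OF open_UNIV smooth_flow]
          is_model_field_imp_ctendsto[OF w_pos assms(1-4)]])
    then show "ctendsto k (at 0) UNIV (\<lambda>t x. dilated w (w j) Z t (flow x) $ l) (\<lambda>x. Y j (flow x) $ l)"
      by (rule ctendsto_bounded_linear[OF open_UNIV bounded_linear_vec_nth])
    show "ctendsto k (at 0) UNIV (\<lambda>t x. ?G x (axis l 1)) (\<lambda>x. ?G x (axis l 1))"
      by (intro ctendsto_smooth open_UNIV smooth_on_compose[OF open_UNIV open_UNIV _ smooth_flow]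
          smooth_on_frechet_derivative smooth_flow_inv subset_UNIV)
  qed
  then show "ctendsto k (at 0) UNIV (dilated w (w j) Z') (left_invariant_field (dynkin_product r br) j)"
  proof (rule ctendsto_cong[OF open_UNIV, rotated 2])
    show "(\<Sum>l\<in>UNIV. Y j (flow x) $ l *\<^sub>R ?G x (axis l 1)) = left_invariant_field (dynkin_product r br) j x" for x
      unfolding exp[symmetric] by (simp add: flow_inv_pushforward left_invariant_field_eq)
    fix K :: "(real ^ 'n) set" assume "compact K"
    then have "compact (flow ` K)"
      using smooth_on_continuous[OF smooth_flow] by (blast intro: compact_continuous_image continuous_on_subset)
    from eventually_dil_subset[where w = w, OF w_pos this assms(1,2)]
    show "\<forall>\<^sub>F t in at 0. \<forall>x\<in>K. (\<Sum>l\<in>UNIV. dilated w (w j) Z t (flow x) $ l *\<^sub>R ?G x (axis l 1)) =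
        dilated w (w j) Z' t x"
    proof eventually_elim
      case (elim t)
      show ?case
      proof
        fix x assume "x \<in> K"
        then have U: "flow (dil w t x) \<in> U" using elim by (auto simp: flow_dil)
        have "dil w t (?G x (dilated w (w j) Z t (flow x))) =
            frechet_derivative flow_inv (at (dil w t (flow x))) (t ^ w j *\<^sub>R Z (dil w t (flow x)))"
          using elim by (simp add: dil_dilated flip: frechet_derivative_flow_inv_dil)
        also have "\<dots> = t ^ w j *\<^sub>R Z' (dil w t x)"
          using Z'[OF U] by (simp add: linear_cmul[OF has_derivative_linear[OF D]] flow_dil)
        also have "\<dots> = dil w t (dilated w (w j) Z' t x)" using elim by (simp add: dil_dilated)
        finally have "?G x (dilated w (w j) Z t (flow x)) = dilated w (w j) Z' t x"
          using elim by (simp add: vec_eq_iff)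
        then show "(\<Sum>l\<in>UNIV. dilated w (w j) Z t (flow x) $ l *\<^sub>R ?G x (axis l 1)) = dilated w (w j) Z' t x"
          unfolding exp[symmetric] .
      qed
    qed
  qed
qed

end

section \<open>Frames\<close>

text \<open>A perturbation argument at the one point where the frame is the standard basis: B - c is
  the sum of c_l (Z_l - e_l), so |B - c| \<le> |c| d with d \<rightarrow> 0. Once d < 1/2 this gives
  |c| \<le> 2 |B|, and hence |B - c| \<le> 2 |B| d.\<close>

lemma frame_coefficients_isCont:
  fixes Z :: "'n::finite \<Rightarrow> real ^ 'n \<Rightarrow> real ^ 'n"
  assumes "open U" "0 \<in> U" and Z: "\<And>l. isCont (Z l) 0" "\<And>l. Z l 0 = axis l 1"
    and B: "isCont B 0" "\<And>q. q \<in> U \<Longrightarrow> B q = (\<Sum>l\<in>UNIV. c q $ l *\<^sub>R Z l q)"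
  shows "isCont c 0"
proof -
  define d where "d q = (\<Sum>l\<in>UNIV. norm (Z l q - axis l 1))" for q
  have "(d \<longlongrightarrow> (\<Sum>l\<in>UNIV. norm (Z l 0 - axis l 1))) (at 0)"
    unfolding d_def using Z(1) by (intro tendsto_intros) (auto simp: isCont_def)
  then have d: "(d \<longlongrightarrow> 0) (at 0)" by (simp add: Z(2))
  have B0: "(B \<longlongrightarrow> B 0) (at 0)" using B(1) by (simp add: isCont_def)
  have diff: "norm (B q - c q) \<le> norm (c q) * d q" if "q \<in> U" for q
  proof -
    have "B q - c q = (\<Sum>l\<in>UNIV. c q $ l *\<^sub>R (Z l q - axis l 1))"
      unfolding B(2)[OF that] by (simp add: scaleR_diff_right sum_subtractf sum_scaleR_axis)
    also have "norm \<dots> \<le> (\<Sum>l\<in>UNIV. norm (c q) * norm (Z l q - axis l 1))"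
      by (intro sum_norm_le) (simp add: mult_right_mono component_le_norm_cart)
    finally show ?thesis by (simp add: d_def sum_distrib_left)
  qed
  have "((\<lambda>q. B q - c q) \<longlongrightarrow> 0) (at 0)"
  proof (rule Lim_null_comparison)
    have "\<forall>\<^sub>F q in at 0. q \<in> U"
      using assms(1,2) by (auto simp: eventually_at_topological)
    moreover have "\<forall>\<^sub>F q in at 0. d q < 1 / 2" using d by (rule order_tendstoD) simp
    ultimately show "\<forall>\<^sub>F q in at 0. norm (B q - c q) \<le> 2 * norm (B q) * d q"
    proof eventually_elim
      case (elim q)
      have "0 \<le> d q" by (simp add: d_def sum_nonneg)
      have "norm (c q) * d q \<le> norm (c q) * (1 / 2)" using elim by (intro mult_left_mono) auto
      moreover have "norm (c q) \<le> norm (B q) + norm (B q - c q)"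
        using norm_triangle_ineq4[of "B q" "B q - c q"] by simp
      ultimately have "norm (c q) \<le> 2 * norm (B q)" using diff[OF elim(1)] by simp
      then show ?case using diff[OF elim(1)] \<open>0 \<le> d q\<close> by (meson mult_right_mono order_trans)
    qed
    have "((\<lambda>q. 2 * norm (B q) * d q) \<longlongrightarrow> 2 * norm (B 0) * 0) (at 0)"
      by (intro tendsto_intros B0 d)
    then show "((\<lambda>q. 2 * norm (B q) * d q) \<longlongrightarrow> 0) (at 0)" by simp
  qed
  from tendsto_diff[OF B0 this] have "(c \<longlongrightarrow> B 0) (at 0)" by simp
  moreover have "B 0 = c 0" using B(2)[OF assms(2)] by (simp add: Z(2) sum_scaleR_axis)
  ultimately show ?thesis by (simp add: isCont_def)
qed

lemma span_frame_expansion: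
  fixes e :: "'n::finite \<Rightarrow> 'a::real_vector"
  assumes "inj e" "u \<in> span (e ` S)"
  shows "\<exists>c :: real ^ 'n. u = (\<Sum>l\<in>UNIV. c $ l *\<^sub>R e l) \<and> (\<forall>l. l \<notin> S \<longrightarrow> c $ l = 0)"
proof -
  have "u \<in> range (\<lambda>f. \<Sum>v\<in>e ` S. f v *\<^sub>R v)"
    using assms(2) span_finite[of "e ` S"] by simp
  then obtain f where "u = (\<Sum>v\<in>e ` S. f v *\<^sub>R v)" by auto
  also have "\<dots> = (\<Sum>l\<in>S. f (e l) *\<^sub>R e l)"
    using assms(1) by (subst sum.reindex) (auto simp: inj_on_def)
  also have "\<dots> = (\<Sum>l\<in>UNIV. (\<chi> l. if l \<in> S then f (e l) else 0) $ l *\<^sub>R e l)"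
    by (rule sum.mono_neutral_cong_left) auto
  finally show ?thesis by (intro exI[of _ "\<chi> l. if l \<in> S then f (e l) else 0"]) simp
qed

text \<open>Sending k to \<open>card {..k}\<close> is strictly increasing into 1, ..., n, hence a
  bijection by counting.\<close>

lemma card_Collect_card_atMost_le:
  assumes "m \<le> CARD('n::{finite, linorder})"
  shows "card {k :: 'n. card {..k} \<le> m} = m"
proof -
  let ?f = "\<lambda>k :: 'n. card {..k}"
  have "?f k < ?f l" if "k < l" for k l
    using that by (intro psubset_card_mono) auto
  then have inj: "inj ?f" by (intro linorder_injI) (simp add: less_imp_neq)
  have "?f k \<in> {1..CARD('n)}" for k
  proof -
    have "0 < ?f k" by (simp add: card_gt_0_iff)
    then show ?thesis by (simp add: Suc_le_eq card_mono card_gt_0_iff)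
  qed
  then have "range ?f \<subseteq> {1..CARD('n)}" by blast
  then have r: "range ?f = {1..CARD('n)}"
    using inj by (intro card_subset_eq) (auto simp: card_image)
  have "{k. ?f k \<le> m} = ?f -` {1..m}"
    using r by auto
  also have "card \<dots> = card {1..m}"
    using inj r assms by (intro card_vimage_inj) auto
  finally show ?thesis by simp
qed

section \<open>Charts\<close>

lemma topological_chartD:
  assumes "topological_chart (V, \<phi>)"
  shows "open V" "open (\<phi> ` V)" "inj_on \<phi> V" "continuous_on V \<phi>" "continuous_on (\<phi> ` V) (chart_inv (V, \<phi>))"
    and "\<And>p. p \<in> V \<Longrightarrow> chart_inv (V, \<phi>) (\<phi> p) = p"
proof -
  have h: "open V" "open (\<phi> ` V)" "homeomorphism V (\<phi> ` V) \<phi> (chart_inv (V, \<phi>))"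
    using assms by (auto simp: topological_chart_def)
  show p: "chart_inv (V, \<phi>) (\<phi> p) = p" if "p \<in> V" for p
    using h(3) that by (simp add: homeomorphism_def)
  show "open V" "open (\<phi> ` V)" "continuous_on V \<phi>" "continuous_on (\<phi> ` V) (chart_inv (V, \<phi>))"
    using h by (auto simp: homeomorphism_def)
  show "inj_on \<phi> V"
  proof (rule inj_onI)
    fix x y assume *: "x \<in> V" "y \<in> V" "\<phi> x = \<phi> y"
    show "x = y" by (rule box_equals[OF arg_cong[OF *(3)] p[OF *(1)] p[OF *(2)]])
  qed
qed

lemma smooth_structureD:
  assumes "smooth_structure A"
  shows "c \<in> A \<Longrightarrow> topological_chart c"
    and "c \<in> A \<Longrightarrow> d \<in> A \<Longrightarrow> compatible_charts c d"
    and "topological_chart c \<Longrightarrow> (\<And>d. d \<in> A \<Longrightarrow> compatible_charts c d) \<Longrightarrow> c \<in> A"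
    and "\<exists>c\<in>A. p \<in> fst c"
proof -
  note D = assms[unfolded smooth_structure_def]
  note 1 = conjunct1[OF D] and 2 = conjunct1[OF conjunct2[OF D]]
    and 3 = conjunct1[OF conjunct2[OF conjunct2[OF D]]] and 4 = conjunct2[OF conjunct2[OF conjunct2[OF D]]]
  show "c \<in> A \<Longrightarrow> topological_chart c" "c \<in> A \<Longrightarrow> d \<in> A \<Longrightarrow> compatible_charts c d"
    using 1 3 by blast+
  show "topological_chart c \<Longrightarrow> (\<And>d. d \<in> A \<Longrightarrow> compatible_charts c d) \<Longrightarrow> c \<in> A"
    using 4 by blast
  have "p \<in> \<Union> (fst ` A)" unfolding 2 by simp
  then show "\<exists>c\<in>A. p \<in> fst c" by blast
qed

lemma tangent_spaceD:
  assumes "v \<in> tangent_space A p" "c \<in> A" "c' \<in> A" "p \<in> fst c" "p \<in> fst c'"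
  shows "v c' = frechet_derivative (transition c c') (at (snd c p)) (v c)"
proof -
  have "\<forall>c\<in>A. \<forall>c'\<in>A. p \<in> fst c \<inter> fst c' \<longrightarrow>
      v c' = frechet_derivative (transition c c') (at (snd c p)) (v c)"
    using assms(1) unfolding tangent_space_def mem_Collect_eq by (rule conjunct2)
  from this[rule_format, OF assms(2,3), OF IntI[OF assms(4,5)]] show ?thesis .
qed

lemma open_chart_image:
  assumes "topological_chart (V, \<phi>)" "open W"
  shows "open (\<phi> ` (V \<inter> W))"
proof -
  note c = topological_chartD[OF assms(1)]
  have "open (\<phi> ` V \<inter> chart_inv (V, \<phi>) -` W)"
    by (rule continuous_open_preimage[OF c(5,2) assms(2)])
  also have "\<phi> ` V \<inter> chart_inv (V, \<phi>) -` W = \<phi> ` (V \<inter> W)"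
    using c(6) by auto
  finally show ?thesis .
qed

context
  fixes A :: "('m::topological_space, 'n::finite) chart set" and V :: "'m set" and \<phi> :: "'m \<Rightarrow> real ^ 'n"
    and F G :: "real ^ 'n \<Rightarrow> real ^ 'n"
  assumes A: "smooth_structure A" and chart: "(V, \<phi>) \<in> A"
    and F: "smooth_on UNIV F" and G: "smooth_on UNIV G"
    and FG [simp]: "\<And>y. F (G y) = y" and GF [simp]: "\<And>x. G (F x) = x"
begin

lemma diffeo_image: "(G \<circ> \<phi>) ` S = F -` (\<phi> ` S)"
proof (intro set_eqI iffI)
  fix x assume "x \<in> F -` (\<phi> ` S)"
  then obtain p where "p \<in> S" "F x = \<phi> p" by auto
  then have "x = (G \<circ> \<phi>) p" using GF[of x] by simp
  then show "x \<in> (G \<circ> \<phi>) ` S" using \<open>p \<in> S\<close> by blast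
qed auto

lemma chart_inv_diffeo: "p \<in> V \<Longrightarrow> chart_inv (V, G \<circ> \<phi>) (G (\<phi> p)) = p"
proof -
  assume p: "p \<in> V"
  have "inj_on \<phi> V" by (rule topological_chartD(3)[OF smooth_structureD(1)[OF A chart]])
  moreover have "\<phi> p = \<phi> q" if "G (\<phi> p) = G (\<phi> q)" for p q
    using arg_cong[OF that, of F] by simp
  ultimately have "inj_on (G \<circ> \<phi>) V" by (simp add: inj_on_def)
  from inv_into_f_f[OF this p] show ?thesis by (simp add: chart_inv_def)
qed

lemma topological_chart_diffeo: "topological_chart (V, G \<circ> \<phi>)"
proof -
  have t: "topological_chart (V, \<phi>)" by (rule smooth_structureD(1)[OF A chart])
  note c = topological_chartD[OF t]
  have cont: "continuous_on S F" "continuous_on S G" for S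
    using smooth_on_continuous[OF F] smooth_on_continuous[OF G] continuous_on_subset by blast+
  have "open ((G \<circ> \<phi>) ` V)"
    unfolding diffeo_image using c(2) cont by (intro open_vimage) auto
  moreover have "homeomorphism V ((G \<circ> \<phi>) ` V) (G \<circ> \<phi>) (chart_inv (V, G \<circ> \<phi>))"
    unfolding homeomorphism_def
  proof (intro conjI ballI)
    show "continuous_on V (G \<circ> \<phi>)" by (intro continuous_on_compose c(4) cont)
    have "continuous_on ((G \<circ> \<phi>) ` V) (\<lambda>x. chart_inv (V, \<phi>) (F x))"
      by (rule continuous_on_compose2[OF c(5) cont(1)]) auto
    then show "continuous_on ((G \<circ> \<phi>) ` V) (chart_inv (V, G \<circ> \<phi>))"
      by (rule continuous_on_eq) (auto simp: chart_inv_diffeo c(6))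
  qed (auto simp: chart_inv_diffeo image_iff)
  ultimately show ?thesis using c(1) by (simp add: topological_chart_def)
qed

text \<open>By maximality of the atlas only compatibility has to be checked, and the new transition
  maps are the old ones composed with F or G.\<close>

lemma diffeo_chart_mem: "(V, G \<circ> \<phi>) \<in> A"
proof -
  have "compatible_charts (V, G \<circ> \<phi>) d" if d: "d \<in> A" for d
  proof -
    obtain V1 \<phi>1 where d1: "d = (V1, \<phi>1)" by (cases d)
    have t: "topological_chart (V, \<phi>)" "topological_chart (V1, \<phi>1)" and comp: "compatible_charts (V, \<phi>) (V1, \<phi>1)"
      using smooth_structureD(1,2)[OF A] chart d unfolding d1 by blast+
    note c = topological_chartD[OF t(1)] and c1 = topological_chartD[OF t(2)]
    have o: "open (\<phi> ` (V \<inter> V1))" "open (\<phi>1 ` (V \<inter> V1))"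
      using open_chart_image[OF t(1) c1(1)] open_chart_image[OF t(2) c(1)] by (simp_all add: Int_commute)
    have o': "open ((G \<circ> \<phi>) ` (V \<inter> V1))"
      unfolding diffeo_image using o(1) smooth_on_continuous[OF F] by (intro open_vimage) auto
    have "smooth_on ((G \<circ> \<phi>) ` (V \<inter> V1)) (\<lambda>x. transition (V, \<phi>) (V1, \<phi>1) (F x))"
      by (rule smooth_on_compose[OF o(1) o' _ smooth_on_subset[OF F subset_UNIV]])
         (use comp in \<open>auto simp: compatible_charts_def\<close>)
    then have "smooth_on ((G \<circ> \<phi>) ` (V \<inter> V1)) (transition (V, G \<circ> \<phi>) (V1, \<phi>1))"
      by (rule smooth_on_cong[OF o', rotated]) (auto simp: transition_def chart_inv_diffeo c(6))
    moreover have "smooth_on (\<phi>1 ` (V \<inter> V1)) (\<lambda>x. G (transition (V1, \<phi>1) (V, \<phi>) x))"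
      by (rule smooth_on_compose[OF open_UNIV o(2) G])
         (use comp in \<open>auto simp: compatible_charts_def\<close>)
    then have "smooth_on (\<phi>1 ` (V \<inter> V1)) (transition (V1, \<phi>1) (V, G \<circ> \<phi>))"
      by (simp add: transition_def o_def)
    ultimately show ?thesis by (simp add: compatible_charts_def d1)
  qed
  then show ?thesis by (rule smooth_structureD(3)[OF A topological_chart_diffeo])
qed

text \<open>The transition between the two charts is G itself, so the rule for tangent vectors
  becomes the pushforward by G.\<close>

lemma rep_diffeo:
  assumes "p \<in> V" "X p \<in> tangent_space A p"
  shows "rep (V, G \<circ> \<phi>) X (G (\<phi> p)) = frechet_derivative G (at (\<phi> p)) (rep (V, \<phi>) X (\<phi> p))"
proof -
  have t: "topological_chart (V, \<phi>)" by (rule smooth_structureD(1)[OF A chart])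
  note c = topological_chartD[OF t]
  have "X p (V, G \<circ> \<phi>) = frechet_derivative (transition (V, \<phi>) (V, G \<circ> \<phi>)) (at (\<phi> p)) (X p (V, \<phi>))"
    using tangent_spaceD[OF assms(2) chart diffeo_chart_mem] assms(1) by simp
  also have "frechet_derivative (transition (V, \<phi>) (V, G \<circ> \<phi>)) (at (\<phi> p)) = frechet_derivative G (at (\<phi> p))"
    by (rule frechet_derivative_cong_open(1)[OF c(2)])
       (use assms(1) in \<open>auto simp: transition_def c(6)\<close>)
  finally show ?thesis by (simp only: rep_def chart_inv_diffeo[OF assms(1)] c(6)[OF assms(1)])
qed

end

section \<open>\<open>H\<close>-frames on Carnot manifolds\<close>

context
  fixes A :: "('m::topological_space, 'n::{finite, linorder}) chart set"
    and H :: "nat \<Rightarrow> 'm \<Rightarrow> ('m, 'n) tvec set" and rk :: "nat \<Rightarrow> nat" and r :: nat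
    and a :: 'm and W :: "'m set" and X :: "'n \<Rightarrow> 'm \<Rightarrow> ('m, 'n) tvec"
  assumes carnot: "carnot_manifold A r H rk" and frame: "H_frame A H rk a W X"
begin

lemma
  shows structure_A: "smooth_structure A" and one_le_r: "1 \<le> r"
    and H_subbundle: "\<And>w. w \<in> {1..r} \<Longrightarrow> subbundle A (rk w) (H w)"
    and H_mono: "\<And>w w' p. 1 \<le> w \<Longrightarrow> w \<le> w' \<Longrightarrow> w' \<le> r \<Longrightarrow> H w p \<subseteq> H w' p"
    and H_top: "\<And>p. H r p = tangent_space A p"
    and H_bracket: "\<And>w w' U X Y p. 1 \<le> w \<Longrightarrow> 1 \<le> w' \<Longrightarrow> w + w' \<le> r \<Longrightarrow> smooth_vf A U X \<Longrightarrow>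
      smooth_vf A U Y \<Longrightarrow> (\<And>p. p \<in> U \<Longrightarrow> X p \<in> H w p) \<Longrightarrow> (\<And>p. p \<in> U \<Longrightarrow> Y p \<in> H w' p) \<Longrightarrow> p \<in> U \<Longrightarrow>
      lie_bracket A X Y p \<in> H (w + w') p"
proof -
  note D = carnot[unfolded carnot_manifold_def]
  note 1 = conjunct1[OF D] and D2 = conjunct2[OF D]
  note 2 = conjunct1[OF D2] and D3 = conjunct2[OF D2]
  note 3 = conjunct1[OF D3] and D4 = conjunct2[OF D3]
  note 4 = conjunct1[OF D4] and D5 = conjunct2[OF D4]
  note 5 = conjunct1[OF D5] and 6 = conjunct2[OF D5]
  show "smooth_structure A" "1 \<le> r" by (fact 1, fact 2)
  show "\<And>w. w \<in> {1..r} \<Longrightarrow> subbundle A (rk w) (H w)" using 3 by blast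
  show "\<And>w w' p. 1 \<le> w \<Longrightarrow> w \<le> w' \<Longrightarrow> w' \<le> r \<Longrightarrow> H w p \<subseteq> H w' p" using 4 by blast
  show "\<And>p. H r p = tangent_space A p" using 5 by blast
  fix w w' U X Y p
  assume "1 \<le> w" "1 \<le> w'" "w + w' \<le> r" "smooth_vf A U X"
      "smooth_vf A U Y" "\<And>p. p \<in> U \<Longrightarrow> X p \<in> H w p" "\<And>p. p \<in> U \<Longrightarrow> Y p \<in> H w' p" "p \<in> U"
  then show "lie_bracket A X Y p \<in> H (w + w') p"
    using 6[rule_format, of w w' U X Y p] by simp
qed

lemma
  shows open_W: "open W" and a_W: "a \<in> W" and X_smooth: "\<And>j. smooth_vf A W (X j)"
    and X_H: "\<And>j p. p \<in> W \<Longrightarrow> X j p \<in> H (weight rk j) p"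
    and X_inj: "\<And>p c. p \<in> W \<Longrightarrow> c \<in> A \<Longrightarrow> p \<in> fst c \<Longrightarrow> inj (\<lambda>j. X j p c)"
    and X_indep: "\<And>p c. p \<in> W \<Longrightarrow> c \<in> A \<Longrightarrow> p \<in> fst c \<Longrightarrow> independent (range (\<lambda>j. X j p c))"
    and X_span: "\<And>p c. p \<in> W \<Longrightarrow> c \<in> A \<Longrightarrow> p \<in> fst c \<Longrightarrow> span (range (\<lambda>j. X j p c)) = UNIV"
  using frame unfolding H_frame_def by blast+

lemma X_tangent: "p \<in> W \<Longrightarrow> X j p \<in> tangent_space A p"
  using X_smooth[of j] by (simp add: smooth_vf_def)

lemma H_fibre:
  assumes "w \<in> {1..r}" "c \<in> A" "p \<in> fst c"
  shows "subspace ((\<lambda>v. v c) ` H w p)" and "dim ((\<lambda>v. v c) ` H w p) = rk w"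
proof -
  from H_subbundle[OF assms(1), unfolded subbundle_def, THEN conjunct2, THEN spec[of _ p]]
  obtain U Y where UY: "open U \<and> p \<in> U \<and> (\<forall>i<rk w. smooth_vf A U (Y i)) \<and>
      (\<forall>q\<in>U. \<forall>c\<in>A. q \<in> fst c \<longrightarrow>
        (\<lambda>v. v c) ` H w q = span ((\<lambda>i::nat. Y i q c) ` {..<rk w}) \<and> dim ((\<lambda>v. v c) ` H w q) = rk w)"
    by (elim exE) (rule that)
  have "p \<in> U" by (rule conjunct1[OF conjunct2[OF UY]])
  note * = conjunct2[OF conjunct2[OF conjunct2[OF UY]], rule_format]
  from *[OF \<open>p \<in> U\<close> assms(2,3)]
  show "subspace ((\<lambda>v. v c) ` H w p)" and "dim ((\<lambda>v. v c) ` H w p) = rk w" by auto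
qed

lemma chart_at_a: "\<exists>c\<in>A. a \<in> fst c"
  by (rule smooth_structureD(4)[OF structure_A])

lemma rk_r: "rk r = CARD('n)"
proof -
  obtain c where c: "c \<in> A" "a \<in> fst c" using chart_at_a by blast
  have r: "r \<in> {1..r}" using one_le_r by simp
  have "range (\<lambda>j. X j a c) \<subseteq> (\<lambda>v. v c) ` H r a"
    using X_tangent[OF a_W] by (auto simp: H_top)
  then have "(\<lambda>v. v c) ` H r a = UNIV"
    using span_minimal[OF _ H_fibre(1)[OF r c]] X_span[OF a_W c] by blast
  then show ?thesis using H_fibre(2)[OF r c] by (simp add: dim_UNIV)
qed

lemma rk_mono:
  assumes "1 \<le> w" "w \<le> w'" "w' \<le> r"
  shows "rk w \<le> rk w'"
proof -
  obtain c where c: "c \<in> A" "a \<in> fst c" using chart_at_a by blast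
  have "dim ((\<lambda>v. v c) ` H w a) \<le> dim ((\<lambda>v. v c) ` H w' a)"
    by (rule dim_subset, rule image_mono, rule H_mono[OF assms])
  then show ?thesis using H_fibre(2)[OF _ c] assms by simp
qed

lemma weight_bounds:
  fixes j :: 'n
  shows "1 \<le> weight rk j" "weight rk j \<le> r" "card {..j} \<le> rk (weight rk j)"
proof -
  have P: "1 \<le> r \<and> card {..j} \<le> rk r" 
    using one_le_r card_mono[OF finite_class.finite_UNIV subset_UNIV, of "{..j}"] by (simp add: rk_r)
  show "1 \<le> weight rk j" "card {..j} \<le> rk (weight rk j)"
    using LeastI[of "\<lambda>w. 1 \<le> w \<and> card {..j} \<le> rk w", OF P] unfolding weight_def by auto
  show "weight rk j \<le> r"
    unfolding weight_def using P by (rule Least_le)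
qed

lemma card_weight_le:
  assumes "w \<in> {1..r}"
  shows "card {k :: 'n. weight rk k \<le> w} = rk w"
proof -
  have "weight rk k \<le> w \<longleftrightarrow> card {..k} \<le> rk w" for k :: 'n
  proof
    assume "weight rk k \<le> w"
    then have "rk (weight rk k) \<le> rk w"
      by (rule rk_mono[OF weight_bounds(1)]) (use assms in simp)
    with weight_bounds(3) show "card {..k} \<le> rk w" by (rule order_trans)
  next
    assume "card {..k} \<le> rk w"
    then show "weight rk k \<le> w"
      unfolding weight_def using assms by (intro Least_le) simp
  qed
  moreover have "rk w \<le> CARD('n)" using rk_mono[of w r] assms by (simp add: rk_r)
  ultimately show ?thesis by (simp add: card_Collect_card_atMost_le)
qed

text \<open>The frame fields of weight at most w lie in the fibre of H_w, are independent and number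
  rk w, so they form a basis of it.\<close>

lemma H_subset_span:
  assumes "w \<in> {1..r}" "p \<in> W" "c \<in> A" "p \<in> fst c" "v \<in> H w p"
  shows "v c \<in> span ((\<lambda>k. X k p c) ` {k. weight rk k \<le> w})"
proof -
  let ?B = "(\<lambda>k. X k p c) ` {k. weight rk k \<le> w}"
  have "?B \<subseteq> (\<lambda>v. v c) ` H w p"
  proof
    fix u assume "u \<in> ?B"
    then obtain k where k: "weight rk k \<le> w" "u = X k p c" by auto
    have "X k p \<in> H w p"
      using X_H[OF assms(2), of k] H_mono[OF weight_bounds(1) k(1)] assms(1) by auto
    then show "u \<in> (\<lambda>v. v c) ` H w p" using k by blast
  qed
  moreover have "independent ?B"
    by (rule independent_mono[OF X_indep[OF assms(2-4)]]) auto
  moreover have "card ?B = rk w"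
    using card_weight_le[OF assms(1)] card_image[OF inj_on_subset[OF X_inj[OF assms(2-4)] subset_UNIV]] by simp
  ultimately have "(\<lambda>v. v c) ` H w p \<subseteq> span ?B"
    using H_fibre(2)[OF assms(1,3,4)] by (intro card_ge_dim_independent) auto
  then show ?thesis using assms(5) by blast
qed

context
  fixes V :: "'m set" and \<phi> :: "'m \<Rightarrow> real ^ 'n::{finite, linorder}"
  assumes adapted: "linearly_adapted A X a (V, \<phi>)"
begin

abbreviation "Z j \<equiv> rep (V, \<phi>) (X j)"

lemma chart_V: "(V, \<phi>) \<in> A" and a_V: "a \<in> V" and \<phi>_a: "\<phi> a = 0" and Z_0: "Z j 0 = axis j 1"
  using adapted by (auto simp: linearly_adapted_def)

lemmas chart_props = topological_chartD[OF smooth_structureD(1)[OF structure_A chart_V]]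

lemma rep_chart: "p \<in> V \<Longrightarrow> rep (V, \<phi>) Y (\<phi> p) = Y p (V, \<phi>)"
  by (simp only: rep_def chart_props(6))

lemma open_chart_frame: "open (\<phi> ` (V \<inter> W))" and zero_chart_frame: "0 \<in> \<phi> ` (V \<inter> W)"
  using open_chart_image[OF smooth_structureD(1)[OF structure_A chart_V] open_W] a_V a_W \<phi>_a
  by auto

lemma smooth_Z: "smooth_on (\<phi> ` (V \<inter> W)) (Z j)"
  using X_smooth[of j] chart_V by (auto simp: smooth_vf_def)

definition chart_bracket :: "'n \<Rightarrow> 'n \<Rightarrow> real ^ 'n::{finite, linorder} \<Rightarrow> real ^ 'n::{finite, linorder}" where
  "chart_bracket i j q = frechet_derivative (Z j) (at q) (Z i q) - frechet_derivative (Z i) (at q) (Z j q)"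

lemma lie_bracket_chart:
  "p \<in> V \<Longrightarrow> lie_bracket A (X i) (X j) p (V, \<phi>) = chart_bracket i j (\<phi> p)"
  using chart_V by (simp add: lie_bracket_def chart_bracket_def rep_chart)

lemma isCont_Z: "isCont (Z j) 0"
  using smooth_on_differentiable[OF smooth_Z zero_chart_frame] differentiable_imp_continuous_within by blast

lemma isCont_chart_bracket: "isCont (chart_bracket i j) 0"
proof -
  have D: "smooth_on (\<phi> ` (V \<inter> W)) (\<lambda>q. frechet_derivative (Z j) (at q) (Z i q))" for i j
  proof -
    have "smooth_on (\<phi> ` (V \<inter> W)) (\<lambda>q. \<Sum>l\<in>UNIV. Z i q $ l *\<^sub>R frechet_derivative (Z j) (at q) (axis l 1))"
      by (intro smooth_on_sum smooth_on_scaleR open_chart_frame smooth_on_frechet_derivative smooth_Z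
          smooth_on_bounded_linear_compose[OF open_chart_frame bounded_linear_vec_nth])
    then show ?thesis
      by (rule smooth_on_cong[OF open_chart_frame, rotated])
         (rule linear_vec_expansion[symmetric, OF has_derivative_linear[OF smooth_on_has_derivative[OF smooth_Z]]])
  qed
  have "isCont (\<lambda>q. frechet_derivative (Z j) (at q) (Z i q)) 0" for i j
    using smooth_on_differentiable[OF D zero_chart_frame] differentiable_imp_continuous_within by blast
  then show ?thesis unfolding chart_bracket_def[abs_def] by (intro continuous_diff)
qed

text \<open>When w_i + w_j exceeds r the bracket condition is silent, but then all weights lie
  within the bound and any expansion in the frame will do.\<close>

lemma ex_bracket_coefficients:
  assumes "q \<in> \<phi> ` (V \<inter> W)"
  shows "\<exists>c :: real ^ 'n::{finite, linorder}. chart_bracket i j q = (\<Sum>l\<in>UNIV. c $ l *\<^sub>R Z l q) \<and>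
    (\<forall>l. weight rk i + weight rk j < weight rk l \<longrightarrow> c $ l = 0)"
proof -
  obtain p where p: "p \<in> V" "p \<in> W" "q = \<phi> p" using assms by auto
  have pc: "p \<in> fst (V, \<phi>)" using p by simp
  have Z: "Z l q = X l p (V, \<phi>)" for l using p by (simp add: rep_chart)
  have "chart_bracket i j q \<in> span ((\<lambda>k. X k p (V, \<phi>)) ` {k. weight rk k \<le> weight rk i + weight rk j})"
  proof (cases "weight rk i + weight rk j \<le> r")
    case True
    have "lie_bracket A (X i) (X j) p \<in> H (weight rk i + weight rk j) p"
      by (rule H_bracket[OF weight_bounds(1) weight_bounds(1) True X_smooth X_smooth X_H X_H p(2)])
    then have "lie_bracket A (X i) (X j) p (V, \<phi>) \<in>
        span ((\<lambda>k. X k p (V, \<phi>)) ` {k. weight rk k \<le> weight rk i + weight rk j})"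
      using True weight_bounds(1)[of i] by (intro H_subset_span[OF _ p(2) chart_V pc]) auto
    then show ?thesis using p by (simp add: lie_bracket_chart)
  next
    case False
    then have "weight rk k \<le> weight rk i + weight rk j" for k :: 'n
      using weight_bounds(2)[of k] by linarith
    then have "{k :: 'n. weight rk k \<le> weight rk i + weight rk j} = UNIV" by blast
    then show ?thesis using X_span[OF p(2) chart_V pc] by simp
  qed
  from span_frame_expansion[OF X_inj[OF p(2) chart_V pc] this] show ?thesis
    by (auto simp: Z not_le)
qed

text \<open>For \<open>weight rk i + weight rk j \<le> r\<close> the bracket condition makes the Lie bracket a tangent vector, so
  its coefficients agree in all charts; other pairs do not enter the bracket of \<open>G(a)\<close>.\<close>

lemma structure_coeff_eq:
  assumes "weight rk i + weight rk j \<le> r"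
  shows "structure_coeff A X a i j = chart_bracket i j 0"
proof -
  define v where "v = lie_bracket A (X i) (X j) a"
  have "v \<in> H (weight rk i + weight rk j) a"
    unfolding v_def
    by (rule H_bracket[OF weight_bounds(1) weight_bounds(1) assms X_smooth X_smooth X_H X_H a_W])
  then have tangent: "v \<in> tangent_space A a"
    using H_mono[of "weight rk i + weight rk j" r a] assms weight_bounds(1)[of i] by (auto simp: H_top)
  \<comment> \<open>In this chart the frame at a is the standard basis, so coefficients are simply
    components.\<close>
  have axis: "(\<Sum>k\<in>UNIV. (l $ k) *\<^sub>R X k a (V, \<phi>)) = l" for l
  proof -
    have "X k a (V, \<phi>) = axis k 1" for k using rep_chart[OF a_V, of "X k"] Z_0[of k] \<phi>_a by simp
    then show ?thesis by (simp only: sum_scaleR_axis)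
  qed
  have v0: "v (V, \<phi>) = chart_bracket i j 0"
    using lie_bracket_chart[OF a_V] by (simp add: v_def \<phi>_a)
  have eq: "v c = (\<Sum>k\<in>UNIV. (chart_bracket i j 0 $ k) *\<^sub>R X k a c)" if c: "c \<in> A" "a \<in> fst c" for c
  proof -
    let ?D = "frechet_derivative (transition (V, \<phi>) c) (at (\<phi> a))"
    have t: "u c = ?D (u (V, \<phi>))" if "u \<in> tangent_space A a" for u
      using tangent_spaceD[OF that chart_V c(1) _ c(2)] a_V by simp
    have "compatible_charts (V, \<phi>) c" by (rule smooth_structureD(2)[OF structure_A chart_V c(1)])
    then have "smooth_on (\<phi> ` (V \<inter> fst c)) (transition (V, \<phi>) c)" by (simp add: compatible_charts_def)
    then have lin: "linear ?D"
      using c(2) a_V by (intro linear_frechet_derivative smooth_on_differentiable) auto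
    have "v c = ?D (\<Sum>k\<in>UNIV. (chart_bracket i j 0 $ k) *\<^sub>R X k a (V, \<phi>))"
      unfolding t[OF tangent] axis v0 ..
    also have "\<dots> = (\<Sum>k\<in>UNIV. (chart_bracket i j 0 $ k) *\<^sub>R X k a c)"
      by (simp add: linear_sum[OF lin] linear_cmul[OF lin] t[OF X_tangent[OF a_W]])
    finally show ?thesis .
  qed
  show ?thesis
    unfolding structure_coeff_def v_def[symmetric]
  proof (rule the_equality)
    show "\<forall>c\<in>A. a \<in> fst c \<longrightarrow> v c = (\<Sum>k\<in>UNIV. (chart_bracket i j 0 $ k) *\<^sub>R X k a c)"
      using eq by blast
    fix l :: "real ^ 'n::{finite, linorder}"
    assume l: "\<forall>c\<in>A. a \<in> fst c \<longrightarrow> v c = (\<Sum>k\<in>UNIV. (l $ k) *\<^sub>R X k a c)"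
    have "v (V, \<phi>) = (\<Sum>k\<in>UNIV. (l $ k) *\<^sub>R X k a (V, \<phi>))"
      using l chart_V a_V by simp
    then show "l = chart_bracket i j 0" unfolding axis v0 by (rule sym)
  qed
qed

lemma graded_fields_model:
  assumes "\<And>j. is_model_field (weight rk) (weight rk j) (Z j) (Y j)"
  shows "graded_fields (weight rk) r (structure_coeff A X a) Y"
proof -
  interpret model_fields "weight rk" "\<phi> ` (V \<inter> W)" Z Y
    by unfold_locales (use weight_bounds(1) open_chart_frame zero_chart_frame smooth_Z Z_0 assms in auto)
  show ?thesis
  proof
    show "1 \<le> weight rk j" for j :: 'n by (rule weight_bounds(1))
    show "weight rk j \<le> r" for j :: 'n by (rule weight_bounds(2))
    show "polynomial_function (Y j)" for j using assms[of j] by (simp add: is_model_field_def)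
    show "s ^ weight rk j * Y j (dil (weight rk) s x) $ k = s ^ weight rk k * Y j x $ k" for s j x k
      by (rule model_homogeneous)
    show "Y j 0 = axis j 1" for j by (rule model_0)
    \<comment> \<open>The weight of k is at most r, so w_i + w_j \<le> r, the range where
      \<open>structure_coeff\<close> is known to be the bracket in the chart.\<close>
    show "structure_coeff A X a j i $ k = - structure_coeff A X a i j $ k"
      if "weight rk k = weight rk i + weight rk j" for i j k
      using that weight_bounds(2)[of k] by (simp add: structure_coeff_eq chart_bracket_def add.commute)
    fix i j p
    have "\<forall>q. \<exists>c :: real ^ 'n::{finite, linorder}. q \<in> \<phi> ` (V \<inter> W) \<longrightarrow> chart_bracket i j q = (\<Sum>l\<in>UNIV. c $ l *\<^sub>R Z l q) \<and>
        (\<forall>l. weight rk i + weight rk j < weight rk l \<longrightarrow> c $ l = 0)"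
      using ex_bracket_coefficients by blast
    from choice[OF this] obtain c :: "real ^ 'n::{finite, linorder} \<Rightarrow> real ^ 'n::{finite, linorder}" where
      c': "\<forall>q. q \<in> \<phi> ` (V \<inter> W) \<longrightarrow> chart_bracket i j q = (\<Sum>l\<in>UNIV. c q $ l *\<^sub>R Z l q) \<and>
        (\<forall>l. weight rk i + weight rk j < weight rk l \<longrightarrow> c q $ l = 0)"
      by (elim exE) (rule that)
    have c: "chart_bracket i j q = (\<Sum>l\<in>UNIV. c q $ l *\<^sub>R Z l q)" if "q \<in> \<phi> ` (V \<inter> W)" for q
      by (rule conjunct1[OF c'[THEN spec, THEN mp, OF that]])
    have c0: "c q $ l = 0" if "q \<in> \<phi> ` (V \<inter> W)" "weight rk i + weight rk j < weight rk l" for q l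
      by (rule conjunct2[OF c'[THEN spec, THEN mp, OF that(1)], THEN spec, THEN mp, OF that(2)])
    \<comment> \<open>The choice of c brings no regularity; continuity at 0 follows from that of the
      frame and of the bracket.\<close>
    have "isCont c 0"
      by (rule frame_coefficients_isCont[OF open_chart_frame zero_chart_frame isCont_Z Z_0 isCont_chart_bracket c])
    from model_bracket[OF c[unfolded chart_bracket_def] c0 this, of p]
    have "frechet_derivative (Y j) (at p) (Y i p) - frechet_derivative (Y i) (at p) (Y j p) =
      (\<Sum>l | weight rk l = weight rk i + weight rk j. c 0 $ l *\<^sub>R Y l p)" .
    also have "\<dots> = (\<Sum>l | weight rk l = weight rk i + weight rk j. structure_coeff A X a i j $ l *\<^sub>R Y l p)"
    proof (intro sum.cong refl)
      fix l :: 'n assume "l \<in> {l. weight rk l = weight rk i + weight rk j}"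
      then have "weight rk i + weight rk j \<le> r" using weight_bounds(2)[of l] by simp
      moreover have "chart_bracket i j 0 = c 0"
        unfolding c[OF zero_chart_frame] Z_0 by (rule sum_scaleR_axis)
      ultimately show "c 0 $ l *\<^sub>R Y l p = structure_coeff A X a i j $ l *\<^sub>R Y l p"
        by (simp add: structure_coeff_eq)
    qed
    finally show "frechet_derivative (Y j) (at p) (Y i p) - frechet_derivative (Y i) (at p) (Y j p) =
      (\<Sum>k | weight rk k = weight rk i + weight rk j. structure_coeff A X a i j $ k *\<^sub>R Y k p)" .
  qed
qed

lemma carnot_coordinates_inv_exp_fields:
  assumes model: "\<And>j. is_model_field (weight rk) (weight rk j) (Z j) (Y j)"
  shows "carnot_coordinates A r rk X a (V, inv (exp_fields Y) \<circ> \<phi>)"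
proof -
  interpret graded_fields "weight rk" r "structure_coeff A X a" Y
    using model by (rule graded_fields_model)
  define Z' where "Z' j = rep (V, flow_inv \<circ> \<phi>) (X j)" for j
  let ?U = "\<phi> ` (V \<inter> W)" and ?L = "left_invariant_field (dynkin_product r (lie_alg_bracket (weight rk) (structure_coeff A X a)))"
  have inA: "(V, flow_inv \<circ> \<phi>) \<in> A"
    by (rule diffeo_chart_mem[OF structure_A chart_V smooth_flow smooth_flow_inv flow_flow_inv flow_inv_flow])
  have Z': "Z' j x = frechet_derivative flow_inv (at (flow x)) (Z j (flow x))" if x: "flow x \<in> ?U" for j x
  proof -
    obtain p where p: "p \<in> V" "p \<in> W" "flow x = \<phi> p" using x by blast
    then have "x = flow_inv (\<phi> p)" by (metis flow_inv_flow)
    then show ?thesis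
      using rep_diffeo[OF structure_A chart_V smooth_flow smooth_flow_inv flow_flow_inv flow_inv_flow p(1),
          where X = "X j", OF X_tangent[OF p(2)]] p(3)
      by (simp add: Z'_def)
  qed
  have model': "is_model_field (weight rk) (weight rk j) (Z' j) (?L j)" for j
    by (rule is_model_field_flow_pullback[OF open_chart_frame zero_chart_frame smooth_Z model Z'])
  have Z'_0: "Z' j 0 = axis j 1" for j
  proof -
    \<comment> \<open>Z_j and Y_j agree at 0, so the value there is that of the left-invariant
      field.\<close>
    have "Z' j 0 = frechet_derivative flow_inv (at (flow 0)) (Y j (flow 0))"
      using Z'[of 0 j] zero_chart_frame by (simp add: Z_0 Y_0)
    also have "\<dots> = axis j 1"
      unfolding flow_inv_pushforward left_invariant_field_eq[symmetric] by (rule left_invariant_field_0)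
    finally show ?thesis .
  qed
  have "flow_inv 0 = 0" using flow_inv_flow[of 0] by simp
  then have "linearly_adapted A X a (V, flow_inv \<circ> \<phi>)"
    using inA a_V \<phi>_a Z'_0 by (simp add: linearly_adapted_def Z'_def)
  moreover have "has_order (weight rk) Z' (\<lambda>x. x $ j) (weight rk j) 0" for j
  proof -
    have "open ((flow_inv \<circ> \<phi>) ` (V \<inter> W))"
      by (rule open_chart_image[OF smooth_structureD(1)[OF structure_A inA] open_W])
    moreover have "0 \<in> (flow_inv \<circ> \<phi>) ` (V \<inter> W)"
      using a_V a_W \<phi>_a \<open>flow_inv 0 = 0\<close> by (intro image_eqI[of _ _ a]) auto
    moreover have "smooth_on ((flow_inv \<circ> \<phi>) ` (V \<inter> W)) (Z' j)" for j
      using X_smooth[of j] inA by (auto simp: smooth_vf_def Z'_def)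
    ultimately interpret model_fields "weight rk" "(flow_inv \<circ> \<phi>) ` (V \<inter> W)" Z' ?L
      by unfold_locales (use weight_bounds(1) Z'_0 model' in auto)
    show ?thesis by (rule has_order_coordinate)
  qed
  ultimately show ?thesis
    using model'
    by (simp add: carnot_coordinates_def privileged_coordinates_def group_mult_def exp_fields_eq_flow
        flow_inv_def[symmetric] Z'_def[abs_def])
qed

end

end

theorem proposition7p2:
  fixes A :: "('m::{t2_space, second_countable_topology}, 'n::{finite, linorder}) chart set"
    and H :: "nat \<Rightarrow> 'm \<Rightarrow> ('m, 'n) tvec set"
    and rk :: "nat \<Rightarrow> nat"
    and r :: nat
    and a :: 'm
    and W :: "'m set"
    and X :: "'n \<Rightarrow> 'm \<Rightarrow> ('m, 'n) tvec"
    and V :: "'m set"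
    and \<kappa> :: "'m \<Rightarrow> real ^ 'n::{finite, linorder}"
    and \<epsilon> :: "real ^ 'n::{finite, linorder} \<Rightarrow> real ^ 'n::{finite, linorder}"
  assumes "carnot_manifold A r H rk"
    and "H_frame A H rk a W X"
    and "(V, \<kappa>) \<in> A" and "a \<in> V"
    and "eps_carnot_map A rk X a (V, \<kappa>) \<epsilon>"
  shows "carnot_coordinates A r rk X a (V, \<epsilon> \<circ> \<kappa>)"
proof -
  from assms(5)[unfolded eps_carnot_map_def fst_conv snd_conv]
  obtain T P Y where *: "affine_map T \<and> linearly_adapted A X a (V, T \<circ> \<kappa>) \<and>
     lower_weight_polynomial_map (weight rk) P \<and>
     privileged_coordinates A rk X a (V, P \<circ> T \<circ> \<kappa>) \<and>
     (\<forall>j. is_model_field (weight rk) (weight rk j) (rep (V, P \<circ> T \<circ> \<kappa>) (X j)) (Y j)) \<and>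
     \<epsilon> = inv (exp_fields Y) \<circ> (P \<circ> T)"
    by (elim exE) (rule that)
  then have \<epsilon>: "\<epsilon> = inv (exp_fields Y) \<circ> (P \<circ> T)" by (elim conjE)
  have model: "is_model_field (weight rk) (weight rk j) (rep (V, P \<circ> T \<circ> \<kappa>) (X j)) (Y j)" for j
    using * by (elim conjE allE)
  from * have "privileged_coordinates A rk X a (V, P \<circ> T \<circ> \<kappa>)" by (elim conjE)
  then have "linearly_adapted A X a (V, P \<circ> T \<circ> \<kappa>)" by (simp add: privileged_coordinates_def)
  from carnot_coordinates_inv_exp_fields[OF assms(1,2) this model]
  show ?thesis unfolding \<epsilon> by (simp only: comp_assoc)
qed

end
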